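(* Let $\zeta\in G\setminus\{0\}$ and let $f,g:G\times G\to\mathbb{C}$ be arbitrary functions such that $L_aL_b=f(a,b)L_{a+b}+g(a,b)L_{a+b+\zeta}$ ($a,b\in G$) defines a CLSAS $W$ on $\mathcal{W}$. Then $W$ is isomorphic to one of: $V_{\alpha,\theta}$ with $\alpha,\theta\in\mathbb{C}$, $\theta=0$ or $\theta^{-1}\notin G$; $V^{\gamma,\lambda}$ with $\gamma\in\mathbb{C}$, $\lambda\in G$, $\lambda\neq\gamma$; or $W(\alpha,\mu,\zeta)$ with $\alpha,\mu\in\mathbb{C}$.
   Context: $G$ is a free (additive) subgroup of $\mathbb{C}$ of rank $\nu>1$. The high rank Witt algebra $\mathcal{W}$ has basis $\{L_a\mid a\in G\}$ and bracket $[L_a,L_b]=(b-a)L_{a+b}$. A left-symmetric algebra is a complex vector space with bilinear product satisfying $(xy)z-x(yz)=(yx)z-y(xz)$; a compatible left-symmetric algebraic structure (CLSAS) on a Lie algebra $\mathfrak g$ is such a product on $\mathfrak g$ with $xy-yx=[x,y]$. $V_{\alpha,\theta}$ is the CLSAS on $\mathcal{W}$ with $L_bL_c=\frac{(\alpha+c+\alpha\theta b)(1+\theta c)}{1+\theta(b+c)}L_{b+c}$. $V^{\gamma,\lambda}$ is the CLSAS with $L_bL_c=(\lambda+c)L_{b+c}$ if $\lambda+b+c\neq0$ and $L_bL_c=\frac{(\lambda+c)(\gamma-\lambda-c)}{\gamma-\lambda}L_{-\lambda}$ if $\lambda+b+c=0$. $W(\alpha,\mu,\zeta)$ is the CLSAS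 with $L_aL_b=(\alpha+b)L_{a+b}+\mu L_{a+b+\zeta}$. *)

theory Defs
  imports Main Complex_Main
begin

definition free_subgroup_rank_gt1 :: "complex set \<Rightarrow> bool" where
  "free_subgroup_rank_gt1 G \<longleftrightarrow>
     0 \<in> G \<and> (\<forall>x\<in>G. \<forall>y\<in>G. x + y \<in> G \<and> - x \<in> G) \<and>
     (\<exists>B. B \<subseteq> G \<and>
        (\<forall>S c. finite S \<longrightarrow> S \<subseteq> B \<longrightarrow> (\<Sum>b\<in>S. of_int (c b) * b) = 0 \<longrightarrow> (\<forall>b\<in>S. c b = (0::int))) \<and>
        G = {(\<Sum>b\<in>S. of_int (c b) * b) | S c. finite S \<and> S \<subseteq> B} \<and>
        \<not> (finite B \<and> card B \<le> 1))"

text \<open>Elements of the Witt algebra: finitely supported coefficient functions on G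
  (x a is the coefficient of L_a).\<close>

definition supp :: "(complex \<Rightarrow> complex) \<Rightarrow> complex set" where
  "supp x = {a. x a \<noteq> 0}"

definition Wsp :: "complex set \<Rightarrow> (complex \<Rightarrow> complex) set" where
  "Wsp G = {x. finite (supp x) \<and> supp x \<subseteq> G}"

text \<open>Bilinear product determined by structure constants: L_a L_b = sum_d sc a b d L_d.\<close>

definition mulsc :: "(complex \<Rightarrow> complex \<Rightarrow> complex \<Rightarrow> complex) \<Rightarrow>
    (complex \<Rightarrow> complex) \<Rightarrow> (complex \<Rightarrow> complex) \<Rightarrow> (complex \<Rightarrow> complex)" where
  "mulsc sc x y = (\<lambda>d. \<Sum>a\<in>supp x. \<Sum>b\<in>supp y. x a * y b * sc a b d)"

definition witt_sc :: "complex \<Rightarrow> complex \<Rightarrow> complex \<Rightarrow> complex" where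
  "witt_sc a b d = (if d = a + b then b - a else 0)"

definition CLSAS :: "complex set \<Rightarrow> (complex \<Rightarrow> complex \<Rightarrow> complex \<Rightarrow> complex) \<Rightarrow> bool" where
  "CLSAS G sc \<longleftrightarrow>
     (\<forall>x\<in>Wsp G. \<forall>y\<in>Wsp G. \<forall>z\<in>Wsp G.
        (\<forall>d. mulsc sc (mulsc sc x y) z d - mulsc sc x (mulsc sc y z) d
        = mulsc sc (mulsc sc y x) z d - mulsc sc y (mulsc sc x z) d)) \<and>
     (\<forall>x\<in>Wsp G. \<forall>y\<in>Wsp G. \<forall>d. mulsc sc x y d - mulsc sc y x d = mulsc witt_sc x y d)"

definition iso_alg :: "complex set \<Rightarrow> (complex \<Rightarrow> complex \<Rightarrow> complex \<Rightarrow> complex) \<Rightarrow>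
    (complex \<Rightarrow> complex \<Rightarrow> complex \<Rightarrow> complex) \<Rightarrow> bool" where
  "iso_alg G sc1 sc2 \<longleftrightarrow>
     (\<exists>\<phi>. bij_betw \<phi> (Wsp G) (Wsp G) \<and>
        (\<forall>x\<in>Wsp G. \<forall>y\<in>Wsp G. \<phi> (\<lambda>a. x a + y a) = (\<lambda>a. \<phi> x a + \<phi> y a)) \<and>
        (\<forall>x\<in>Wsp G. \<forall>c. \<phi> (\<lambda>a. c * x a) = (\<lambda>a. c * \<phi> x a)) \<and>
        (\<forall>x\<in>Wsp G. \<forall>y\<in>Wsp G. \<phi> (mulsc sc1 x y) = mulsc sc2 (\<phi> x) (\<phi> y)))"

definition fg_sc :: "complex \<Rightarrow> (complex \<Rightarrow> complex \<Rightarrow> complex) \<Rightarrow> (complex \<Rightarrow> complex \<Rightarrow> complex)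
    \<Rightarrow> complex \<Rightarrow> complex \<Rightarrow> complex \<Rightarrow> complex" where
  "fg_sc \<zeta> f g a b d = (if d = a + b then f a b else 0) + (if d = a + b + \<zeta> then g a b else 0)"

definition V_sc :: "complex \<Rightarrow> complex \<Rightarrow> complex \<Rightarrow> complex \<Rightarrow> complex \<Rightarrow> complex" where
  "V_sc \<alpha> \<theta> b c d = (if d = b + c then
      (\<alpha> + c + \<alpha> * \<theta> * b) * (1 + \<theta> * c) / (1 + \<theta> * (b + c)) else 0)"

definition Vup_sc :: "complex \<Rightarrow> complex \<Rightarrow> complex \<Rightarrow> complex \<Rightarrow> complex \<Rightarrow> complex" where
  "Vup_sc \<gamma> lam b c d = (if d = b + c then
      (if lam + b + c \<noteq> 0 then lam + c else (lam + c) * (\<gamma> - lam - c) / (\<gamma> - lam)) else 0)"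

definition Wamz_sc :: "complex \<Rightarrow> complex \<Rightarrow> complex \<Rightarrow> complex \<Rightarrow> complex \<Rightarrow> complex \<Rightarrow> complex" where
  "Wamz_sc \<alpha> \<mu> \<zeta> a b d = (if d = a + b then \<alpha> + b else 0) + (if d = a + b + \<zeta> then \<mu> else 0)"

end

theory Submission
  imports Defs "HOL-Computational_Algebra.Polynomial"
begin

text \<open>Comparing coefficients, \<open>f\<close> alone defines a graded structure, and \<open>g\<close> is a symmetric
  solution of a linear cocycle equation and a quadratic equation.

  Left multiplication by \<open>L_a\<close> makes the space a module over the Witt algebra with one-dimensional
  weight spaces. On a chain \<open>c + \<int>a\<close> the products of \<open>f\<close> along closed paths are polynomials in
  the weight, which forces, far out on the chain and after rescaling the basis, the action
  \<open>L_{ia} v = (x + \<beta> i a) v'\<close> of an intermediate series module. Commuting \<open>L_b\<close> with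
  \<open>L_{\<plusminus>a}\<close> and \<open>L_{\<plusminus>2a}\<close> gives an overdetermined linear system whose determinant forces \<open>\<beta>\<close> to
  be the same for all chains and all directions, and hence determines all products along closed
  paths of length two and three. The relation \<open>f a b - f b a = b - a\<close> fixes the rescaling: for
  \<open>\<alpha> = f 0 0 \<noteq> 0\<close> because \<open>f a 0 = \<alpha>\<close>, and for \<open>\<alpha> = 0\<close> because the equation
  \<open>(a - b) S (a + b) = a S a - b S b\<close> has only affine solutions. So \<open>f\<close> is literally one of
  the listed families.

  Finally \<open>g\<close> is determined by \<open>g 0\<close>; the two equations make it constant if \<open>f a b = \<alpha> + b\<close> and
  zero otherwise, so the identity map is the required isomorphism.\<close>

text \<open>The obstacle is that structure constants may vanish, so basis vectors can be rescaled
  consistently only at the far end of a chain, where the affine factors are nonzero. Hence the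
  filter \<open>at_top\<close>: identities are proved there with rescaled vectors, and exact
  recurrences for products along closed paths, which no rescaling changes, fix the remaining
  constants and carry the values back to every weight. Paths of length two see only
  \<open>\<beta> * (1 - \<beta>)\<close> and so confuse \<beta> with 1 - \<beta>. Paths of length
  three separate the two, except for 0 and 1, whose products agree. The normalisation \<beta>
  \<noteq> 1 therefore makes the weight unique. For \<alpha> \<noteq> 0 the parameter of the generic
  family is \<open>\<theta> = \<beta> / \<alpha>\<close>. For \<alpha> = 0 every path starting at 0
  has product zero, which is why that case needs its own argument.\<close>

lemma eventually_shift_int:
  fixes P :: "int \<Rightarrow> bool"
  assumes "\<forall>\<^sub>F n in at_top. P n"
  shows "\<forall>\<^sub>F n in at_top. P (n + k)"
proof -
  obtain N where "\<And>n. n \<ge> N \<Longrightarrow> P n"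
    using assms by (auto simp: eventually_at_top_linorder)
  then have "\<And>n. n \<ge> N - k \<Longrightarrow> P (n + k)" by auto
  then show ?thesis by (auto simp: eventually_at_top_linorder)
qed

lemma eventually_poly_nonzero:
  fixes p :: "complex poly"
  assumes "p \<noteq> 0" "d \<noteq> 0"
  shows "\<forall>\<^sub>F n :: int in at_top. poly p (x + of_int n * d) \<noteq> 0"
proof -
  let ?S = "{n :: int. poly p (x + of_int n * d) = 0}"
  have "inj (\<lambda>n :: int. x + of_int n * d)"
    using assms(2) by (auto simp: inj_on_def)
  moreover have "?S = (\<lambda>n. x + of_int n * d) -` {z. poly p z = 0}" by auto
  ultimately have "finite ?S"
    using poly_roots_finite[OF assms(1)] by (metis finite_vimageI)
  then obtain N where "\<And>n. n \<in> ?S \<Longrightarrow> n \<le> N"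
    by (meson Max_ge)
  then have "\<And>n. n \<ge> N + 1 \<Longrightarrow> poly p (x + of_int n * d) \<noteq> 0" by fastforce
  then show ?thesis by (auto simp: eventually_at_top_linorder)
qed

text \<open>Infinitely many zeros force a polynomial to vanish. Degree four is what
  \<open>witt_chain_structure\<close> needs; comparisons of lower degree are padded with zero
  coefficients.\<close>

lemma frequently_quartic_zero:
  fixes c0 c1 c2 c3 c4 :: complex
  assumes "\<exists>\<^sub>F n :: int in at_top. let z = x + of_int n * d in
      c0 + c1 * z + c2 * z^2 + c3 * z^3 + c4 * z^4 = 0" and "d \<noteq> 0"
  shows "c0 = 0" "c1 = 0" "c2 = 0" "c3 = 0" "c4 = 0"
proof -
  have "[:c0, c1, c2, c3, c4:] = 0"
  proof (rule ccontr)
    assume "[:c0, c1, c2, c3, c4:] \<noteq> 0"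
    from eventually_poly_nonzero[OF this \<open>d \<noteq> 0\<close>, of x]
    have "\<not> (\<exists>\<^sub>F n :: int in at_top. let z = x + of_int n * d in
      c0 + c1 * z + c2 * z^2 + c3 * z^3 + c4 * z^4 = 0)"
      unfolding frequently_def not_not
      by eventually_elim (simp add: Let_def algebra_simps power2_eq_square power3_eq_cube power4_eq_xxxx)
    then show False using assms(1) by contradiction
  qed
  then show "c0 = 0" "c1 = 0" "c2 = 0" "c3 = 0" "c4 = 0" by simp_all
qed

lemma eventually_imp_frequently_int:
  assumes "\<forall>\<^sub>F n :: int in at_top. P n"
  shows "\<exists>\<^sub>F n in at_top. P n"
  using assms by (simp add: eventually_frequently)

lemma int_const_if_shift_invariant:
  fixes g :: "int \<Rightarrow> 'a"
  assumes "\<And>n. g n = g (n - 1)"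
  shows "g n = g 0"
proof (induction n rule: int_induct[of _ 0])
  case (step1 i) then show ?case using assms[of "i + 1"] by simp
next
  case (step2 i) then show ?case using assms[of i] by simp
qed simp

lemma eventually_affine_nonzero:
  fixes x d :: complex
  assumes "d \<noteq> 0"
  shows "\<forall>\<^sub>F n :: int in at_top. x + of_int n * d \<noteq> 0"
  using eventually_poly_nonzero[of "[:0,1:]" d x] assms by simp

section \<open>Additive subgroups and a functional equation with affine solutions\<close>

locale add_subgroup =
  fixes G :: "complex set"
  assumes zero_in: "0 \<in> G" and add_in: "\<And>x y. x \<in> G \<Longrightarrow> y \<in> G \<Longrightarrow> x + y \<in> G"
    and neg_in: "\<And>x. x \<in> G \<Longrightarrow> - x \<in> G"
begin

lemma of_int_mult_in: "a \<in> G \<Longrightarrow> of_int k * a \<in> G"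
proof (induction k rule: int_induct[of _ 0])
  case (step1 i) then show ?case using add_in[of "of_int i * a" a] by (simp add: algebra_simps)
next
  case (step2 i) then show ?case using add_in[of "of_int i * a" "- a"] neg_in[of a] by (simp add: algebra_simps)
qed (simp add: zero_in)

lemma numeral_mult_in: "a \<in> G \<Longrightarrow> numeral k * a \<in> G"
  using of_int_mult_in[of a "numeral k"] by simp

lemma diff_in: "x \<in> G \<Longrightarrow> y \<in> G \<Longrightarrow> x - y \<in> G"
  using add_in[of x "- y"] neg_in[of y] by simp

lemmas in_G = zero_in add_in neg_in diff_in of_int_mult_in numeral_mult_in

text \<open>Every affine function solves the equation; subtracting the one that agrees with
  \<open>g\<close> at \<open>e\<close> and \<open>2 e\<close> leaves a solution that vanishes identically.\<close>

lemma affine_if_weighted_additive: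
  fixes g :: "complex \<Rightarrow> complex"
  assumes e: "e \<in> G" "e \<noteq> 0"
    and eq: "\<And>a b. a \<in> G \<Longrightarrow> b \<in> G \<Longrightarrow> a \<noteq> 0 \<Longrightarrow> b \<noteq> 0 \<Longrightarrow> a + b \<noteq> 0 \<Longrightarrow>
      (a - b) * g (a + b) = a * g a - b * g b"
  obtains p q where "\<And>a. a \<in> G \<Longrightarrow> a \<noteq> 0 \<Longrightarrow> g a = p + q * a"
proof -
  define q where "q = (g (2 * e) - g e) / e"
  define p where "p = 2 * g e - g (2 * e)"
  define h where "h a = g a - p - q * a" for a
  have he: "h e = 0" "h (2 * e) = 0" using e by (simp_all add: h_def p_def q_def field_simps)
  have heq: "(a - b) * h (a + b) = a * h a - b * h b"
    if "a \<in> G" "b \<in> G" "a \<noteq> 0" "b \<noteq> 0" "a + b \<noteq> 0" for a b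
    using eq[OF that] by (simp add: h_def algebra_simps)
  have e2: "2 * e \<in> G" using e by (simp add: in_G)
  have e3: "3 * e \<in> G" using e by (simp add: in_G)
  \<comment> \<open>The two zeros \<open>e\<close> and \<open>2 * e\<close> give two ways from
    \<open>h x\<close> to \<open>h (x + 2 * e)\<close>; they differ by the factor
    \<open>2 * e^2\<close>.\<close>
  have main: "h x = 0" if x: "x \<in> G" "x \<noteq> 0" "x + e \<noteq> 0" "x + 2 * e \<noteq> 0" for x
  proof -
    have "(x - e) * h (x + e) = x * h x" using heq[of x e] x e he by simp
    moreover have "(x - 2 * e) * h (x + 2 * e) = x * h x" using heq[of x "2 * e"] x e e2 he by simp
    moreover have "x * h (x + 2 * e) = (x + e) * h (x + e)"
      using heq[of "x + e" e] x e he add_in[OF x(1) e(1)] by (simp add: algebra_simps)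
    ultimately have "x * (2 * e^2 * h x) = 0" by algebra
    then show ?thesis using x e by simp
  qed
  \<comment> \<open>The points \<open>- e\<close> and \<open>- 2 * e\<close> escape
    \<open>main\<close>; pairing each with \<open>3 * e\<close> gives the sums \<open>2 * e\<close>
    and \<open>e\<close>, which are known zeros.\<close>
  have "h (3 * e) = 0" using main[of "3 * e"] e e3 by (simp add: algebra_simps)
  then have "h (- e) = 0" "h (- 2 * e) = 0"
    using heq[of "3 * e" "- e"] heq[of "3 * e" "- 2 * e"] e e2 e3 neg_in[OF e(1)] neg_in[OF e2] he
    by auto
  then have "h a = 0" if "a \<in> G" "a \<noteq> 0" for a
    using main[OF that] by (metis add_eq_0_iff2 mult_minus_left)
  then show ?thesis using that[of p q] by (simp add: h_def diff_eq_eq add.commute)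
qed

end

section \<open>Chains of weight vectors\<close>

text \<open>The four closed products \<open>D\<close>, \<open>D2\<close>, \<open>T\<close>,
  \<open>T'\<close> satisfy difference equations with polynomial right-hand sides, so each is a
  polynomial in \<open>Y n\<close> up to a constant of summation. Regrouping factors gives
  \<open>T n * T' n = D2 n * D n * D (n + 1)\<close>, and comparing coefficients there leaves only
  the choice between \<beta> and 1 - \<beta>.\<close>

lemma witt_chain_structure:
  fixes F :: "int \<Rightarrow> int \<Rightarrow> complex" and Y :: "int \<Rightarrow> complex" and y :: complex
  assumes rel: "\<And>j k n. (of_int k - of_int j) * F (j + k) n = F k n * F j (n + k) - F j n * F k (n + j)"
    and F0: "\<And>n. F 0 n = Y n" and Y: "\<And>n. Y n = y + of_int n"
  obtains \<beta> where "\<beta> \<noteq> 1"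
    "\<And>n. F 1 n * F (-1) (n + 1) = (Y n + \<beta>) * (Y n + 1 - \<beta>)"
    "\<And>n. F 2 n * F (-2) (n + 2) = Y n * (Y n + 2) + 4 * (\<beta> * (1 - \<beta>))"
    "\<And>n. F 2 n * F (-1) (n + 2) * F (-1) (n + 1) = (Y n + 2 * \<beta>) * (Y n + 1 - \<beta>) * (Y n + 2 - \<beta>)"
    "\<And>n. F (-2) (n + 2) * F 1 n * F 1 (n + 1) = (Y n + 2 - 2 * \<beta>) * (Y n + \<beta>) * (Y n + 1 + \<beta>)"
proof -
  have Ym: "Y (n - 1) = Y n - 1" "Y (n - 2) = Y n - 2" "Y (n + 1) = Y n + 1" for n
    by (simp_all add: Y)
  define D where "D n = F 1 n * F (-1) (n + 1)" for n
  define T where "T n = F 2 n * F (-1) (n + 2) * F (-1) (n + 1)" for n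
  define T' where "T' n = F (-2) (n + 2) * F 1 n * F 1 (n + 1)" for n
  define D2 where "D2 n = F 2 n * F (-2) (n + 2)" for n
  have D: "D n = D (n - 1) + 2 * Y n" for n
    using rel[of "-1" 1 n] by (simp add: D_def F0 algebra_simps)
  have T: "T n = T (n - 1) + 3 * D n" for n
  proof -
    have "F (-1) (n + 1) * (3 * F 1 n) = F (-1) (n + 1) * (F 2 n * F (-1) (n + 2) - F (-1) n * F 2 (n - 1))"
      using rel[of 2 "-1" n] by simp
    then show ?thesis by (simp add: T_def D_def algebra_simps)
  qed
  have T': "T' n = T' (n - 1) + 3 * D n" for n
  proof -
    have "F 1 n * (3 * F (-1) (n + 1)) = F 1 n * (F 1 (n + 1) * F (-2) (n + 2) - F (-2) (n + 1) * F 1 (n - 1))"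
      using rel[of "-2" 1 "n + 1"] by (simp add: algebra_simps)
    then show ?thesis by (simp add: T'_def D_def algebra_simps)
  qed
  have D2: "D2 n = D2 (n - 2) + 4 * Y n" for n
    using rel[of "-2" 2 n] by (simp add: D2_def F0 algebra_simps)
  have TT': "T n * T' n = D2 n * D n * D (n + 1)" for n
    by (simp add: T_def T'_def D_def D2_def add.commute)
  define K where "K = D 0 - Y 0 * (Y 0 + 1)"
  have DK: "D n = Y n * (Y n + 1) + K" for n
  proof -
    have "D n - Y n * (Y n + 1) = D 0 - Y 0 * (Y 0 + 1)"
    proof (rule int_const_if_shift_invariant)
      fix n show "D n - Y n * (Y n + 1) = D (n - 1) - Y (n - 1) * (Y (n - 1) + 1)"
        using D[of n] unfolding Ym by (simp add: algebra_simps)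
    qed
    then show ?thesis by (simp add: K_def algebra_simps)
  qed
  define \<beta> where "\<beta> = (1 + csqrt (1 - 4 * K)) / 2"
  have K: "\<beta> * (1 - \<beta>) = K"
  proof -
    have "2 * \<beta> - 1 = csqrt (1 - 4 * K)" by (simp add: \<beta>_def field_simps)
    then have "(2 * \<beta> - 1)\<^sup>2 = 1 - 4 * K" by simp
    then have "4 * (\<beta> * (1 - \<beta>)) = 4 * K" by (simp add: power2_eq_square algebra_simps)
    then show ?thesis unfolding mult_cancel_left by simp
  qed
  \<comment> \<open>The value of \<open>T\<close> in the intermediate series module of weight
    \<open>b\<close>; \<open>Q (1 - b)\<close> is that of \<open>T'\<close>. The two cubics differ
    only in the constant term.\<close>
  define Q where "Q b z = (z + 2 * b) * (z + 1 - b) * (z + 2 - b)" for b z :: complex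
  have QK: "Q \<beta> z = z^3 + 3 * z^2 + (2 + 3 * K) * z + 2 * K * (2 - \<beta>)"
    and QK': "Q (1 - \<beta>) z = z^3 + 3 * z^2 + (2 + 3 * K) * z + 2 * K * (1 + \<beta>)" for z
    unfolding Q_def K[symmetric] by (simp_all add: algebra_simps power2_eq_square power3_eq_cube)
  define k where "k = T 0 - Q \<beta> (Y 0)"
  define k' where "k' = T' 0 - Q (1 - \<beta>) (Y 0)"
  have Qd: "Q \<beta> (z - 1) = Q \<beta> z - 3 * (z * (z + 1) + K)"
     "Q (1 - \<beta>) (z - 1) = Q (1 - \<beta>) z - 3 * (z * (z + 1) + K)" for z
    unfolding QK QK' by (simp_all add: algebra_simps power2_eq_square power3_eq_cube)
  have Tk: "T n = Q \<beta> (Y n) + k" for n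
  proof -
    have "T n - Q \<beta> (Y n) = T 0 - Q \<beta> (Y 0)"
    proof (rule int_const_if_shift_invariant)
      fix n show "T n - Q \<beta> (Y n) = T (n - 1) - Q \<beta> (Y (n - 1))"
        using T[of n] unfolding Ym Qd DK by (simp add: algebra_simps)
    qed
    then show ?thesis by (simp add: k_def algebra_simps)
  qed
  have Tk': "T' n = Q (1 - \<beta>) (Y n) + k'" for n
  proof -
    have "T' n - Q (1 - \<beta>) (Y n) = T' 0 - Q (1 - \<beta>) (Y 0)"
    proof (rule int_const_if_shift_invariant)
      fix n show "T' n - Q (1 - \<beta>) (Y n) = T' (n - 1) - Q (1 - \<beta>) (Y (n - 1))"
        using T'[of n] unfolding Ym Qd DK by (simp add: algebra_simps)
    qed
    then show ?thesis by (simp add: k'_def algebra_simps)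
  qed
  \<comment> \<open>The recurrence of \<open>D2\<close> has step two, so its constant might depend
    on the parity of \<open>i\<close>. In the quartic below, degree 4 gives
    \<open>\<delta> = 0\<close>, degree 3 gives \<open>k' = - k\<close>, and the constant term gives
    the last equation.\<close>
  have parity: "D2 i - Y i * (Y i + 2) = 4 * K \<and> k' = - k \<and> k * (k - 2 * K * (2 * \<beta> - 1)) = 0" for i
  proof -
    define e where "e = D2 i - Y i * (Y i + 2)"
    have e: "D2 (i + 2 * m) = Y (i + 2 * m) * (Y (i + 2 * m) + 2) + e" for m
    proof -
      have "D2 (i + 2 * m) - Y (i + 2 * m) * (Y (i + 2 * m) + 2)
          = D2 (i + 2 * 0) - Y (i + 2 * 0) * (Y (i + 2 * 0) + 2)"
      proof (rule int_const_if_shift_invariant)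
        fix m :: int
        have i: "i + 2 * (m - 1) = i + 2 * m - 2" by simp
        show "D2 (i + 2 * m) - Y (i + 2 * m) * (Y (i + 2 * m) + 2)
          = D2 (i + 2 * (m - 1)) - Y (i + 2 * (m - 1)) * (Y (i + 2 * (m - 1)) + 2)"
          using D2[of "i + 2 * m"] unfolding i Ym
          by (simp add: algebra_simps)
      qed
      then show ?thesis by (simp add: e_def algebra_simps)
    qed
    define \<delta> where "\<delta> = e - 4 * K"
    have pol: "(k * k' + 2 * K * (1 + \<beta>) * k + 2 * K * (2 - \<beta>) * k' - \<delta> * (K * (2 + K)))
        + ((k + k') * (2 + 3 * K) - \<delta> * (2 + 4 * K)) * z + (3 * (k + k') - \<delta> * (5 + 2 * K)) * z^2
        + (k + k' - 4 * \<delta>) * z^3 + (- \<delta>) * z^4 = 0" if z: "z = Y (i + 2 * m)" for m z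
    proof -
      have DD: "D (i + 2 * m) = z^2 + z + K" "D (i + 2 * m + 1) = z^2 + 3 * z + 2 + K"
        unfolding DK z by (simp_all add: Y algebra_simps power2_eq_square)
      have QQ: "Q \<beta> z * Q (1 - \<beta>) z = (z * (z + 2) + 4 * K) * (z^2 + z + K) * (z^2 + 3 * z + 2 + K)"
        unfolding Q_def K[symmetric] by algebra
      have "(Q \<beta> z + k) * (Q (1 - \<beta>) z + k') = (z * (z + 2) + e) * (z^2 + z + K) * (z^2 + 3 * z + 2 + K)"
        using TT'[of "i + 2 * m"] unfolding Tk Tk' e DD z[symmetric] .
      note prod = this
      have "k * Q (1 - \<beta>) z + k' * Q \<beta> z + k * k'
          = (Q \<beta> z + k) * (Q (1 - \<beta>) z + k') - Q \<beta> z * Q (1 - \<beta>) z" by (simp add: algebra_simps)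
      also have "\<dots> = \<delta> * ((z^2 + z + K) * (z^2 + 3 * z + 2 + K))"
        unfolding prod QQ \<delta>_def by (simp add: left_diff_distrib distrib_right mult.assoc)
      finally have *: "k * Q (1 - \<beta>) z + k' * Q \<beta> z + k * k' - \<delta> * ((z^2 + z + K) * (z^2 + 3 * z + 2 + K)) = 0"
        by simp
      show ?thesis by (rule trans[OF _ *], unfold QK QK') algebra
    qed
    have "\<forall>\<^sub>F m :: int in at_top. let z = Y i + of_int m * 2 in
        (k * k' + 2 * K * (1 + \<beta>) * k + 2 * K * (2 - \<beta>) * k' - \<delta> * (K * (2 + K)))
        + ((k + k') * (2 + 3 * K) - \<delta> * (2 + 4 * K)) * z + (3 * (k + k') - \<delta> * (5 + 2 * K)) * z^2
        + (k + k' - 4 * \<delta>) * z^3 + (- \<delta>) * z^4 = 0"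
      unfolding Let_def by (intro always_eventually allI pol) (simp add: Y)
    note c = frequently_quartic_zero[OF eventually_imp_frequently_int[OF this], simplified]
    have "\<delta> = 0" "k' = - k" using c(4,5) by (simp_all add: add_eq_0_iff2)
    then show ?thesis using c(1) unfolding \<delta>_def e_def by (auto simp: algebra_simps)
  qed
  have D2K: "D2 n = Y n * (Y n + 2) + 4 * K" for n using parity[of n] by (simp add: algebra_simps)
  have "\<exists>b. b * (1 - b) = K \<and> (\<forall>n. T n = Q b (Y n)) \<and> (\<forall>n. T' n = Q (1 - b) (Y n))"
  proof (cases "k = 0")
    case True then show ?thesis using parity[of 0] K Tk Tk' by auto
  next
    \<comment> \<open>The nonzero value of \<open>k\<close> is exactly the difference of the
      constant terms of \<open>Q (1 - \<beta>)\<close> and \<open>Q \<beta>\<close>, so the other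
      root takes over.\<close>
    case False
    then have "k = 2 * K * (2 * \<beta> - 1)" "k' = - (2 * K * (2 * \<beta> - 1))" using parity[of 0] by auto
    then have "(1 - \<beta>) * (1 - (1 - \<beta>)) = K \<and> (\<forall>n. T n = Q (1 - \<beta>) (Y n)) \<and> (\<forall>n. T' n = Q (1 - (1 - \<beta>)) (Y n))"
      unfolding Tk Tk' using K by (simp add: QK QK' algebra_simps)
    then show ?thesis by blast
  qed
  then obtain b0 where b0: "b0 * (1 - b0) = K" "\<And>n. T n = Q b0 (Y n)" "\<And>n. T' n = Q (1 - b0) (Y n)"
    by blast
  \<comment> \<open>Weights 0 and 1 give the same four products.\<close>
  define b where "b = (if b0 = 1 then 0 else b0)"
  have b: "b \<noteq> 1" "b * (1 - b) = K" "\<And>n. T n = Q b (Y n)" "\<And>n. T' n = Q (1 - b) (Y n)"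
    using b0 by (auto simp: b_def Q_def algebra_simps)
  show ?thesis
  proof (rule that[OF b(1)])
    fix n
    show "F 1 n * F (-1) (n + 1) = (Y n + b) * (Y n + 1 - b)"
      using DK[of n] unfolding D_def b(2)[symmetric] by (simp add: algebra_simps)
    show "F 2 n * F (-2) (n + 2) = Y n * (Y n + 2) + 4 * (b * (1 - b))"
      using D2K[of n] unfolding D2_def b(2) .
    show "F 2 n * F (-1) (n + 2) * F (-1) (n + 1) = (Y n + 2 * b) * (Y n + 1 - b) * (Y n + 2 - b)"
      using b(3)[of n] unfolding T_def Q_def .
    show "F (-2) (n + 2) * F 1 n * F 1 (n + 1) = (Y n + 2 - 2 * b) * (Y n + b) * (Y n + 1 + b)"
      using b(4)[of n] unfolding T'_def Q_def by (simp add: algebra_simps)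
  qed
qed

section \<open>Operators between two chains\<close>

text \<open>In the next three lemmas \<open>m k\<close> is the action of \<open>L_{b + ka}\<close> from one chain to another, in the
  normalisation where \<open>L_{ia}\<close> acts on the two chains by \<open>y + \<beta>\<^sub>1 i\<close> and \<open>y + \<nu> + \<beta>\<^sub>2 i\<close>. The
  commutators with \<open>L_{\<plusminus>a}\<close> and \<open>L_{\<plusminus>2a}\<close> give three homogeneous linear equations for three
  consecutive values of \<open>m 0\<close>.\<close>

lemma equivariant_three_term:
  fixes m :: "int \<Rightarrow> int \<Rightarrow> complex" and y \<nu> \<beta>\<^sub>1 \<beta>\<^sub>2 :: complex
  assumes rel: "\<forall>i\<in>{1, -1, 2, -2}. \<forall>k. \<forall>\<^sub>F j in at_top.
      (\<nu> + of_int k - of_int i) * m (k + i) j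
      = m k j * (y + of_int j + \<nu> + of_int k + \<beta>\<^sub>2 * of_int i) - (y + of_int j + \<beta>\<^sub>1 * of_int i) * m k (j + i)"
  shows "\<forall>\<^sub>F j in at_top. let Y = y + of_int j; Z = Y + \<nu> in
      (Y - \<beta>\<^sub>1) * (Z - (1 - \<beta>\<^sub>2)) * m 0 (j - 1)
      - (2 * Y * Z + 2 + \<beta>\<^sub>1 * (1 - \<beta>\<^sub>1) + \<beta>\<^sub>2 * (1 - \<beta>\<^sub>2)) * m 0 j
      + (Y + \<beta>\<^sub>1) * (Z + (1 - \<beta>\<^sub>2)) * m 0 (j + 1) = 0"
    and "\<forall>\<^sub>F j in at_top. let Y = y + of_int j; Z = Y + \<nu> in
      ((\<nu> - 2) * (Z - 1 + \<beta>\<^sub>2) * (Z + \<beta>\<^sub>2) - \<nu> * (\<nu> - 1) * (Z - 1 + 2 * \<beta>\<^sub>2)) * m 0 (j - 1)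
      - 2 * (\<nu> - 2) * (Y - 1 + \<beta>\<^sub>1) * (Z + \<beta>\<^sub>2) * m 0 j
      + ((\<nu> - 2) * (Y - 1 + \<beta>\<^sub>1) * (Y + \<beta>\<^sub>1) + \<nu> * (\<nu> - 1) * (Y - 1 + 2 * \<beta>\<^sub>1)) * m 0 (j + 1) = 0"
    and "\<forall>\<^sub>F j in at_top. let Y = y + of_int j; Z = Y + \<nu> in
      ((\<nu> + 2) * (Y + 1 - \<beta>\<^sub>1) * (Y - \<beta>\<^sub>1) + (\<nu> + 1) * \<nu> * (Y + 1 - 2 * \<beta>\<^sub>1)) * m 0 (j - 1)
      - 2 * (\<nu> + 2) * (Y + 1 - \<beta>\<^sub>1) * (Z - \<beta>\<^sub>2) * m 0 j
      + ((\<nu> + 2) * (Z + 1 - \<beta>\<^sub>2) * (Z - \<beta>\<^sub>2) - (\<nu> + 1) * \<nu> * (Z + 1 - 2 * \<beta>\<^sub>2)) * m 0 (j + 1) = 0"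
proof -
  note sh = eventually_shift_int
  note r = rel[rule_format]
  show "\<forall>\<^sub>F j in at_top. let Y = y + of_int j; Z = Y + \<nu> in
      (Y - \<beta>\<^sub>1) * (Z - (1 - \<beta>\<^sub>2)) * m 0 (j - 1)
      - (2 * Y * Z + 2 + \<beta>\<^sub>1 * (1 - \<beta>\<^sub>1) + \<beta>\<^sub>2 * (1 - \<beta>\<^sub>2)) * m 0 j
      + (Y + \<beta>\<^sub>1) * (Z + (1 - \<beta>\<^sub>2)) * m 0 (j + 1) = 0"
    using r[of 1 0, simplified] sh[OF r[of 1 0], of "-1", simplified] r[of "-1" 1, simplified]
  proof eventually_elim
    case (elim j)
    define p q r u v Y where "p = m 0 j" and "q = m 0 (j - 1)" and "r = m 0 (j + 1)"
      and "u = m 1 j" and "v = m 1 (j - 1)" and "Y = y + of_int j"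
    have e1: "(\<nu> - 1) * u = p * (Y + \<nu> + \<beta>\<^sub>2) - (Y + \<beta>\<^sub>1) * r"
      and e2: "(\<nu> - 1) * v = q * (Y - 1 + \<nu> + \<beta>\<^sub>2) - (Y - 1 + \<beta>\<^sub>1) * p"
      and e3: "(\<nu> + 2) * p = u * (Y + \<nu> + 1 - \<beta>\<^sub>2) - (Y - \<beta>\<^sub>1) * v"
      using elim by (simp_all add: p_def q_def r_def u_def v_def Y_def algebra_simps)
    \<comment> \<open>\<open>u\<close> and \<open>v\<close> are eliminated by multiplying with
      \<open>\<nu> - 1\<close>, which may be zero, rather than dividing.\<close>
    have "((\<nu> - 1) * u) * (Y + \<nu> + 1 - \<beta>\<^sub>2) - (Y - \<beta>\<^sub>1) * ((\<nu> - 1) * v) = (\<nu> - 1) * ((\<nu> + 2) * p)"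
      unfolding e3 by (simp add: algebra_simps)
    note el = this[unfolded e1 e2]
    have "(Y - \<beta>\<^sub>1) * (Y + \<nu> - (1 - \<beta>\<^sub>2)) * q
      - (2 * Y * (Y + \<nu>) + 2 + \<beta>\<^sub>1 * (1 - \<beta>\<^sub>1) + \<beta>\<^sub>2 * (1 - \<beta>\<^sub>2)) * p
      + (Y + \<beta>\<^sub>1) * (Y + \<nu> + (1 - \<beta>\<^sub>2)) * r = 0"
      using el by algebra
    then show ?case by (simp add: Let_def p_def q_def r_def Y_def)
  qed
  show "\<forall>\<^sub>F j in at_top. let Y = y + of_int j; Z = Y + \<nu> in
      ((\<nu> - 2) * (Z - 1 + \<beta>\<^sub>2) * (Z + \<beta>\<^sub>2) - \<nu> * (\<nu> - 1) * (Z - 1 + 2 * \<beta>\<^sub>2)) * m 0 (j - 1)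
      - 2 * (\<nu> - 2) * (Y - 1 + \<beta>\<^sub>1) * (Z + \<beta>\<^sub>2) * m 0 j
      + ((\<nu> - 2) * (Y - 1 + \<beta>\<^sub>1) * (Y + \<beta>\<^sub>1) + \<nu> * (\<nu> - 1) * (Y - 1 + 2 * \<beta>\<^sub>1)) * m 0 (j + 1) = 0"
    using r[of 1 0, simplified] sh[OF r[of 1 0], of "-1", simplified]
      sh[OF r[of 1 1], of "-1", simplified] sh[OF r[of 2 0], of "-1", simplified]
  proof eventually_elim
    case (elim j)
    define p q r u v w Y where "p = m 0 j" and "q = m 0 (j - 1)" and "r = m 0 (j + 1)"
      and "u = m 1 j" and "v = m 1 (j - 1)" and "w = m 2 (j - 1)" and "Y = y + of_int j"
    have e1: "(\<nu> - 1) * u = p * (Y + \<nu> + \<beta>\<^sub>2) - (Y + \<beta>\<^sub>1) * r"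
      and e2: "(\<nu> - 1) * v = q * (Y - 1 + \<nu> + \<beta>\<^sub>2) - (Y - 1 + \<beta>\<^sub>1) * p"
      and e3: "\<nu> * w = v * (Y + \<nu> + \<beta>\<^sub>2) - (Y - 1 + \<beta>\<^sub>1) * u"
      and e4: "(\<nu> - 2) * w = q * (Y - 1 + \<nu> + 2 * \<beta>\<^sub>2) - (Y - 1 + 2 * \<beta>\<^sub>1) * r"
      using elim by (simp_all add: p_def q_def r_def u_def v_def w_def Y_def algebra_simps)
    \<comment> \<open>\<open>w\<close> belongs to \<open>L_{b + 2a}\<close>, which is reached both
      by two commutators with \<open>L_a\<close> and by one with \<open>L_{2a}\<close>; equating the
      two results gives the equation. The third claim mirrors this with \<open>-a\<close>.\<close>
    have "(\<nu> - 2) * (((\<nu> - 1) * v) * (Y + \<nu> + \<beta>\<^sub>2) - (Y - 1 + \<beta>\<^sub>1) * ((\<nu> - 1) * u)) = (\<nu> - 2) * ((\<nu> - 1) * (\<nu> * w))"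
      unfolding e3 by (simp add: algebra_simps)
    also have "\<dots> = (\<nu> - 1) * \<nu> * ((\<nu> - 2) * w)" by (simp add: algebra_simps)
    finally have el: "(\<nu> - 2) * ((q * (Y - 1 + \<nu> + \<beta>\<^sub>2) - (Y - 1 + \<beta>\<^sub>1) * p) * (Y + \<nu> + \<beta>\<^sub>2)
        - (Y - 1 + \<beta>\<^sub>1) * (p * (Y + \<nu> + \<beta>\<^sub>2) - (Y + \<beta>\<^sub>1) * r))
        = (\<nu> - 1) * \<nu> * (q * (Y - 1 + \<nu> + 2 * \<beta>\<^sub>2) - (Y - 1 + 2 * \<beta>\<^sub>1) * r)" unfolding e1 e2 e4 .
    have "((\<nu> - 2) * (Y + \<nu> - 1 + \<beta>\<^sub>2) * (Y + \<nu> + \<beta>\<^sub>2) - \<nu> * (\<nu> - 1) * (Y + \<nu> - 1 + 2 * \<beta>\<^sub>2)) * q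
      - 2 * (\<nu> - 2) * (Y - 1 + \<beta>\<^sub>1) * (Y + \<nu> + \<beta>\<^sub>2) * p
      + ((\<nu> - 2) * (Y - 1 + \<beta>\<^sub>1) * (Y + \<beta>\<^sub>1) + \<nu> * (\<nu> - 1) * (Y - 1 + 2 * \<beta>\<^sub>1)) * r = 0"
      using el by algebra
    then show ?case by (simp add: Let_def p_def q_def r_def Y_def)
  qed
  show "\<forall>\<^sub>F j in at_top. let Y = y + of_int j; Z = Y + \<nu> in
      ((\<nu> + 2) * (Y + 1 - \<beta>\<^sub>1) * (Y - \<beta>\<^sub>1) + (\<nu> + 1) * \<nu> * (Y + 1 - 2 * \<beta>\<^sub>1)) * m 0 (j - 1)
      - 2 * (\<nu> + 2) * (Y + 1 - \<beta>\<^sub>1) * (Z - \<beta>\<^sub>2) * m 0 j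
      + ((\<nu> + 2) * (Z + 1 - \<beta>\<^sub>2) * (Z - \<beta>\<^sub>2) - (\<nu> + 1) * \<nu> * (Z + 1 - 2 * \<beta>\<^sub>2)) * m 0 (j + 1) = 0"
    using r[of "-1" 0, simplified] sh[OF r[of "-1" 0], of 1, simplified]
      sh[OF r[of "-1" "-1"], of 1, simplified] sh[OF r[of "-2" 0], of 1, simplified]
  proof eventually_elim
    case (elim j)
    define p q r u v w Y where "p = m 0 j" and "q = m 0 (j - 1)" and "r = m 0 (j + 1)"
      and "u = m (-1) j" and "v = m (-1) (j + 1)" and "w = m (-2) (j + 1)" and "Y = y + of_int j"
    have e1: "(\<nu> + 1) * u = p * (Y + \<nu> - \<beta>\<^sub>2) - (Y - \<beta>\<^sub>1) * q"
      and e2: "(\<nu> + 1) * v = r * (Y + 1 + \<nu> - \<beta>\<^sub>2) - (Y + 1 - \<beta>\<^sub>1) * p"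
      and e3: "\<nu> * w = v * (Y + \<nu> - \<beta>\<^sub>2) - (Y + 1 - \<beta>\<^sub>1) * u"
      and e4: "(\<nu> + 2) * w = r * (Y + 1 + \<nu> - 2 * \<beta>\<^sub>2) - (Y + 1 - 2 * \<beta>\<^sub>1) * q"
      using elim by (simp_all add: p_def q_def r_def u_def v_def w_def Y_def algebra_simps)
    have "(\<nu> + 2) * (((\<nu> + 1) * v) * (Y + \<nu> - \<beta>\<^sub>2) - (Y + 1 - \<beta>\<^sub>1) * ((\<nu> + 1) * u)) = (\<nu> + 2) * ((\<nu> + 1) * (\<nu> * w))"
      unfolding e3 by (simp add: algebra_simps)
    also have "\<dots> = (\<nu> + 1) * \<nu> * ((\<nu> + 2) * w)" by (simp add: algebra_simps)
    finally have el: "(\<nu> + 2) * ((r * (Y + 1 + \<nu> - \<beta>\<^sub>2) - (Y + 1 - \<beta>\<^sub>1) * p) * (Y + \<nu> - \<beta>\<^sub>2)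
        - (Y + 1 - \<beta>\<^sub>1) * (p * (Y + \<nu> - \<beta>\<^sub>2) - (Y - \<beta>\<^sub>1) * q))
        = (\<nu> + 1) * \<nu> * (r * (Y + 1 + \<nu> - 2 * \<beta>\<^sub>2) - (Y + 1 - 2 * \<beta>\<^sub>1) * q)" unfolding e1 e2 e4 .
    have "((\<nu> + 2) * (Y + 1 - \<beta>\<^sub>1) * (Y - \<beta>\<^sub>1) + (\<nu> + 1) * \<nu> * (Y + 1 - 2 * \<beta>\<^sub>1)) * q
      - 2 * (\<nu> + 2) * (Y + 1 - \<beta>\<^sub>1) * (Y + \<nu> - \<beta>\<^sub>2) * p
      + ((\<nu> + 2) * (Y + \<nu> + 1 - \<beta>\<^sub>2) * (Y + \<nu> - \<beta>\<^sub>2) - (\<nu> + 1) * \<nu> * (Y + \<nu> + 1 - 2 * \<beta>\<^sub>2)) * r = 0"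
      using el by algebra
    then show ?case by (simp add: Let_def p_def q_def r_def Y_def)
  qed
qed

text \<open>A nonzero middle value \<open>m 0 j\<close> makes the 3 by 3 system singular. The
  determinant has degree only one in \<open>Y\<close>, and since it vanishes infinitely often its
  linear coefficient \<open>c1\<close> is zero; the factors of \<open>c1\<close> are the three
  alternatives.\<close>

lemma equivariant_weights:
  fixes m :: "int \<Rightarrow> int \<Rightarrow> complex" and y \<nu> \<beta>\<^sub>1 \<beta>\<^sub>2 :: complex
  assumes rel: "\<forall>i\<in>{1, -1, 2, -2}. \<forall>k. \<forall>\<^sub>F j in at_top.
      (\<nu> + of_int k - of_int i) * m (k + i) j
      = m k j * (y + of_int j + \<nu> + of_int k + \<beta>\<^sub>2 * of_int i) - (y + of_int j + \<beta>\<^sub>1 * of_int i) * m k (j + i)"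
    and "\<nu> \<noteq> 0" and "\<exists>\<^sub>F j in at_top. m 0 j \<noteq> 0"
  shows "\<beta>\<^sub>2 = \<beta>\<^sub>1 \<or> \<beta>\<^sub>2 = \<beta>\<^sub>1 - 1 \<or> 2 * \<beta>\<^sub>1 = 3 * (\<beta>\<^sub>1 + \<beta>\<^sub>2)\<^sup>2 - 5 * (\<beta>\<^sub>1 + \<beta>\<^sub>2) + 2"
proof -
  define c0 where "c0 = 4 * (\<beta>\<^sub>2 - \<beta>\<^sub>1) * (\<beta>\<^sub>2 - \<beta>\<^sub>1 + 1) * (\<beta>\<^sub>2 - \<beta>\<^sub>1 - 1) * (\<beta>\<^sub>1 + \<beta>\<^sub>2 - 1) * (\<beta>\<^sub>1 + \<beta>\<^sub>2) * (\<beta>\<^sub>1 + \<beta>\<^sub>2 - 2)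
    + \<nu>\<^sup>2 * (\<beta>\<^sub>2 - \<beta>\<^sub>1) * (\<beta>\<^sub>2 - \<beta>\<^sub>1 + 1) * (\<beta>\<^sub>1^4 + 2*\<beta>\<^sub>1^3*\<beta>\<^sub>2 + 2*\<beta>\<^sub>1^3 + 8*\<beta>\<^sub>1^2*\<beta>\<^sub>2 - 19*\<beta>\<^sub>1^2 - 2*\<beta>\<^sub>1*\<beta>\<^sub>2^3
      + 14*\<beta>\<^sub>1*\<beta>\<^sub>2^2 - 34*\<beta>\<^sub>1*\<beta>\<^sub>2 + 24*\<beta>\<^sub>1 - \<beta>\<^sub>2^4 + 8*\<beta>\<^sub>2^3 - 19*\<beta>\<^sub>2^2 + 16*\<beta>\<^sub>2 - 4)"
  define c1 where "c1 = - 4 * \<nu> * (\<beta>\<^sub>2 - \<beta>\<^sub>1) * (\<beta>\<^sub>2 - \<beta>\<^sub>1 + 1) * (3 * (\<beta>\<^sub>1 + \<beta>\<^sub>2)\<^sup>2 - 5 * (\<beta>\<^sub>1 + \<beta>\<^sub>2) + 2 - 2 * \<beta>\<^sub>1)"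
  have "\<forall>\<^sub>F j in at_top. (c0 + c1 * (y + of_int j)) * m 0 j = 0"
    using equivariant_three_term[OF rel]
  proof eventually_elim
    case (elim j)
    define p q r Y where "p = m 0 j" and "q = m 0 (j - 1)" and "r = m 0 (j + 1)" and "Y = y + of_int j"
    define A0 A1 A2 where "A0 = (Y - \<beta>\<^sub>1) * (Y + \<nu> - (1 - \<beta>\<^sub>2))"
      and "A1 = 2 * Y * (Y + \<nu>) + 2 + \<beta>\<^sub>1 * (1 - \<beta>\<^sub>1) + \<beta>\<^sub>2 * (1 - \<beta>\<^sub>2)"
      and "A2 = (Y + \<beta>\<^sub>1) * (Y + \<nu> + (1 - \<beta>\<^sub>2))"
    define B0 B1 B2 where "B0 = (\<nu> - 2) * (Y + \<nu> - 1 + \<beta>\<^sub>2) * (Y + \<nu> + \<beta>\<^sub>2) - \<nu> * (\<nu> - 1) * (Y + \<nu> - 1 + 2 * \<beta>\<^sub>2)"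
      and "B1 = 2 * (\<nu> - 2) * (Y - 1 + \<beta>\<^sub>1) * (Y + \<nu> + \<beta>\<^sub>2)"
      and "B2 = (\<nu> - 2) * (Y - 1 + \<beta>\<^sub>1) * (Y + \<beta>\<^sub>1) + \<nu> * (\<nu> - 1) * (Y - 1 + 2 * \<beta>\<^sub>1)"
    define C0 C1 C2 where "C0 = (\<nu> + 2) * (Y + 1 - \<beta>\<^sub>1) * (Y - \<beta>\<^sub>1) + (\<nu> + 1) * \<nu> * (Y + 1 - 2 * \<beta>\<^sub>1)"
      and "C1 = 2 * (\<nu> + 2) * (Y + 1 - \<beta>\<^sub>1) * (Y + \<nu> - \<beta>\<^sub>2)"
      and "C2 = (\<nu> + 2) * (Y + \<nu> + 1 - \<beta>\<^sub>2) * (Y + \<nu> - \<beta>\<^sub>2) - (\<nu> + 1) * \<nu> * (Y + \<nu> + 1 - 2 * \<beta>\<^sub>2)"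
    have eqs: "A0 * q - A1 * p + A2 * r = 0" "B0 * q - B1 * p + B2 * r = 0" "C0 * q - C1 * p + C2 * r = 0"
      using elim unfolding Let_def
        A0_def A1_def A2_def B0_def B1_def B2_def C0_def C1_def C2_def p_def q_def r_def Y_def by simp_all
    have det: "A1 * (B0 * C2 - B2 * C0) - B1 * (A0 * C2 - A2 * C0) + C1 * (A0 * B2 - A2 * B0) = c0 + c1 * Y"
      unfolding A0_def A1_def A2_def B0_def B1_def B2_def C0_def C1_def C2_def c0_def c1_def by algebra
    \<comment> \<open>Cramer's rule for the middle unknown: the cofactors of its column eliminate
      \<open>q\<close> and \<open>r\<close>.\<close>
    have "(A1 * (B0 * C2 - B2 * C0) - B1 * (A0 * C2 - A2 * C0) + C1 * (A0 * B2 - A2 * B0)) * p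
        = - (B0 * C2 - B2 * C0) * (A0 * q - A1 * p + A2 * r) + (A0 * C2 - A2 * C0) * (B0 * q - B1 * p + B2 * r)
          - (A0 * B2 - A2 * B0) * (C0 * q - C1 * p + C2 * r)" by algebra
    then show ?case unfolding det eqs by (simp add: p_def Y_def)
  qed
  with assms(3) have "\<exists>\<^sub>F j in at_top. c0 + c1 * (y + of_int j) = 0"
    by (rule frequently_rev_mp[OF _ eventually_mono]) auto
  then have "\<exists>\<^sub>F j in at_top. let z = y + of_int j * 1 in c0 + c1 * z + 0 * z^2 + 0 * z^3 + 0 * z^4 = 0"
    by (simp add: Let_def)
  from frequently_quartic_zero(2)[OF this] have "c1 = 0" by simp
  then have "\<beta>\<^sub>2 - \<beta>\<^sub>1 = 0 \<or> \<beta>\<^sub>2 - \<beta>\<^sub>1 + 1 = 0 \<or> 3 * (\<beta>\<^sub>1 + \<beta>\<^sub>2)\<^sup>2 - 5 * (\<beta>\<^sub>1 + \<beta>\<^sub>2) + 2 - 2 * \<beta>\<^sub>1 = 0"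
    using \<open>\<nu> \<noteq> 0\<close> unfolding c1_def mult_eq_0_iff by simp
  moreover have "\<beta>\<^sub>2 = \<beta>\<^sub>1 - 1" if "\<beta>\<^sub>2 - \<beta>\<^sub>1 + 1 = 0" using that by algebra
  ultimately show ?thesis by auto
qed

text \<open>For equal weights the determinant vanishes identically, so a solution can survive.
  Eliminating \<open>m 0 (j - 1)\<close> from the first two equations leaves a one-step recurrence
  times the common factor \<open>\<Delta>\<close>, and the recurrence says that
  \<open>m 0 j / (y + j + \<beta> * \<nu>)\<close> is eventually constant.\<close>

lemma equivariant_normal_form:
  fixes m :: "int \<Rightarrow> int \<Rightarrow> complex" and y \<nu> \<beta> :: complex
  assumes rel: "\<forall>i\<in>{1, -1, 2, -2}. \<forall>k. \<forall>\<^sub>F j in at_top.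
      (\<nu> + of_int k - of_int i) * m (k + i) j
      = m k j * (y + of_int j + \<nu> + of_int k + \<beta> * of_int i) - (y + of_int j + \<beta> * of_int i) * m k (j + i)"
  obtains K where "\<forall>\<^sub>F j in at_top. m 0 j = K * (y + of_int j + \<beta> * \<nu>)"
proof -
  \<comment> \<open>The common factor \<open>\<Delta>\<close> as a polynomial in \<open>Y\<close>;
    its leading coefficient 4 keeps it nonzero for all values of \<nu> and \<beta>.\<close>
  let ?p = "[: - 2*\<nu>^2*\<beta> + 2*\<nu>^2 - 4*\<nu>*\<beta>^2 + 8*\<nu>*\<beta> - 2*\<nu> + 4*\<beta>^2 - 4*\<beta>,
      - 4*\<nu>*\<beta> + 6*\<nu> + 8*\<beta> - 4, 4:]"
  have nz: "\<forall>\<^sub>F j :: int in at_top. y + \<beta> * \<nu> + of_int j * 1 \<noteq> 0"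
    by (rule eventually_affine_nonzero) simp
  have "\<forall>\<^sub>F j :: int in at_top. poly ?p (y + of_int j * 1) \<noteq> 0"
    by (rule eventually_poly_nonzero) simp_all
  then have "\<forall>\<^sub>F j in at_top. (y + of_int j + 1 + \<beta> * \<nu>) * m 0 j = (y + of_int j + \<beta> * \<nu>) * m 0 (j + 1)"
    using equivariant_three_term(1,2)[OF rel]
  proof eventually_elim
    case (elim j)
    define p q r Y where "p = m 0 j" and "q = m 0 (j - 1)" and "r = m 0 (j + 1)" and "Y = y + of_int j"
    define A0 A1 A2 where "A0 = (Y - \<beta>) * (Y + \<nu> - (1 - \<beta>))"
      and "A1 = 2 * Y * (Y + \<nu>) + 2 + \<beta> * (1 - \<beta>) + \<beta> * (1 - \<beta>)"
      and "A2 = (Y + \<beta>) * (Y + \<nu> + (1 - \<beta>))"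
    define B0 B1 B2 where "B0 = (\<nu> - 2) * (Y + \<nu> - 1 + \<beta>) * (Y + \<nu> + \<beta>) - \<nu> * (\<nu> - 1) * (Y + \<nu> - 1 + 2 * \<beta>)"
      and "B1 = 2 * (\<nu> - 2) * (Y - 1 + \<beta>) * (Y + \<nu> + \<beta>)"
      and "B2 = (\<nu> - 2) * (Y - 1 + \<beta>) * (Y + \<beta>) + \<nu> * (\<nu> - 1) * (Y - 1 + 2 * \<beta>)"
    have eqs: "A0 * q - A1 * p + A2 * r = 0" "B0 * q - B1 * p + B2 * r = 0"
      using elim unfolding Let_def A0_def A1_def A2_def B0_def B1_def B2_def p_def q_def r_def Y_def by simp_all
    define \<Delta> where "\<Delta> = (- 2*\<nu>^2*\<beta> + 2*\<nu>^2 - 4*\<nu>*\<beta>^2 + 8*\<nu>*\<beta> - 2*\<nu> + 4*\<beta>^2 - 4*\<beta>)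
      + (- 4*\<nu>*\<beta> + 6*\<nu> + 8*\<beta> - 4) * Y + 4 * Y^2"
    have \<Delta>: "A0 * B2 - A2 * B0 = (Y + \<beta> * \<nu>) * \<Delta>" "A0 * B1 - A1 * B0 = (Y + 1 + \<beta> * \<nu>) * \<Delta>"
      unfolding A0_def A1_def A2_def B0_def B1_def B2_def \<Delta>_def by algebra+
    have "(A0 * B2 - A2 * B0) * r - (A0 * B1 - A1 * B0) * p
        = A0 * (B0 * q - B1 * p + B2 * r) - B0 * (A0 * q - A1 * p + A2 * r)" by algebra
    then have "\<Delta> * ((Y + \<beta> * \<nu>) * r - (Y + 1 + \<beta> * \<nu>) * p) = 0"
      unfolding \<Delta> eqs by (simp add: algebra_simps)
    moreover have "\<Delta> \<noteq> 0" using elim(1) by (simp add: \<Delta>_def Y_def algebra_simps power2_eq_square)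
    ultimately show ?case by (simp add: p_def r_def Y_def)
  qed
  with nz eventually_shift_int[OF nz, of 1]
  have "\<forall>\<^sub>F j in at_top. y + of_int j + \<beta> * \<nu> \<noteq> 0 \<and>
      m 0 (j + 1) / (y + of_int (j + 1) + \<beta> * \<nu>) = m 0 j / (y + of_int j + \<beta> * \<nu>)"
    by eventually_elim (simp add: field_simps)
  then obtain N where N: "\<And>j. j \<ge> N \<Longrightarrow> y + of_int j + \<beta> * \<nu> \<noteq> 0"
      "\<And>j. j \<ge> N \<Longrightarrow> m 0 (j + 1) / (y + of_int (j + 1) + \<beta> * \<nu>) = m 0 j / (y + of_int j + \<beta> * \<nu>)"
    by (auto simp: eventually_at_top_linorder)
  have "m 0 j / (y + of_int j + \<beta> * \<nu>) = m 0 N / (y + of_int N + \<beta> * \<nu>)" if "j \<ge> N" for j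
    using that by (induction j rule: int_ge_induct) (simp_all only: N)
  then have "\<And>j. j \<ge> N \<Longrightarrow> m 0 j = m 0 N / (y + of_int N + \<beta> * \<nu>) * (y + of_int j + \<beta> * \<nu>)"
    using N(1) by (metis nonzero_eq_divide_eq)
  then have "\<forall>\<^sub>F j in at_top. m 0 j = m 0 N / (y + of_int N + \<beta> * \<nu>) * (y + of_int j + \<beta> * \<nu>)"
    unfolding eventually_at_top_linorder by blast
  then show ?thesis by (rule that)
qed

text \<open>\<open>s\<close> is built as a product so that \<open>L_1\<close> acts as prescribed;
  the products \<open>D\<close>, \<open>T\<close> and \<open>T'\<close> then force the action of
  \<open>L_{-1}\<close>, \<open>L_2\<close> and \<open>L_{-2}\<close> after cancelling nonzero
  affine factors.\<close>

lemma gauge_exists: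
  fixes F :: "int \<Rightarrow> int \<Rightarrow> complex" and y \<beta> :: complex
  defines "Y \<equiv> \<lambda>n :: int. y + of_int n"
  assumes D: "\<And>n. F 1 n * F (-1) (n + 1) = (Y n + \<beta>) * (Y n + 1 - \<beta>)"
    and T: "\<And>n. F 2 n * F (-1) (n + 2) * F (-1) (n + 1) = (Y n + 2 * \<beta>) * (Y n + 1 - \<beta>) * (Y n + 2 - \<beta>)"
    and T': "\<And>n. F (-2) (n + 2) * F 1 n * F 1 (n + 1) = (Y n + 2 - 2 * \<beta>) * (Y n + \<beta>) * (Y n + 1 + \<beta>)"
  obtains s where "\<forall>\<^sub>F n in at_top. s n \<noteq> 0"
    "\<And>i. i \<in> {1, -1, 2, -2} \<Longrightarrow> \<forall>\<^sub>F n in at_top. F i n * s (n + i) = (Y n + \<beta> * of_int i) * s n"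
proof -
  have "\<forall>\<^sub>F n in at_top. Y n + \<beta> \<noteq> 0 \<and> Y n + 1 - \<beta> \<noteq> 0"
    using eventually_affine_nonzero[OF one_neq_zero, of "y + \<beta>"]
      eventually_affine_nonzero[OF one_neq_zero, of "y + 1 - \<beta>"]
    by eventually_elim (auto simp: Y_def algebra_simps)
  then obtain N where nz: "\<And>n. n \<ge> N \<Longrightarrow> Y n + \<beta> \<noteq> 0" "\<And>n. n \<ge> N \<Longrightarrow> Y n + 1 - \<beta> \<noteq> 0"
    by (auto simp: eventually_at_top_linorder)
  have F1: "F 1 n \<noteq> 0" if "n \<ge> N" for n using D[of n] nz[OF that] by auto
  define s where "s n = (\<Prod>i<nat (n - N). (Y (N + int i) + \<beta>) / F 1 (N + int i))" for n
  have s0: "s n \<noteq> 0" for n by (simp add: s_def F1 nz)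
  have s1: "F 1 n * s (n + 1) = (Y n + \<beta>) * s n" if "n \<ge> N" for n
  proof -
    have "nat (n + 1 - N) = Suc (nat (n - N))" "N + int (nat (n - N)) = n" using that by auto
    then show ?thesis using F1[OF that] by (simp add: s_def field_simps)
  qed
  have s2: "F (-1) (n + 1) * s n = (Y n + 1 - \<beta>) * s (n + 1)" if "n \<ge> N" for n
  proof -
    have "(Y n + \<beta>) * (F (-1) (n + 1) * s n) = F (-1) (n + 1) * (F 1 n * s (n + 1))"
      unfolding s1[OF that] by (simp add: algebra_simps)
    also have "\<dots> = F 1 n * F (-1) (n + 1) * s (n + 1)" by (simp add: algebra_simps)
    also have "\<dots> = (Y n + \<beta>) * ((Y n + 1 - \<beta>) * s (n + 1))" unfolding D by (simp add: mult.assoc)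
    finally show ?thesis using nz(1)[OF that] by simp
  qed
  have s3: "F 2 n * s (n + 2) = (Y n + 2 * \<beta>) * s n" if "n \<ge> N" for n
  proof -
    have a: "F (-1) (n + 1) * s n = (Y n + 1 - \<beta>) * s (n + 1)"
      "F (-1) (n + 2) * s (n + 1) = (Y n + 2 - \<beta>) * s (n + 2)"
      using s2[of n] s2[of "n + 1"] that by (simp_all add: Y_def algebra_simps)
    have "Y n + 1 - \<beta> \<noteq> 0" "Y n + 2 - \<beta> \<noteq> 0" using nz(2)[of n] nz(2)[of "n + 1"] that
      by (simp_all add: Y_def algebra_simps)
    then have nz': "(Y n + 1 - \<beta>) * (Y n + 2 - \<beta>) \<noteq> 0" by simp
    have "(Y n + 1 - \<beta>) * (Y n + 2 - \<beta>) * (F 2 n * s (n + 2)) = F 2 n * (Y n + 1 - \<beta>) * (F (-1) (n + 2) * s (n + 1))"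
      unfolding a(2) by (simp add: algebra_simps)
    also have "\<dots> = F 2 n * F (-1) (n + 2) * (F (-1) (n + 1) * s n)" unfolding a(1) by (simp add: algebra_simps)
    also have "\<dots> = (Y n + 1 - \<beta>) * (Y n + 2 - \<beta>) * ((Y n + 2 * \<beta>) * s n)"
      unfolding mult.assoc[symmetric] T by (simp add: mult_ac)
    finally show ?thesis by (rule mult_left_cancel[OF nz', THEN iffD1])
  qed
  have s4: "F (-2) (n + 2) * s n = (Y n + 2 - 2 * \<beta>) * s (n + 2)" if "n \<ge> N" for n
  proof -
    have a: "F 1 n * s (n + 1) = (Y n + \<beta>) * s n"
      "F 1 (n + 1) * s (n + 2) = (Y n + 1 + \<beta>) * s (n + 1)"
      using s1[of n] s1[of "n + 1"] that by (simp_all add: Y_def algebra_simps)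
    have "Y n + \<beta> \<noteq> 0" "Y n + 1 + \<beta> \<noteq> 0" using nz(1)[of n] nz(1)[of "n + 1"] that
      by (simp_all add: Y_def algebra_simps)
    then have nz': "(Y n + \<beta>) * (Y n + 1 + \<beta>) \<noteq> 0" by simp
    have "(Y n + \<beta>) * (Y n + 1 + \<beta>) * (F (-2) (n + 2) * s n) = F (-2) (n + 2) * (Y n + 1 + \<beta>) * (F 1 n * s (n + 1))"
      unfolding a(1) by (simp add: algebra_simps)
    also have "\<dots> = F (-2) (n + 2) * F 1 n * (F 1 (n + 1) * s (n + 2))" unfolding a(2) by (simp add: algebra_simps)
    also have "\<dots> = (Y n + \<beta>) * (Y n + 1 + \<beta>) * ((Y n + 2 - 2 * \<beta>) * s (n + 2))"
      unfolding mult.assoc[symmetric] T' by (simp add: mult_ac)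
    finally show ?thesis by (rule mult_left_cancel[OF nz', THEN iffD1])
  qed
  show ?thesis
  proof (rule that)
    show "\<forall>\<^sub>F n in at_top. s n \<noteq> 0" by (simp add: s0)
    fix i :: int assume "i \<in> {1, -1, 2, -2}"
    \<comment> \<open>The bound is \<open>N + 2\<close> because the lowering operators use
      \<open>s2\<close> and \<open>s4\<close> at \<open>n - 1\<close> and
      \<open>n - 2\<close>.\<close>
    then have "F i n * s (n + i) = (Y n + \<beta> * of_int i) * s n" if "n \<ge> N + 2" for n
      using s1[of n] s2[of "n - 1"] s3[of n] s4[of "n - 2"] that
      by (auto simp: Y_def algebra_simps)
    then show "\<forall>\<^sub>F n in at_top. F i n * s (n + i) = (Y n + \<beta> * of_int i) * s n"
      by (auto simp: eventually_at_top_linorder)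
  qed
qed

section \<open>Modules with one-dimensional weight spaces\<close>

locale witt_module = add_subgroup G for G +
  fixes f :: "complex \<Rightarrow> complex \<Rightarrow> complex" and \<alpha> :: complex
  assumes f0: "\<And>c. c \<in> G \<Longrightarrow> f 0 c = \<alpha> + c"
    and bracket: "\<And>a b c. a \<in> G \<Longrightarrow> b \<in> G \<Longrightarrow> c \<in> G \<Longrightarrow>
      (b - a) * f (a + b) c = f b c * f a (b + c) - f a c * f b (a + c)"
begin

text \<open>On a chain \<open>c + \<int>a\<close> the sequence \<open>s\<close> rescales the basis vectors so that \<open>L_{ia}\<close>
  acts by the structure constants of an intermediate series module with parameter \<open>\<beta>\<close>,
  far enough in the direction of \<open>a\<close>.\<close>

definition gauge :: "complex \<Rightarrow> complex \<Rightarrow> complex \<Rightarrow> (int \<Rightarrow> complex) \<Rightarrow> bool" where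
  "gauge a c \<beta> s \<longleftrightarrow> (\<forall>\<^sub>F n in at_top. s n \<noteq> 0) \<and>
    (\<forall>i\<in>{1, -1, 2, -2}. \<forall>\<^sub>F n in at_top.
      f (of_int i * a) (c + of_int n * a) * s (n + i) = (\<alpha> + c + of_int n * a + \<beta> * (of_int i * a)) * s n)"

text \<open>Dividing weights and structure constants by \<open>a\<close> turns the chain into one
  indexed by integers with step 1. The same \<beta> governs the gauge and the closed products of
  step \<open>a\<close> and step \<open>2 * a\<close>.\<close>

lemma chain:
  assumes "a \<in> G" "c \<in> G" "a \<noteq> 0"
  obtains \<beta> s where "\<beta> \<noteq> 1" "gauge a c \<beta> s"
    "\<And>n :: int. let x = \<alpha> + c + of_int n * a in
      f a (c + of_int n * a) * f (- a) (a + (c + of_int n * a)) = x * (x + a) + \<beta> * (1 - \<beta>) * a\<^sup>2"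
    "f (2 * a) c * f (- (2 * a)) (2 * a + c) = (\<alpha> + c) * (\<alpha> + c + 2 * a) + 4 * (\<beta> * (1 - \<beta>)) * a\<^sup>2"
proof -
  define F where "F j n = f (of_int j * a) (c + of_int n * a) / a" for j n :: int
  define y where "y = (\<alpha> + c) / a"
  have aF: "f (of_int j * a) (c + of_int n * a) = a * F j n" for j n using assms by (simp add: F_def)
  have ya: "y * a = \<alpha> + c" using assms by (simp add: y_def)
  have rel: "(of_int k - of_int j) * F (j + k) n = F k n * F j (n + k) - F j n * F k (n + j)" for j k n
  proof -
    have "of_int j * a \<in> G" "of_int k * a \<in> G" "c + of_int n * a \<in> G" using assms by (simp_all add: in_G)
    note br = bracket[OF this]
    have "a * (of_int k - of_int j) * (a * F (j + k) n) = (a * F k n) * (a * F j (n + k)) - (a * F j n) * (a * F k (n + j))"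
      unfolding aF[symmetric] using br by (simp add: algebra_simps)
    then have "(a * a) * ((of_int k - of_int j) * F (j + k) n) = (a * a) * (F k n * F j (n + k) - F j n * F k (n + j))"
      by (simp add: algebra_simps)
    then show ?thesis using assms(3) by (metis mult_left_cancel no_zero_divisors)
  qed
  have F0: "F 0 n = y + of_int n" for n
  proof -
    have "c + of_int n * a \<in> G" using assms by (simp add: in_G)
    from f0[OF this] show ?thesis using assms(3) by (simp add: F_def y_def field_simps)
  qed
  obtain \<beta> where \<beta>: "\<beta> \<noteq> 1"
    "\<And>n. F 1 n * F (-1) (n + 1) = (y + of_int n + \<beta>) * (y + of_int n + 1 - \<beta>)"
    "\<And>n. F 2 n * F (-2) (n + 2) = (y + of_int n) * (y + of_int n + 2) + 4 * (\<beta> * (1 - \<beta>))"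
    "\<And>n. F 2 n * F (-1) (n + 2) * F (-1) (n + 1) = (y + of_int n + 2 * \<beta>) * (y + of_int n + 1 - \<beta>) * (y + of_int n + 2 - \<beta>)"
    "\<And>n. F (-2) (n + 2) * F 1 n * F 1 (n + 1) = (y + of_int n + 2 - 2 * \<beta>) * (y + of_int n + \<beta>) * (y + of_int n + 1 + \<beta>)"
    using witt_chain_structure[of F "\<lambda>n. y + of_int n" y, OF rel F0 refl] by blast
  obtain s where s: "\<forall>\<^sub>F n in at_top. s n \<noteq> 0"
    "\<And>i. i \<in> {1, -1, 2, -2} \<Longrightarrow> \<forall>\<^sub>F n in at_top. F i n * s (n + i) = (y + of_int n + \<beta> * of_int i) * s n"
    using gauge_exists[of F y \<beta>, OF \<beta>(2,4,5)] by blast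
  show ?thesis
  proof (rule that[OF \<beta>(1)])
    show "gauge a c \<beta> s" unfolding gauge_def aF
    proof (intro conjI ballI s(1))
      fix i :: int assume "i \<in> {1, -1, 2, -2}"
      from s(2)[OF this] show "\<forall>\<^sub>F n in at_top. a * F i n * s (n + i) =
          (\<alpha> + c + of_int n * a + \<beta> * (of_int i * a)) * s n"
        by eventually_elim (simp add: ya[symmetric] algebra_simps)
    qed
    fix n :: int
    show "let x = \<alpha> + c + of_int n * a in
      f a (c + of_int n * a) * f (- a) (a + (c + of_int n * a)) = x * (x + a) + \<beta> * (1 - \<beta>) * a\<^sup>2"
    proof -
      have "f a (c + of_int n * a) = a * F 1 n" "f (- a) (a + (c + of_int n * a)) = a * F (-1) (n + 1)"
        using aF[of 1 n] aF[of "-1" "n + 1"] by (simp_all add: algebra_simps)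
      then have "f a (c + of_int n * a) * f (- a) (a + (c + of_int n * a)) = a^2 * (F 1 n * F (-1) (n + 1))"
        by (simp add: power2_eq_square)
      then show ?thesis unfolding \<beta>(2) Let_def ya[symmetric] by (simp add: algebra_simps power2_eq_square)
    qed
  next
    have "f (2 * a) c = a * F 2 0" "f (- (2 * a)) (2 * a + c) = a * F (-2) (0 + 2)"
      using aF[of 2 0] aF[of "-2" 2] by (simp_all add: algebra_simps)
    then have "f (2 * a) c * f (- (2 * a)) (2 * a + c) = a^2 * (F 2 0 * F (-2) (0 + 2))"
      by (simp add: power2_eq_square)
    then show "f (2 * a) c * f (- (2 * a)) (2 * a + c) = (\<alpha> + c) * (\<alpha> + c + 2 * a) + 4 * (\<beta> * (1 - \<beta>)) * a\<^sup>2"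
      unfolding \<beta>(3) ya[symmetric] by (simp add: algebra_simps power2_eq_square)
  qed
qed

text \<open>\<open>m k\<close> is the matrix of \<open>L_{b + ka}\<close> in the rescaled bases of
  the two chains, divided by \<open>a\<close>; the relation is its commutator with
  \<open>L_{ia}\<close>, for the parameters \<open>\<nu> = b / a\<close> and
  \<open>y = (\<alpha> + c) / a\<close>.\<close>

lemma equivariance:
  assumes ab: "a \<in> G" "b \<in> G" "c \<in> G" "a \<noteq> 0"
    and g: "gauge a c \<beta>\<^sub>1 s" "gauge a (c + b) \<beta>\<^sub>2 t"
  defines "m \<equiv> \<lambda>k j :: int. f (b + of_int k * a) (c + of_int j * a) * t (k + j) / (s j * a)"
  shows "\<forall>i\<in>{1, -1, 2, -2}. \<forall>k. \<forall>\<^sub>F j in at_top. (b / a + of_int k - of_int i) * m (k + i) j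
      = m k j * ((\<alpha> + c) / a + of_int j + b / a + of_int k + \<beta>\<^sub>2 * of_int i)
        - ((\<alpha> + c) / a + of_int j + \<beta>\<^sub>1 * of_int i) * m k (j + i)"
proof (intro ballI allI)
  fix i k :: int assume i: "i \<in> {1, -1, 2, -2}"
  have "\<forall>\<^sub>F j in at_top. s j \<noteq> 0" using g(1) by (simp add: gauge_def)
  moreover have "\<forall>\<^sub>F j in at_top. s (j + i) \<noteq> 0" by (rule eventually_shift_int) fact
  moreover have "\<forall>\<^sub>F n in at_top. f (of_int i * a) (c + of_int n * a) * s (n + i)
      = (\<alpha> + c + of_int n * a + \<beta>\<^sub>1 * (of_int i * a)) * s n"
    using g(1) i by (auto simp: gauge_def)
  moreover have "\<forall>\<^sub>F n in at_top. f (of_int i * a) (c + b + of_int (n + k) * a) * t (n + k + i)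
      = (\<alpha> + (c + b) + of_int (n + k) * a + \<beta>\<^sub>2 * (of_int i * a)) * t (n + k)"
    using g(2) i by (intro eventually_shift_int) (auto simp: gauge_def)
  ultimately show "\<forall>\<^sub>F j in at_top. (b / a + of_int k - of_int i) * m (k + i) j
      = m k j * ((\<alpha> + c) / a + of_int j + b / a + of_int k + \<beta>\<^sub>2 * of_int i)
        - ((\<alpha> + c) / a + of_int j + \<beta>\<^sub>1 * of_int i) * m k (j + i)"
  proof eventually_elim
    case (elim j)
    define v w u z where "v = f (b + of_int k * a) (c + of_int j * a)"
      and "w = f (b + of_int k * a) (c + of_int (j + i) * a)"
      and "u = f (b + of_int (k + i) * a) (c + of_int j * a)"
      and "z = \<alpha> + c + of_int j * a"
    have br: "(b + of_int k * a - of_int i * a) * u = v * f (of_int i * a) (c + b + of_int (j + k) * a)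
        - f (of_int i * a) (c + of_int j * a) * w"
    proof -
      have "of_int i * a \<in> G" "b + of_int k * a \<in> G" "c + of_int j * a \<in> G" using ab by (simp_all add: in_G)
      from bracket[OF this] show ?thesis by (simp add: u_def v_def w_def algebra_simps)
    qed
    have "(b + of_int k * a - of_int i * a) * u * s (j + i) * t (j + k + i)
      = v * (f (of_int i * a) (c + b + of_int (j + k) * a) * t (j + k + i)) * s (j + i)
        - (f (of_int i * a) (c + of_int j * a) * s (j + i)) * w * t (j + k + i)"
      unfolding br by (simp add: algebra_simps)
    also have "\<dots> = v * ((z + b + of_int k * a + \<beta>\<^sub>2 * (of_int i * a)) * t (j + k)) * s (j + i)
       - (z + \<beta>\<^sub>1 * (of_int i * a)) * s j * w * t (j + k + i)"
      unfolding elim z_def by (simp add: algebra_simps)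
    finally have *: "(b + of_int k * a - of_int i * a) * u * s (j + i) * t (j + k + i)
      = v * ((z + b + of_int k * a + \<beta>\<^sub>2 * (of_int i * a)) * t (j + k)) * s (j + i)
       - (z + \<beta>\<^sub>1 * (of_int i * a)) * s j * w * t (j + k + i)" .
    have mm: "m (k + i) j = u * t (j + k + i) / (s j * a)" "m k j = v * t (j + k) / (s j * a)"
      "m k (j + i) = w * t (j + k + i) / (s (j + i) * a)"
      by (simp_all add: m_def u_def v_def w_def add_ac)
    have zz: "(\<alpha> + c) / a + of_int j = z / a" using ab by (simp add: z_def field_simps)
    have "(b / a + of_int k - of_int i) * m (k + i) j
        = (b + of_int k * a - of_int i * a) * u * s (j + i) * t (j + k + i) / (s j * s (j + i) * a\<^sup>2)"
      unfolding mm using elim ab by (simp add: field_simps power2_eq_square)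
    also have "\<dots> = m k j * (z / a + b / a + of_int k + \<beta>\<^sub>2 * of_int i)
        - (z / a + \<beta>\<^sub>1 * of_int i) * m k (j + i)"
      unfolding * mm using elim ab by (simp add: field_simps power2_eq_square)
    finally show ?case unfolding zz .
  qed
qed

section \<open>Closed paths and the weight of a direction\<close>

text \<open>The scalars by which the closed paths \<open>c, a + c, c\<close> and \<open>c, a + c, a + b + c, c\<close> act; unlike
  \<open>f\<close> itself they do not change when the basis vectors are rescaled.\<close>

definition P :: "complex \<Rightarrow> complex \<Rightarrow> complex" where
  "P a c = f a c * f (- a) (a + c)"

definition T :: "complex \<Rightarrow> complex \<Rightarrow> complex \<Rightarrow> complex" where
  "T a b c = f a c * f b (a + c) * f (- (a + b)) (a + b + c)"

lemma P_step: "b \<in> G \<Longrightarrow> c \<in> G \<Longrightarrow> P b c = P b (c - b) + 2 * b * (\<alpha> + c)"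
  using bracket[of "- b" b c] f0[of c] by (simp add: P_def in_G algebra_simps)

lemma T_swap:
  assumes "a \<in> G" "b \<in> G" "c \<in> G"
  shows "T a b c = T b a c + (a - b) * P (a + b) c"
proof -
  have "(a - b) * f (a + b) c * f (- (a + b)) (a + b + c)
      = (f a c * f b (a + c) - f b c * f a (b + c)) * f (- (a + b)) (a + b + c)"
    using bracket[of b a c] assms by (simp add: add.commute)
  then show ?thesis by (simp add: T_def P_def algebra_simps)
qed

text \<open>The paths of \<open>T b a c\<close> and \<open>T a b (c - a)\<close> share the step
  \<open>f b c\<close> and apply the other two, by \<open>a\<close> and by \<open>- (a + b)\<close>,
  in opposite order. Their commutator is a multiple of \<open>L_{-b}\<close>, which closes the path
  of \<open>P b c\<close>; \<open>T_swap\<close> restores the order of \<open>a\<close> and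
  \<open>b\<close>.\<close>

lemma T_step:
  assumes "a \<in> G" "b \<in> G" "c \<in> G"
  shows "T a b c = T a b (c - a) + (a - b) * P (a + b) c + (2 * a + b) * P b c"
proof -
  have "- (a + b) \<in> G" "b + c \<in> G" using assms by (simp_all add: in_G)
  from bracket[OF this(1) assms(1) this(2)]
  have "(2 * a + b) * f (- b) (b + c)
      = f a (b + c) * f (- (a + b)) (a + b + c) - f (- (a + b)) (b + c) * f a (c - a)"
    by (simp add: algebra_simps)
  then have "f b c * ((2 * a + b) * f (- b) (b + c))
      = f b c * (f a (b + c) * f (- (a + b)) (a + b + c) - f (- (a + b)) (b + c) * f a (c - a))"
    by (rule arg_cong)
  then have "T b a c = T a b (c - a) + (2 * a + b) * P b c" by (simp add: T_def P_def algebra_simps)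
  then show ?thesis using T_swap[OF assms] by simp
qed

text \<open>If \<open>L_b\<close> annihilated the end of a chain, then so would \<open>L_{b \<plusminus> a}\<close> and hence \<open>L_{2b}\<close>, which
  contradicts that \<open>P b c - x (x + b)\<close>, where \<open>x = \<alpha> + c\<close>, is multiplied by 4 when \<open>b\<close> is doubled.\<close>

lemma frequently_nonzero:
  assumes ab: "a \<in> G" "b \<in> G" "c \<in> G" "a \<noteq> 0" "b \<noteq> 0" and g: "gauge a c \<beta> s"
  shows "\<exists>\<^sub>F j :: int in at_top. f b (c + of_int j * a) \<noteq> 0"
proof (rule ccontr)
  assume "\<not> ?thesis"
  then have z: "\<forall>\<^sub>F j :: int in at_top. f b (c + of_int j * a) = 0" by (simp add: frequently_def)
  show False
  proof (cases "b = a \<or> b = - a")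
    \<comment> \<open>Here one of \<open>b - a\<close>, \<open>b + a\<close> is zero, so the
      commutator argument fails; the gauge itself shows that \<open>f b\<close> is nonzero far
      out.\<close>
    case True
    then have "\<exists>i\<in>{1, -1, 2, -2 :: int}. b = of_int i * a" by auto
    then obtain i :: int where i: "i \<in> {1, -1, 2, -2}" "b = of_int i * a" by blast
    have "\<forall>\<^sub>F n in at_top. f (of_int i * a) (c + of_int n * a) * s (n + i)
        = (\<alpha> + c + of_int n * a + \<beta> * (of_int i * a)) * s n" "\<forall>\<^sub>F n in at_top. s n \<noteq> 0"
      using g i(1) by (auto simp: gauge_def)
    moreover have "\<forall>\<^sub>F n :: int in at_top. \<alpha> + c + of_int n * a + \<beta> * (of_int i * a) \<noteq> 0"
      using eventually_affine_nonzero[OF ab(4), of "\<alpha> + c + \<beta> * (of_int i * a)"]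
      by eventually_elim (simp add: algebra_simps)
    ultimately have "\<forall>\<^sub>F n :: int in at_top. False"
      using z by eventually_elim (simp add: i(2))
    then show False by simp
  next
    case False
    have z': "\<forall>\<^sub>F j :: int in at_top. f b (c + of_int (j + i) * a) = 0" for i
      by (rule eventually_shift_int[OF z])
    have mem: "c + of_int j * a \<in> G" for j using ab by (simp add: in_G)
    \<comment> \<open>Eliminating \<gamma> at the end leaves \<open>x * (3 * x + 2 * b) = 0\<close>;
      the last two conditions avoid both roots in advance.\<close>
    have "\<forall>\<^sub>F j :: int in at_top. f (2 * b) (c + of_int j * a) = 0 \<and> f b (c + of_int j * a) = 0
        \<and> \<alpha> + c + of_int j * a \<noteq> 0 \<and> (\<alpha> + c + 2 * b / 3) + of_int j * a \<noteq> 0"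
      using z z'[of 1] z'[of "-1"] z'[of 1] eventually_affine_nonzero[OF ab(4), of "\<alpha> + c"]
        eventually_affine_nonzero[OF ab(4), of "\<alpha> + c + 2 * b / 3"]
    proof eventually_elim
      case (elim j)
      have "(b - a) * f (a + b) (c + of_int j * a) = 0"
        using bracket[OF ab(1,2) mem[of j]] elim by (simp add: algebra_simps)
      moreover have "(b + a) * f (b - a) (c + of_int j * a) = 0"
        using bracket[OF neg_in[OF ab(1)] ab(2) mem[of j]] elim by (simp add: algebra_simps)
      moreover have "b - a \<noteq> 0" "b + a \<noteq> 0" using False by (auto simp: eq_neg_iff_add_eq_0)
      ultimately have "f (a + b) (c + of_int j * a) = 0" "f (b - a) (c + of_int j * a) = 0"
        by simp_all
      then have "(2 * a) * f (2 * b) (c + of_int j * a) = 0"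
        using bracket[OF diff_in[OF ab(2,1)] add_in[OF ab(1,2)] mem[of j]] by simp
      then show ?case using elim ab by simp
    qed
    from eventually_happens'[OF _ this] obtain j :: int
      where j: "f (2 * b) (c + of_int j * a) = 0" "f b (c + of_int j * a) = 0"
      "\<alpha> + c + of_int j * a \<noteq> 0" "(\<alpha> + c + 2 * b / 3) + of_int j * a \<noteq> 0"
      by auto
    obtain \<gamma> where "f b (c + of_int j * a) * f (- b) (b + (c + of_int j * a))
        = (\<alpha> + (c + of_int j * a)) * (\<alpha> + (c + of_int j * a) + b) + \<gamma> * (1 - \<gamma>) * b\<^sup>2"
      "f (2 * b) (c + of_int j * a) * f (- (2 * b)) (2 * b + (c + of_int j * a))
        = (\<alpha> + (c + of_int j * a)) * (\<alpha> + (c + of_int j * a) + 2 * b) + 4 * (\<gamma> * (1 - \<gamma>)) * b\<^sup>2"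
    proof (rule chain[OF ab(2) mem[of j] ab(5)])
      fix \<gamma> s
      assume p: "\<And>n :: int. let x = \<alpha> + (c + of_int j * a) + of_int n * b in
        f b (c + of_int j * a + of_int n * b) * f (- b) (b + (c + of_int j * a + of_int n * b)) = x * (x + b) + \<gamma> * (1 - \<gamma>) * b\<^sup>2"
       and q: "f (2 * b) (c + of_int j * a) * f (- (2 * b)) (2 * b + (c + of_int j * a))
        = (\<alpha> + (c + of_int j * a)) * (\<alpha> + (c + of_int j * a) + 2 * b) + 4 * (\<gamma> * (1 - \<gamma>)) * b\<^sup>2"
      show thesis using that[of \<gamma>] p[of 0] q by (simp add: Let_def)
    qed
    then have "x * (x + b) + \<gamma> * (1 - \<gamma>) * b\<^sup>2 = 0" "x * (x + 2 * b) + 4 * (\<gamma> * (1 - \<gamma>)) * b\<^sup>2 = 0"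
      if "x = \<alpha> + c + of_int j * a" for x
      using j(1,2) by (simp_all add: that add.assoc)
    note * = this[OF refl]
    have "(\<alpha> + c + of_int j * a) * (3 * (\<alpha> + c + of_int j * a) + 2 * b)
        = 4 * ((\<alpha> + c + of_int j * a) * (\<alpha> + c + of_int j * a + b) + \<gamma> * (1 - \<gamma>) * b\<^sup>2)
          - ((\<alpha> + c + of_int j * a) * (\<alpha> + c + of_int j * a + 2 * b) + 4 * (\<gamma> * (1 - \<gamma>)) * b\<^sup>2)"
      by (simp add: algebra_simps)
    then have "3 * (\<alpha> + c + of_int j * a) + 2 * b = 0" unfolding * using j(3) by simp
    moreover have "3 * ((\<alpha> + c + 2 * b / 3) + of_int j * a) = 3 * (\<alpha> + c + of_int j * a) + 2 * b"
      by (simp add: algebra_simps)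
    ultimately show False using j(4) by (metis mult_eq_0_iff zero_neq_numeral)
  qed
qed

text \<open>The determinant condition is not symmetric in the two weights; applying it to \<open>L_b\<close> and to
  \<open>L_{-b}\<close> leaves only equality.\<close>

lemma weights_agree:
  assumes ab: "a \<in> G" "b \<in> G" "c \<in> G" "a \<noteq> 0" "b \<noteq> 0"
    and g: "gauge a c \<beta>\<^sub>1 s" "gauge a (c + b) \<beta>\<^sub>2 t" and n1: "\<beta>\<^sub>1 \<noteq> 1" "\<beta>\<^sub>2 \<noteq> 1"
  shows "\<beta>\<^sub>1 = \<beta>\<^sub>2"
proof -
  have half: "q = p \<or> q = p - 1 \<or> 2 * p = 3 * (p + q)\<^sup>2 - 5 * (p + q) + 2"
    if ab: "a \<in> G" "b \<in> G" "c \<in> G" "a \<noteq> 0" "b \<noteq> 0" and g: "gauge a c p s" "gauge a (c + b) q t"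
    for b c p q s t
  proof (rule equivariant_weights[OF equivariance[OF ab(1-4) g]])
    show "b / a \<noteq> 0" using ab by simp
    have "\<forall>\<^sub>F j in at_top. s j \<noteq> 0" "\<forall>\<^sub>F j in at_top. t j \<noteq> 0"
      using g by (auto simp: gauge_def)
    then have "\<forall>\<^sub>F j in at_top. f b (c + of_int j * a) \<noteq> 0
        \<longrightarrow> f (b + of_int 0 * a) (c + of_int j * a) * t (0 + j) / (s j * a) \<noteq> 0"
      by eventually_elim (use ab in simp)
    with frequently_nonzero[OF ab g(1)]
    show "\<exists>\<^sub>F j in at_top. f (b + of_int 0 * a) (c + of_int j * a) * t (0 + j) / (s j * a) \<noteq> 0"
      by (rule frequently_rev_mp)
  qed
  have fwd: "\<beta>\<^sub>2 = \<beta>\<^sub>1 \<or> \<beta>\<^sub>2 = \<beta>\<^sub>1 - 1 \<or> 2 * \<beta>\<^sub>1 = 3 * (\<beta>\<^sub>1 + \<beta>\<^sub>2)\<^sup>2 - 5 * (\<beta>\<^sub>1 + \<beta>\<^sub>2) + 2"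
    by (rule half[OF ab g])
  have bwd: "\<beta>\<^sub>1 = \<beta>\<^sub>2 \<or> \<beta>\<^sub>1 = \<beta>\<^sub>2 - 1 \<or> 2 * \<beta>\<^sub>2 = 3 * (\<beta>\<^sub>2 + \<beta>\<^sub>1)\<^sup>2 - 5 * (\<beta>\<^sub>2 + \<beta>\<^sub>1) + 2"
    using half[of "- b" "c + b" \<beta>\<^sub>2 t \<beta>\<^sub>1 s] ab g by (simp add: in_G)
  \<comment> \<open>The mixed case reduces to \<open>12 * (p - 1)^2 = 0\<close>, which the
    normalisation excludes. If the quadratic relation holds both ways, the right-hand sides coincide
    and the weights are equal.\<close>
  have exc: "p = 1" if "q = p - 1" "2 * q = 3 * (q + p)\<^sup>2 - 5 * (q + p) + 2" for p q :: complex
  proof -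
    have "12 * ((p - 1) * (p - 1)) = 0" using that(2) unfolding that(1)
      by (simp add: power2_eq_square algebra_simps)
    then show ?thesis by simp
  qed
  consider "\<beta>\<^sub>1 = \<beta>\<^sub>2" | "\<beta>\<^sub>2 = \<beta>\<^sub>1 - 1" "\<beta>\<^sub>1 = \<beta>\<^sub>2 - 1"
    | "\<beta>\<^sub>2 = \<beta>\<^sub>1 - 1" "2 * \<beta>\<^sub>2 = 3 * (\<beta>\<^sub>2 + \<beta>\<^sub>1)\<^sup>2 - 5 * (\<beta>\<^sub>2 + \<beta>\<^sub>1) + 2"
    | "\<beta>\<^sub>1 = \<beta>\<^sub>2 - 1" "2 * \<beta>\<^sub>1 = 3 * (\<beta>\<^sub>1 + \<beta>\<^sub>2)\<^sup>2 - 5 * (\<beta>\<^sub>1 + \<beta>\<^sub>2) + 2"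
    | "2 * \<beta>\<^sub>1 = 2 * \<beta>\<^sub>2"
    using fwd bwd by (metis add.commute)
  then show ?thesis
  proof cases
    case 2
    from 2(2) have "\<beta>\<^sub>1 = \<beta>\<^sub>1 - 2" unfolding 2(1) by simp
    then show ?thesis by simp
  next
    case 3 then show ?thesis using exc n1(1) by blast
  next
    case 4 then show ?thesis using exc n1(2) by blast
  qed simp_all
qed

lemma direction_weight:
  assumes "a \<in> G" "a \<noteq> 0"
  obtains \<beta> where "\<beta> \<noteq> 1" "\<And>c. c \<in> G \<Longrightarrow> \<exists>s. gauge a c \<beta> s"
    "\<And>c. c \<in> G \<Longrightarrow> P a c = (\<alpha> + c) * (\<alpha> + c + a) + \<beta> * (1 - \<beta>) * a\<^sup>2"
proof -
  have ex: "\<exists>\<beta> s. \<beta> \<noteq> 1 \<and> gauge a c \<beta> s \<and> P a c = (\<alpha> + c) * (\<alpha> + c + a) + \<beta> * (1 - \<beta>) * a\<^sup>2"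
    if c: "c \<in> G" for c
  proof (rule chain[OF assms(1) c assms(2)])
    fix \<beta> s
    assume "\<beta> \<noteq> 1" "gauge a c \<beta> s"
     and "\<And>n :: int. let x = \<alpha> + c + of_int n * a in
        f a (c + of_int n * a) * f (- a) (a + (c + of_int n * a)) = x * (x + a) + \<beta> * (1 - \<beta>) * a\<^sup>2"
    note this(1,2) this(3)[of 0]
    then show ?thesis by (auto simp: P_def Let_def)
  qed
  from ex[OF zero_in] obtain \<beta> s where \<beta>: "\<beta> \<noteq> 1" "gauge a 0 \<beta> s"
    "P a 0 = \<alpha> * (\<alpha> + a) + \<beta> * (1 - \<beta>) * a\<^sup>2" by auto
  have "\<exists>s. gauge a c \<beta> s \<and> P a c = (\<alpha> + c) * (\<alpha> + c + a) + \<beta> * (1 - \<beta>) * a\<^sup>2" if c: "c \<in> G" for c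
  proof (cases "c = 0")
    case True then show ?thesis using \<beta> by auto
  next
    case False
    from ex[OF c] obtain \<gamma> t where \<gamma>: "\<gamma> \<noteq> 1" "gauge a c \<gamma> t" "P a c = (\<alpha> + c) * (\<alpha> + c + a) + \<gamma> * (1 - \<gamma>) * a\<^sup>2"
      by blast
    have "\<beta> = \<gamma>"
      using weights_agree[OF assms(1) c zero_in assms(2) False \<beta>(2) _ \<beta>(1) \<gamma>(1)] \<gamma>(2) by simp
    then show ?thesis using \<gamma> by auto
  qed
  then show ?thesis using that[of \<beta>] \<beta>(1) by blast
qed

lemma normal_form:
  assumes ab: "a \<in> G" "b \<in> G" "c \<in> G" "a \<noteq> 0"
    and g: "gauge a c \<beta> s" "gauge a (c + b) \<beta> t"
  obtains K where "\<forall>\<^sub>F j in at_top. f b (c + of_int j * a) * t j = K * (\<alpha> + c + of_int j * a + \<beta> * b) * s j"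
proof -
  obtain K where K: "\<forall>\<^sub>F j in at_top. f (b + of_int 0 * a) (c + of_int j * a) * t (0 + j) / (s j * a)
      = K * ((\<alpha> + c) / a + of_int j + \<beta> * (b / a))"
    by (rule equivariant_normal_form[OF equivariance[OF ab g]])
  have "\<forall>\<^sub>F j in at_top. s j \<noteq> 0" using g by (simp add: gauge_def)
  with K have "\<forall>\<^sub>F j in at_top. f b (c + of_int j * a) * t j = K * (\<alpha> + c + of_int j * a + \<beta> * b) * s j"
    by eventually_elim (use ab(4) in \<open>simp add: field_simps\<close>)
  then show ?thesis by (rule that)
qed

section \<open>One weight for all directions\<close>

text \<open>Here \<beta> is the weight of direction \<open>a\<close> while \<open>P b\<close>
  belongs to direction \<open>b\<close>. The normal form gives \<open>P b\<close> up to a factor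
  \<open>\<kappa>\<close> on the chain of \<open>c\<close> and \<open>\<kappa>'\<close> on that of
  \<open>c - b\<close>; \<open>P_step\<close> links the two chains, and its coefficients give
  \<open>\<kappa> = \<kappa>'\<close> and \<open>\<kappa> + \<kappa>' = 2\<close>.\<close>

lemma P_eventually:
  assumes ab: "a \<in> G" "b \<in> G" "c \<in> G" "a \<noteq> 0" "b \<noteq> 0"
    and g: "\<forall>c\<in>G. \<exists>s. gauge a c \<beta> s"
  shows "\<forall>\<^sub>F j :: int in at_top. let x = \<alpha> + c + of_int j * a in
    P b (c + of_int j * a) = x * (x + b) + \<beta> * (1 - \<beta>) * b\<^sup>2"
proof -
  have ex: "\<exists>\<kappa>. \<forall>\<^sub>F j :: int in at_top. P b (c + of_int j * a)
      = \<kappa> * ((\<alpha> + c + of_int j * a + \<beta> * b) * (\<alpha> + c + of_int j * a + b - \<beta> * b))" if c: "c \<in> G" for c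
  proof -
    have cb: "c + b \<in> G" using c ab by (simp add: in_G)
    obtain s t where st: "gauge a c \<beta> s" "gauge a (c + b) \<beta> t" using g c cb by blast
    obtain K where K: "\<forall>\<^sub>F j in at_top. f b (c + of_int j * a) * t j = K * (\<alpha> + c + of_int j * a + \<beta> * b) * s j"
      using normal_form[OF ab(1,2) c ab(4) st] .
    have "gauge a (c + b + - b) \<beta> s" using st by simp
    from normal_form[OF ab(1) neg_in[OF ab(2)] cb ab(4) st(2) this]
    obtain L where L: "\<forall>\<^sub>F j in at_top. f (- b) (c + b + of_int j * a) * s j
        = L * (\<alpha> + (c + b) + of_int j * a + \<beta> * - b) * t j" by blast
    have nz: "\<forall>\<^sub>F j in at_top. s j \<noteq> 0" "\<forall>\<^sub>F j in at_top. t j \<noteq> 0" using st by (auto simp: gauge_def)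
    have "\<forall>\<^sub>F j :: int in at_top. P b (c + of_int j * a)
      = (K * L) * ((\<alpha> + c + of_int j * a + \<beta> * b) * (\<alpha> + c + of_int j * a + b - \<beta> * b))"
      using K L nz
    proof eventually_elim
      case (elim j)
      have "P b (c + of_int j * a) * (s j * t j) = (f b (c + of_int j * a) * t j) * (f (- b) (c + b + of_int j * a) * s j)"
        by (simp add: P_def algebra_simps)
      also have "\<dots> = (K * L) * ((\<alpha> + c + of_int j * a + \<beta> * b) * (\<alpha> + c + of_int j * a + b - \<beta> * b)) * (s j * t j)"
        unfolding elim(1,2) by (simp add: algebra_simps)
      finally show ?case using elim(3,4) by simp
    qed
    then show ?thesis by blast
  qed
  obtain \<kappa> where \<kappa>: "\<forall>\<^sub>F j :: int in at_top. P b (c + of_int j * a)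
      = \<kappa> * ((\<alpha> + c + of_int j * a + \<beta> * b) * (\<alpha> + c + of_int j * a + b - \<beta> * b))"
    using ex[OF ab(3)] by blast
  have cb: "c - b \<in> G" using ab by (simp add: in_G)
  obtain \<kappa>' where \<kappa>': "\<forall>\<^sub>F j :: int in at_top. P b (c - b + of_int j * a)
      = \<kappa>' * ((\<alpha> + (c - b) + of_int j * a + \<beta> * b) * (\<alpha> + (c - b) + of_int j * a + b - \<beta> * b))"
    using ex[OF cb] by blast
  have "\<forall>\<^sub>F j :: int in at_top. let z = (\<alpha> + c) + of_int j * a in
      (\<kappa> - \<kappa>') * \<beta> * (1 - \<beta>) * b\<^sup>2 + (b * (\<kappa> + \<kappa>' - 2)) * z + (\<kappa> - \<kappa>') * z^2 + 0 * z^3 + 0 * z^4 = 0"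
    using \<kappa> \<kappa>'
  proof eventually_elim
    case (elim j)
    define z where "z = \<alpha> + c + of_int j * a"
    have "c + of_int j * a \<in> G" using ab by (simp add: in_G)
    from P_step[OF ab(2) this] have "P b (c + of_int j * a) = P b (c - b + of_int j * a) + 2 * b * z"
      by (simp add: z_def algebra_simps)
    moreover have "P b (c + of_int j * a) = \<kappa> * ((z + \<beta> * b) * (z + b - \<beta> * b))"
      "P b (c - b + of_int j * a) = \<kappa>' * ((z - b + \<beta> * b) * (z - \<beta> * b))"
      using elim by (simp_all add: z_def algebra_simps)
    ultimately have "\<kappa> * ((z + \<beta> * b) * (z + b - \<beta> * b)) - (\<kappa>' * ((z - b + \<beta> * b) * (z - \<beta> * b)) + 2 * b * z) = 0"
      by simp
    then have "(\<kappa> - \<kappa>') * \<beta> * (1 - \<beta>) * b\<^sup>2 + (b * (\<kappa> + \<kappa>' - 2)) * z + (\<kappa> - \<kappa>') * z^2 + 0 * z^3 + 0 * z^4 = 0"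
      by (simp add: algebra_simps power2_eq_square)
    then show ?case unfolding Let_def z_def .
  qed
  from frequently_quartic_zero(2,3)[OF eventually_imp_frequently_int[OF this] ab(4)]
  have "\<kappa> = 1" using ab(5) by simp
  from \<kappa> show ?thesis unfolding Let_def
    by eventually_elim (simp add: \<open>\<kappa> = 1\<close> algebra_simps power2_eq_square)
qed

lemma T_eventually:
  assumes ab: "a \<in> G" "b \<in> G" "c \<in> G" "a \<noteq> 0"
    and g: "\<forall>c\<in>G. \<exists>s. gauge a c \<beta> s"
  obtains \<kappa> where "\<forall>\<^sub>F j :: int in at_top. let x = \<alpha> + c + of_int j * a in
    T a b (c + of_int j * a) = \<kappa> * ((x + \<beta> * a) * (x + a + \<beta> * b) * (x + (1 - \<beta>) * (a + b)))"
proof -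
  have cb: "c + b \<in> G" "- (a + b) \<in> G" using ab by (simp_all add: in_G)
  obtain s t where st: "gauge a c \<beta> s" "gauge a (c + b) \<beta> t" using g ab(3) cb(1) by blast
  \<comment> \<open>The path of \<open>T\<close>, after its first step by \<open>a\<close>, returns
    to the original chain; based at \<open>c - a\<close> that chain is the one of \<open>c\<close>
    with its index moved by one.\<close>
  define u where "u n = s (n - 1)" for n
  have "gauge a (c - a) \<beta> u"
    unfolding gauge_def
  proof (intro conjI ballI)
    show "\<forall>\<^sub>F n in at_top. u n \<noteq> 0"
      using st(1) eventually_shift_int[of "\<lambda>n. s n \<noteq> 0" "-1"] by (simp add: gauge_def u_def)
    fix i :: int assume "i \<in> {1, -1, 2, -2}"
    then have "\<forall>\<^sub>F n in at_top. f (of_int i * a) (c + of_int n * a) * s (n + i)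
        = (\<alpha> + c + of_int n * a + \<beta> * (of_int i * a)) * s n" using st(1) by (auto simp: gauge_def)
    from eventually_shift_int[OF this, of "-1"]
    show "\<forall>\<^sub>F n in at_top. f (of_int i * a) (c - a + of_int n * a) * u (n + i)
        = (\<alpha> + (c - a) + of_int n * a + \<beta> * (of_int i * a)) * u n"
      by eventually_elim (simp add: u_def algebra_simps)
  qed
  then have u: "gauge a (c + b + - (a + b)) \<beta> u" by simp
  obtain K where K: "\<forall>\<^sub>F j in at_top. f b (c + of_int j * a) * t j = K * (\<alpha> + c + of_int j * a + \<beta> * b) * s j"
    using normal_form[OF ab st] .
  obtain L where L: "\<forall>\<^sub>F j in at_top. f (- (a + b)) (c + b + of_int j * a) * u j
      = L * (\<alpha> + (c + b) + of_int j * a + \<beta> * - (a + b)) * t j"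
    using normal_form[OF ab(1) cb(2,1) ab(4) st(2) u] .
  have s: "\<forall>\<^sub>F n in at_top. f (of_int 1 * a) (c + of_int n * a) * s (n + 1)
        = (\<alpha> + c + of_int n * a + \<beta> * (of_int 1 * a)) * s n" using st(1) by (auto simp: gauge_def)
  have nz: "\<forall>\<^sub>F j in at_top. s j \<noteq> 0" "\<forall>\<^sub>F j in at_top. t j \<noteq> 0" using st by (auto simp: gauge_def)
  have "\<forall>\<^sub>F j :: int in at_top. let x = \<alpha> + c + of_int j * a in
    T a b (c + of_int j * a) = (K * L) * ((x + \<beta> * a) * (x + a + \<beta> * b) * (x + (1 - \<beta>) * (a + b)))"
    using eventually_shift_int[OF K, of 1] eventually_shift_int[OF L, of 1] s nz(1)
      eventually_shift_int[OF nz(1), of 1] eventually_shift_int[OF nz(2), of 1]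
  proof eventually_elim
    case (elim j)
    define x where "x = \<alpha> + c + of_int j * a"
    define p q r where "p = f a (c + of_int j * a)" and "q = f b (c + of_int (j + 1) * a)"
      and "r = f (- (a + b)) (c + b + of_int (j + 1) * a)"
    have e: "q * t (j + 1) = K * (x + a + \<beta> * b) * s (j + 1)"
      "r * s j = L * (x + (1 - \<beta>) * (a + b)) * t (j + 1)"
      "p * s (j + 1) = (x + \<beta> * a) * s j"
      using elim(1-3) by (simp_all add: p_def q_def r_def x_def u_def algebra_simps)
    have "T a b (c + of_int j * a) = p * q * r" by (simp add: T_def p_def q_def r_def algebra_simps)
    then have "T a b (c + of_int j * a) * (s j * s (j + 1) * t (j + 1)) = (p * s (j + 1)) * (q * t (j + 1)) * (r * s j)"
      by (simp add: algebra_simps)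
    also have "\<dots> = (K * L) * ((x + \<beta> * a) * (x + a + \<beta> * b) * (x + (1 - \<beta>) * (a + b))) * (s j * s (j + 1) * t (j + 1))"
      unfolding e by (simp only: mult_ac)
    finally show ?case using elim(4-6) unfolding Let_def x_def[symmetric] by simp
  qed
  then show ?thesis by (rule that)
qed

text \<open>\<open>Q\<close> and \<open>T\<close> satisfy the same step equation with increment
  \<open>R\<close>. Far out \<open>T = \<kappa> * Q\<close>, hence
  \<open>(\<kappa> - 1) * R = 0\<close>, and the leading coefficient \<open>3 * a\<close> of
  \<open>R\<close> gives \<open>\<kappa> = 1\<close>. The difference \<open>T - Q\<close> is
  constant along the chain and zero far out, so it vanishes at \<open>c\<close> too.\<close>

lemma T_value:
  assumes ab: "a \<in> G" "b \<in> G" "c \<in> G" "a \<noteq> 0"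
    and g: "\<forall>c\<in>G. \<exists>s. gauge a c \<beta> s"
    and P: "\<And>a c. a \<in> G \<Longrightarrow> c \<in> G \<Longrightarrow> P a c = (\<alpha> + c) * (\<alpha> + c + a) + \<beta> * (1 - \<beta>) * a\<^sup>2"
  shows "T a b c = (\<alpha> + c + \<beta> * a) * (\<alpha> + c + a + \<beta> * b) * (\<alpha> + c + (1 - \<beta>) * (a + b))"
proof -
  define Q where "Q x = (x + \<beta> * a) * (x + a + \<beta> * b) * (x + (1 - \<beta>) * (a + b))" for x
  define R where "R x = (a - b) * (x * (x + (a + b)) + \<beta> * (1 - \<beta>) * (a + b)\<^sup>2) + (2 * a + b) * (x * (x + b) + \<beta> * (1 - \<beta>) * b\<^sup>2)" for x
  have QR: "Q x = Q (x - a) + R x" for x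
    unfolding Q_def R_def by algebra
  have mem: "c + of_int j * a \<in> G" for j using ab by (simp add: in_G)
  have step: "T a b (c + of_int j * a) = T a b (c + of_int (j - 1) * a) + R (\<alpha> + c + of_int j * a)" for j :: int
  proof -
    have *: "c + of_int j * a - a = c + of_int (j - 1) * a" by (simp add: algebra_simps)
    show ?thesis
      using T_step[OF ab(1,2) mem[of j]]
      unfolding * P[OF add_in[OF ab(1,2)] mem[of j]] P[OF ab(2) mem[of j]] R_def by (simp add: add.assoc)
  qed
  obtain \<kappa> where \<kappa>: "\<forall>\<^sub>F j :: int in at_top. T a b (c + of_int j * a) = \<kappa> * Q (\<alpha> + c + of_int j * a)"
    using T_eventually[OF ab g] unfolding Q_def Let_def by blast
  have "\<forall>\<^sub>F j :: int in at_top. let z = (\<alpha> + c) + of_int j * a in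
    (\<kappa> - 1) * \<beta> * (1 - \<beta>) * ((a - b) * (a + b)\<^sup>2 + (2 * a + b) * b\<^sup>2) + ((\<kappa> - 1) * ((a - b) * (a + b) + (2 * a + b) * b)) * z
     + ((\<kappa> - 1) * (3 * a)) * z^2 + 0 * z^3 + 0 * z^4 = 0"
    using \<kappa> eventually_shift_int[OF \<kappa>, of "-1"]
  proof eventually_elim
    case (elim j)
    define z where "z = \<alpha> + c + of_int j * a"
    have za: "z - a = \<alpha> + c + of_int (j - 1) * a" by (simp add: z_def algebra_simps)
    have "\<kappa> * Q z = \<kappa> * Q (z - a) + R z"
      unfolding za using step[of j] elim by (simp add: z_def)
    then have "(\<kappa> - 1) * R z = 0" unfolding QR[of z] by (simp add: algebra_simps)
    then have "(\<kappa> - 1) * \<beta> * (1 - \<beta>) * ((a - b) * (a + b)\<^sup>2 + (2 * a + b) * b\<^sup>2) + ((\<kappa> - 1) * ((a - b) * (a + b) + (2 * a + b) * b)) * z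
     + ((\<kappa> - 1) * (3 * a)) * z^2 + 0 * z^3 + 0 * z^4 = 0"
      unfolding R_def by algebra
    then show ?case unfolding Let_def z_def .
  qed
  from frequently_quartic_zero(3)[OF eventually_imp_frequently_int[OF this] ab(4)]
  have "\<kappa> = 1" using ab(4) by simp
  define h where "h j = T a b (c + of_int j * a) - Q (\<alpha> + c + of_int j * a)" for j :: int
  have h: "h j = h (j - 1)" for j
  proof -
    have *: "\<alpha> + c + of_int j * a - a = \<alpha> + c + of_int (j - 1) * a" by (simp add: algebra_simps)
    show ?thesis using step[of j] QR[of "\<alpha> + c + of_int j * a"] unfolding * by (simp add: h_def)
  qed
  have "\<forall>\<^sub>F j in at_top. h j = 0" using \<kappa> by eventually_elim (simp add: h_def \<open>\<kappa> = 1\<close>)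
  then obtain j where "h j = 0" using eventually_happens' trivial_limit_at_top_linorder by blast
  then have "h 0 = 0" using int_const_if_shift_invariant[of h j] h by simp
  then show ?thesis by (simp add: h_def Q_def)
qed

text \<open>These are the closed products of the intermediate series module
  \<open>L_a v_c = (\<alpha> + c + \<beta> * a) v_{a + c}\<close>. Zeros of \<open>f\<close> prevent
  a direct identification of the modules.\<close>

definition series_weight :: "complex \<Rightarrow> bool" where
  "series_weight \<beta> \<longleftrightarrow>
    (\<forall>a\<in>G. \<forall>c\<in>G. P a c = (\<alpha> + c) * (\<alpha> + c + a) + \<beta> * (1 - \<beta>) * a\<^sup>2) \<and>
    (\<forall>a\<in>G. \<forall>b\<in>G. \<forall>c\<in>G.
      T a b c = (\<alpha> + c + \<beta> * a) * (\<alpha> + c + a + \<beta> * b) * (\<alpha> + c + (1 - \<beta>) * (a + b)))"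

lemma series_weightD:
  assumes "series_weight \<beta>" "a \<in> G" "c \<in> G"
  shows "P a c = (\<alpha> + c) * (\<alpha> + c + a) + \<beta> * (1 - \<beta>) * a\<^sup>2"
    and "b \<in> G \<Longrightarrow> T a b c = (\<alpha> + c + \<beta> * a) * (\<alpha> + c + a + \<beta> * b) * (\<alpha> + c + (1 - \<beta>) * (a + b))"
  using assms by (simp_all add: series_weight_def)

lemma intermediate_series:
  assumes e: "e \<in> G" "e \<noteq> 0"
  obtains \<beta> where "\<beta> \<noteq> 1" "series_weight \<beta>"
proof -
  have "\<exists>\<beta>. \<beta> \<noteq> 1 \<and> (\<forall>c\<in>G. \<exists>s. gauge a c \<beta> s) \<and> (\<forall>c\<in>G. P a c = (\<alpha> + c) * (\<alpha> + c + a) + \<beta> * (1 - \<beta>) * a\<^sup>2)"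
    if "a \<in> G" "a \<noteq> 0" for a using direction_weight[OF that] by metis
  then obtain w where w: "\<And>a. a \<in> G \<Longrightarrow> a \<noteq> 0 \<Longrightarrow> w a \<noteq> 1"
    "\<And>a c. a \<in> G \<Longrightarrow> a \<noteq> 0 \<Longrightarrow> c \<in> G \<Longrightarrow> \<exists>s. gauge a c (w a) s"
    "\<And>a c. a \<in> G \<Longrightarrow> a \<noteq> 0 \<Longrightarrow> c \<in> G \<Longrightarrow> P a c = (\<alpha> + c) * (\<alpha> + c + a) + w a * (1 - w a) * a\<^sup>2"
    by metis
  have kap: "w a * (1 - w a) = w b * (1 - w b)" if ab: "a \<in> G" "a \<noteq> 0" "b \<in> G" "b \<noteq> 0" for a b
  proof -
    have "\<forall>c\<in>G. \<exists>s. gauge a c (w a) s" using w(2) ab by blast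
    from P_eventually[OF ab(1,3) zero_in ab(2,4) this]
    have "\<forall>\<^sub>F j :: int in at_top. w a * (1 - w a) * b\<^sup>2 = w b * (1 - w b) * b\<^sup>2"
    proof eventually_elim
      case (elim j)
      have "of_int j * a \<in> G" using ab by (simp add: in_G)
      from w(3)[OF ab(3,4) this] elim show ?case by (auto simp: Let_def)
    qed
    then show ?thesis using ab by simp
  qed
  have P: "P a c = (\<alpha> + c) * (\<alpha> + c + a) + w b * (1 - w b) * a\<^sup>2"
    if "a \<in> G" "c \<in> G" "b \<in> G" "b \<noteq> 0" for a b c
  proof (cases "a = 0")
    case True then show ?thesis using that f0 by (simp add: P_def)
  next
    case False then show ?thesis using w(3)[of a c] kap[of a b] that by simp
  qed
  have T: "T a b c = (\<alpha> + c + w a * a) * (\<alpha> + c + a + w a * b) * (\<alpha> + c + (1 - w a) * (a + b))"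
    if "a \<in> G" "b \<in> G" "c \<in> G" "a \<noteq> 0" for a b c
    by (rule T_value[OF that _ P[OF _ _ that(1,4)]]) (use w(2) that in blast)
  \<comment> \<open>By \<open>kap\<close> the only alternative is \<open>w b = 1 - w a\<close>. Then
    \<open>T_swap\<close> compares \<open>T a b 0\<close> and \<open>T b a 0\<close>, computed with
    different weights, and gives \<open>p * (1 - p) * (1 - 2 * p) = 0\<close>, where each root is
    excluded.\<close>
  have agree: "w a = w b" if ab: "a \<in> G" "b \<in> G" "a \<noteq> 0" "b \<noteq> 0" "a + b \<noteq> 0" for a b
  proof (rule ccontr)
    assume ne: "w a \<noteq> w b"
    define p q where "p = w a" and "q = w b"
    have pq: "p * (1 - p) = q * (1 - q)" "p \<noteq> q" "p \<noteq> 1" "q \<noteq> 1"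
      using kap[of a b] ab ne w(1) by (auto simp: p_def q_def)
    have "(p - q) * (1 - (p + q)) = 0" using pq(1) by (simp add: algebra_simps)
    then have "1 - (p + q) = 0" using pq(2) by (metis mult_eq_0_iff right_minus_eq)
    then have q: "q = 1 - p" by algebra
    have "(\<alpha> + p * a) * (\<alpha> + a + p * b) * (\<alpha> + (1 - p) * (a + b))
        = (\<alpha> + q * b) * (\<alpha> + b + q * a) * (\<alpha> + (1 - q) * (b + a)) + (a - b) * (\<alpha> * (\<alpha> + (a + b)) + p * (1 - p) * (a + b)\<^sup>2)"
      using T_swap[OF ab(1,2) zero_in] T[OF ab(1,2) zero_in ab(3)] T[OF ab(2,1) zero_in ab(4)]
        P[OF add_in[OF ab(1,2)] zero_in ab(1,3)]
      by (simp add: p_def q_def)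
    then have "(a * b * (a + b)) * (p * (1 - p) * (1 - 2 * p)) = 0" unfolding q by algebra
    then have "p = 0 \<or> p = 1 \<or> 2 * p = 1" using ab by auto
    then show False using pq q by auto
  qed
  have we: "w a = w e" if a: "a \<in> G" "a \<noteq> 0" for a
  proof (cases "a + e = 0")
    case False then show ?thesis using agree[of a e] a e by simp
  next
    case True
    have e2: "2 * e \<in> G" "2 * e \<noteq> 0" using e by (simp_all add: in_G)
    have "a + 2 * e \<noteq> 0" using True e by (simp add: algebra_simps add_eq_0_iff2)
    then show ?thesis using agree[of a "2 * e"] agree[of "2 * e" e] a e e2 by simp
  qed
  show ?thesis
  proof (rule that[of "w e"])
    show "w e \<noteq> 1" using w(1) e by simp
    have "P a c = (\<alpha> + c) * (\<alpha> + c + a) + w e * (1 - w e) * a\<^sup>2" if "a \<in> G" "c \<in> G" for a c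
      using P[OF that e] .
    moreover have "T a b c = (\<alpha> + c + w e * a) * (\<alpha> + c + a + w e * b) * (\<alpha> + c + (1 - w e) * (a + b))"
      if "a \<in> G" "b \<in> G" "c \<in> G" for a b c
    proof (cases "a = 0")
      case True
      have "T a b c = (\<alpha> + c) * P b c" using True that f0 by (simp add: T_def P_def)
      then show ?thesis using P[OF that(2,3) e] True by (simp add: algebra_simps power2_eq_square)
    next
      case False then show ?thesis using T[OF that False] we[OF that(1) False] by simp
    qed
    ultimately show "series_weight (w e)" by (simp add: series_weight_def)
  qed
qed

end

section \<open>Graded structures\<close>

locale graded_clsas = add_subgroup G for G +
  fixes f :: "complex \<Rightarrow> complex \<Rightarrow> complex"
  assumes lie: "\<And>a b. a \<in> G \<Longrightarrow> b \<in> G \<Longrightarrow> f a b - f b a = b - a"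
    and left_sym: "\<And>a b c. a \<in> G \<Longrightarrow> b \<in> G \<Longrightarrow> c \<in> G \<Longrightarrow>
      (b - a) * f (a + b) c = f b c * f a (b + c) - f a c * f b (a + c)"
begin

definition \<alpha> :: complex where "\<alpha> = f 0 0"

text \<open>Left symmetry of \<open>L_0\<close>, \<open>L_c\<close>, \<open>L_0\<close> gives
  \<open>f c 0 * (f 0 c - \<alpha> - c) = 0\<close>, and \<open>f c 0 = f 0 c - c\<close>.\<close>

lemma f_zero_cases:
  assumes "c \<in> G"
  shows "f 0 c = c \<or> f 0 c = \<alpha> + c"
  using left_sym[OF zero_in assms zero_in] lie[OF zero_in assms]
  by (auto simp: \<alpha>_def algebra_simps)

text \<open>\<open>[L_0, L_a] = a L_a\<close>, so left multiplication by \<open>L_a\<close> raises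
  eigenvalues of \<open>L_0\<close> by exactly \<open>a\<close>.\<close>

lemma f_eq_0_if_weights_differ:
  assumes "a \<in> G" "c \<in> G" "f 0 (a + c) - (a + c) \<noteq> f 0 c - c"
  shows "f a c = 0"
proof -
  have "f a c * ((f 0 (a + c) - (a + c)) - (f 0 c - c)) = 0"
    using left_sym[OF zero_in assms(1,2)] by (simp add: algebra_simps)
  then show ?thesis using assms(3) unfolding mult_eq_0_iff right_minus_eq by blast
qed

text \<open>The \<open>L\<^sub>0\<close>-weight of \<open>c\<close> is \<open>c\<close> or \<open>\<alpha> + c\<close>. If both kinds occurred, the weights of the
  first kind would be closed under doubling while each of them would equal \<open>- 8 \<alpha> / 5\<close>.\<close>

lemma f_zero_left:
  assumes "c \<in> G"
  shows "f 0 c = \<alpha> + c"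
proof (rule ccontr)
  assume "f 0 c \<noteq> \<alpha> + c"
  then have c: "f 0 c = c" "\<alpha> \<noteq> 0" using f_zero_cases[OF assms] by auto
  have "c \<noteq> 0" using c by (auto simp: \<alpha>_def)
  have neg: "f 0 (- s) = \<alpha> - s" if s: "s \<in> G" "s \<noteq> 0" "f 0 s = s" for s
  proof (rule ccontr)
    have ms: "- s \<in> G" using s by (simp add: in_G)
    assume "f 0 (- s) \<noteq> \<alpha> - s"
    then have h: "f 0 (- s) = - s" using f_zero_cases[OF ms] by auto
    have "f s (- s) = 0" using f_eq_0_if_weights_differ[OF s(1) ms] h c(2) by (simp add: \<alpha>_def)
    moreover have "f (- s) s = 0" using f_eq_0_if_weights_differ[OF ms s(1)] s c(2) by (simp add: \<alpha>_def)
    ultimately show False using lie[OF s(1) ms] s by simp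
  qed
  have dbl: "f 0 (2 * s) = 2 * s" if s: "s \<in> G" "s \<noteq> 0" "f 0 s = s" for s
  proof (rule ccontr)
    have ms: "- s \<in> G" "2 * s \<in> G" using s by (simp_all add: in_G)
    assume "f 0 (2 * s) \<noteq> 2 * s"
    then have h: "f 0 (2 * s) = \<alpha> + 2 * s" using f_zero_cases[OF ms(2)] by auto
    have "f (2 * s) (- s) = 0" using f_eq_0_if_weights_differ[OF ms(2,1)] neg[OF s] c(2) s(3) by simp
    moreover have "f (- s) (2 * s) = 0" using f_eq_0_if_weights_differ[OF ms] h s c(2) by simp
    ultimately show False using lie[OF ms] s by simp
  qed
  have key: "8 * \<alpha> = - 5 * s" if s: "s \<in> G" "s \<noteq> 0" "f 0 s = s" for s
  proof -
    have ms: "- s \<in> G" "2 * s \<in> G" "- (2 * s) \<in> G" using s by (simp_all add: in_G)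
    have s2: "2 * s \<noteq> 0" "f 0 (2 * s) = 2 * s" using s dbl by auto
    note n1 = neg[OF s] and n2 = neg[OF ms(2) s2]
    have "f (- s) s = 0" using f_eq_0_if_weights_differ[OF ms(1) s(1)] s c(2) by (simp add: \<alpha>_def)
    then have v1: "f s (- s) = - 2 * s" using lie[OF s(1) ms(1)] by simp
    have "f (- (2 * s)) (2 * s) = 0" using f_eq_0_if_weights_differ[OF ms(3,2)] s2 c(2) by (simp add: \<alpha>_def)
    then have v2: "f (2 * s) (- (2 * s)) = - 4 * s" using lie[OF ms(2,3)] by simp
    have "f (- (2 * s)) s = 0" using f_eq_0_if_weights_differ[OF ms(3) s(1)] s n1 c(2) by simp
    then have v3: "f s (- (2 * s)) = - 3 * s" using lie[OF s(1) ms(3)] by simp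
    have v4: "f (2 * s) (- s) = 0" using f_eq_0_if_weights_differ[OF ms(2,1)] n1 c(2) s(3) by simp
    have v5: "f (- s) 0 = \<alpha>" using lie[OF ms(1) zero_in] n1 by simp
    have eqs: "2 * s + - s = s" "- s + - s = - (2 * s)" "s + - s = 0" by simp_all
    \<comment> \<open>The one structure constant left unknown; left symmetry at
      \<open>2 * s, - s, - s\<close> and at \<open>s, - s, - s\<close> gives two linear equations
      for it, whose compatibility ties \<alpha> to \<open>s\<close>.\<close>
    define X where "X = f (- s) (- s)"
    have "(- s - 2 * s) * (- 2 * s) = X * (- 4 * s) - 0 * f (- s) s"
      using left_sym[OF ms(2,1,1)] unfolding eqs v1 v2 v4 X_def .
    then have "s * (4 * X + 6 * s) = 0" by algebra
    then have X1: "4 * X + 6 * s = 0" using s(2) by simp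
    have "(- s - s) * (\<alpha> - s) = X * (- 3 * s) - (- 2 * s) * \<alpha>"
      using left_sym[OF s(1) ms(1,1)] unfolding eqs n1 v1 v3 v5 X_def .
    then have "s * (3 * X - 4 * \<alpha> + 2 * s) = 0" by algebra
    then have "3 * X - 4 * \<alpha> + 2 * s = 0" using s(2) by simp
    with X1 show ?thesis by algebra
  qed
  have "8 * \<alpha> = - 5 * c" "8 * \<alpha> = - 5 * (2 * c)"
    using key[of c] key[of "2 * c"] dbl[of c] assms \<open>c \<noteq> 0\<close> c by (simp_all add: in_G)
  then show False using \<open>c \<noteq> 0\<close> by simp
qed

sublocale witt_module G f \<alpha>
  by unfold_locales (simp_all add: f_zero_left left_sym)

lemma f_zero_right: "a \<in> G \<Longrightarrow> f a 0 = \<alpha>"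
  using lie[OF zero_in, of a] f_zero_left[of a] by simp

lemma P_zero: "a \<in> G \<Longrightarrow> P a 0 = \<alpha> * f (- a) a"
  by (simp add: P_def f_zero_right)

lemma T_zero: "a \<in> G \<Longrightarrow> T a b 0 = f b a * (\<alpha> * f (- (a + b)) (a + b))"
  by (simp add: T_def f_zero_right)

section \<open>Recovering \<open>f\<close> from the closed products\<close>

text \<open>Since \<open>f a 0 = \<alpha>\<close>, the product \<open>T a b 0\<close> is
  \<open>f b a\<close> times \<open>P (a + b) 0\<close>. Both are known, so \<open>f b a\<close>
  follows after cancelling their common factor
  \<open>\<alpha> + (1 - \<beta>) * (a + b)\<close>.\<close>

lemma f_off_exceptional_level:
  assumes ab: "a \<in> G" "b \<in> G"
    and w: "series_weight \<beta>"
  shows "\<alpha> + (1 - \<beta>) * (a + b) = 0 \<or> f b a * (\<alpha> + \<beta> * (a + b)) = (\<alpha> + \<beta> * a) * (\<alpha> + a + \<beta> * b)"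
proof -
  have "\<alpha> * f (- (a + b)) (a + b) = (\<alpha> + \<beta> * (a + b)) * (\<alpha> + (1 - \<beta>) * (a + b))"
    using series_weightD(1)[OF w add_in[OF ab] zero_in] P_zero[OF add_in[OF ab]]
    by (simp add: algebra_simps power2_eq_square)
  then have "f b a * ((\<alpha> + \<beta> * (a + b)) * (\<alpha> + (1 - \<beta>) * (a + b)))
      = (\<alpha> + \<beta> * a) * (\<alpha> + a + \<beta> * b) * (\<alpha> + (1 - \<beta>) * (a + b))"
    using series_weightD(2)[OF w ab(1) zero_in ab(2)] T_zero[OF ab(1)] by simp
  then have "(f b a * (\<alpha> + \<beta> * (a + b)) - (\<alpha> + \<beta> * a) * (\<alpha> + a + \<beta> * b)) * (\<alpha> + (1 - \<beta>) * (a + b)) = 0"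
    by (simp add: algebra_simps)
  then show ?thesis by auto
qed

text \<open>\<open>d\<close> is the deviation of \<open>f\<close> from \<open>\<alpha> + b\<close>
  on the level \<open>\<alpha> + a + b = 0\<close>. Left symmetry makes \<open>d x / x\<close>
  affine, and \<open>lie\<close> makes \<open>d\<close> invariant under
  \<open>x \<mapsto> - \<alpha> - x\<close>, so \<open>d x = q * x * (x + \<alpha>)\<close>; here
  \<open>x + \<alpha>\<close> is \<open>- b\<close>.\<close>

lemma exceptional_level:
  assumes e: "e \<in> G" "e \<noteq> 0" and "\<alpha> \<in> G"
    and off: "\<And>a b. a \<in> G \<Longrightarrow> b \<in> G \<Longrightarrow> \<alpha> + a + b \<noteq> 0 \<Longrightarrow> f a b = \<alpha> + b"
  obtains \<eta> where "\<And>a b. a \<in> G \<Longrightarrow> b \<in> G \<Longrightarrow> \<alpha> + a + b = 0 \<Longrightarrow> f a b = \<alpha> + b + \<eta> * a * b"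
proof -
  define d where "d x = f x (- \<alpha> - x) + x" for x
  have ma: "- \<alpha> - x \<in> G" if "x \<in> G" for x using that \<open>\<alpha> \<in> G\<close> by (simp add: in_G)
  have d_eq: "(a - b) * d (a + b) = (a + b) * (d a - d b)"
    if ab: "a \<in> G" "b \<in> G" "a \<noteq> 0" "b \<noteq> 0" for a b
  proof -
    define c where "c = - \<alpha> - (a + b)"
    have c: "c \<in> G" using ma[OF add_in[OF ab(1,2)]] by (simp add: c_def)
    have "f b c = \<alpha> + c" "f a c = \<alpha> + c" using off ab c by (simp_all add: c_def)
    moreover have "f a (b + c) = d a - a" "f b (a + c) = d b - b" "f (a + b) c = d (a + b) - (a + b)"
      by (simp_all add: d_def c_def add.commute[of _ "- \<alpha>"] flip: diff_diff_eq)
    ultimately have "(b - a) * (d (a + b) - (a + b)) = (\<alpha> + c) * (d a - a) - (\<alpha> + c) * (d b - b)"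
      using left_sym[OF ab(1,2) c] by simp
    moreover have "\<alpha> + c = - (a + b)" by (simp add: c_def)
    ultimately show ?thesis by algebra
  qed
  obtain p q where pq: "\<And>x. x \<in> G \<Longrightarrow> x \<noteq> 0 \<Longrightarrow> d x / x = p + q * x"
  proof (rule affine_if_weighted_additive[OF e])
    fix a b assume ab: "a \<in> G" "b \<in> G" "a \<noteq> 0" "b \<noteq> 0" "a + b \<noteq> 0"
    show "(a - b) * (d (a + b) / (a + b)) = a * (d a / a) - b * (d b / b)"
      using d_eq[OF ab(1-4)] ab by (simp add: field_simps)
  qed (rule that)
  have d0: "d 0 = 0" using f_zero_left[OF ma[OF zero_in]] by (simp add: d_def)
  have dx: "d x = p * x + q * x\<^sup>2" if "x \<in> G" for x
  proof (cases "x = 0")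
    case False then show ?thesis using pq[OF that False] by (simp add: field_simps power2_eq_square)
  qed (simp add: d0)
  have sym: "d x = d (- \<alpha> - x)" if "x \<in> G" for x
    using lie[OF that ma[OF that]] by (simp add: d_def algebra_simps)
  have p: "p = q * \<alpha>"
  proof (cases "\<alpha> = 0")
    case True
    have "2 * e * p = 0" using sym[OF e(1)] dx[OF e(1)] dx[OF neg_in[OF e(1)]] True by (simp add: algebra_simps)
    then show ?thesis using e True by simp
  next
    case False
    have "d (- \<alpha>) = 0" using sym[OF zero_in] d0 by simp
    then have "\<alpha> * (q * \<alpha> - p) = 0" using dx[OF neg_in[OF \<open>\<alpha> \<in> G\<close>]] by (simp add: algebra_simps power2_eq_square)
    then show ?thesis using False by simp
  qed
  show ?thesis
  proof (rule that[of "- q"])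
    fix a b assume ab: "a \<in> G" "b \<in> G" "\<alpha> + a + b = 0"
    then have b: "b = - \<alpha> - a" by algebra
    show "f a b = \<alpha> + b + - q * a * b"
      using dx[OF ab(1)] unfolding d_def p b by (simp add: algebra_simps power2_eq_square)
  qed
qed

lemma classification_alpha_nonzero:
  assumes "\<alpha> \<noteq> 0" "\<beta> \<noteq> 0" "\<beta> \<noteq> 1" and w: "series_weight \<beta>"
  shows "\<And>x. x \<in> G \<Longrightarrow> \<alpha> + \<beta> * x \<noteq> 0"
    "\<And>a b. a \<in> G \<Longrightarrow> b \<in> G \<Longrightarrow> f b a * (\<alpha> + \<beta> * (a + b)) = (\<alpha> + \<beta> * a) * (\<alpha> + a + \<beta> * b)"
proof -
  have P: "P a c = (\<alpha> + c) * (\<alpha> + c + a) + \<beta> * (1 - \<beta>) * a\<^sup>2" if "a \<in> G" "c \<in> G" for a c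
    by (rule series_weightD(1)[OF w that])
  note key = f_off_exceptional_level[OF _ _ w]
  show nz: "\<alpha> + \<beta> * x \<noteq> 0" if x: "x \<in> G" for x
  proof
    assume 0: "\<alpha> + \<beta> * x = 0"
    then have "x \<noteq> 0" using \<open>\<alpha> \<noteq> 0\<close> by auto
    have mem: "2 * x \<in> G" "- x \<in> G" using x by (simp_all add: in_G)
    have al: "\<alpha> = - \<beta> * x" using 0 by algebra
    show False
    \<comment> \<open>Off the exceptional level the pair \<open>2 * x\<close>, \<open>- x\<close>
      with sum \<open>x\<close> contradicts \<open>key\<close>. On it, \<beta> = 1/2 and
      \<open>x = - 2 * \<alpha>\<close>; then \<open>key\<close> gives \<open>f x x = 0\<close>,
      against the value of \<open>P (- x) (2 * x)\<close>.\<close>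
    proof (cases "\<alpha> + (1 - \<beta>) * x = 0")
      case False
      then have "f (- x) (2 * x) * (\<alpha> + \<beta> * x) = (\<alpha> + \<beta> * (2 * x)) * (\<alpha> + 2 * x + \<beta> * - x)"
        using key[OF mem] by simp
      then have "(\<beta> * x) * (2 * (1 - \<beta>) * x) = 0" unfolding al by algebra
      then show False using \<open>x \<noteq> 0\<close> \<open>\<beta> \<noteq> 0\<close> \<open>\<beta> \<noteq> 1\<close> by simp
    next
      case True
      then have "x * (1 - 2 * \<beta>) = 0" unfolding al by algebra
      then have \<beta>: "2 * \<beta> = 1" using \<open>x \<noteq> 0\<close> by simp
      then have x2: "x = - 2 * \<alpha>" using al by algebra
      have *: "\<alpha> + (1 - \<beta>) * (x + x) = - \<alpha>" "\<alpha> + \<beta> * (x + x) = - \<alpha>"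
        using \<beta> unfolding x2 by algebra+
      have "\<alpha> + (1 - \<beta>) * (x + x) \<noteq> 0" "\<alpha> + \<beta> * (x + x) \<noteq> 0" unfolding * using \<open>\<alpha> \<noteq> 0\<close> by simp_all
      then have "f x x = 0" using key[OF x x] 0 by auto
      then have "P (- x) (2 * x) = 0" by (simp add: P_def)
      then have "(\<alpha> + 2 * x) * (\<alpha> + 2 * x - x) + \<beta> * (1 - \<beta>) * x\<^sup>2 = 0"
        using P[OF mem(2,1)] by simp
      then have "4 * x\<^sup>2 = 0" using \<beta> x2 by algebra
      then show False using \<open>x \<noteq> 0\<close> by simp
    qed
  qed
  show "f b a * (\<alpha> + \<beta> * (a + b)) = (\<alpha> + \<beta> * a) * (\<alpha> + a + \<beta> * b)" if ab: "a \<in> G" "b \<in> G" for a b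
  proof (cases "\<alpha> + (1 - \<beta>) * (a + b) = 0 \<and> a \<noteq> 0 \<and> b \<noteq> 0")
    case False
    then consider "\<alpha> + (1 - \<beta>) * (a + b) \<noteq> 0" | "a = 0" | "b = 0" by blast
    then show ?thesis
    proof cases
      case 1 then show ?thesis using key[OF ab] by blast
    next
      case 2 then show ?thesis using f_zero_right[OF ab(2)] by simp
    next
      case 3 then show ?thesis using f_zero_left[OF ab(1)] by simp
    qed
  next
    \<comment> \<open>On the exceptional level \<open>f b a\<close> is read off from
      \<open>P b a\<close>, whose return step \<open>f (- b) (a + b)\<close> lies off the
      level.\<close>
    case True
    have mem: "a + b \<in> G" "- b \<in> G" using ab by (simp_all add: in_G)
    have al: "\<alpha> = - (1 - \<beta>) * (a + b)" using True by algebra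
    have "\<alpha> + (1 - \<beta>) * a = - (1 - \<beta>) * b" unfolding al by algebra
    then have "f (- b) (a + b) * (\<alpha> + \<beta> * a) = (\<alpha> + \<beta> * (a + b)) * (\<alpha> + (a + b) - \<beta> * b)"
      using key[OF mem] True \<open>\<beta> \<noteq> 1\<close> by auto
    moreover have "\<alpha> + (a + b) - \<beta> * b = \<beta> * a" unfolding al by algebra
    ultimately have 1: "f (- b) (a + b) * (\<alpha> + \<beta> * a) = (\<alpha> + \<beta> * (a + b)) * (\<beta> * a)" by simp
    have "f b a * f (- b) (a + b) = (\<alpha> + a + \<beta> * b) * (\<beta> * a)"
      using P[OF ab(2,1)] unfolding P_def \<open>\<alpha> + (a + b) - \<beta> * b = \<beta> * a\<close>[symmetric]
      by (simp add: algebra_simps power2_eq_square)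
    then have "(f b a * (\<alpha> + \<beta> * (a + b)) - (\<alpha> + \<beta> * a) * (\<alpha> + a + \<beta> * b)) * (\<beta> * a) = 0"
      using 1 by algebra
    then show ?thesis using True \<open>\<beta> \<noteq> 0\<close> by simp
  qed
qed

lemma classification_alpha_zero:
  assumes e: "e \<in> G" "e \<noteq> 0" and "\<alpha> = 0"
    and w: "series_weight 0"
  shows "(\<forall>a\<in>G. \<forall>b\<in>G. a + b \<noteq> 0 \<longrightarrow> f a b = b) \<or> (\<exists>\<theta>. \<theta> \<noteq> 0 \<and> (\<forall>x\<in>G. 1 + \<theta> * x \<noteq> 0) \<and>
      (\<forall>a\<in>G. \<forall>b\<in>G. f a b = b * (1 + \<theta> * b) / (1 + \<theta> * (a + b))))"
proof -
  have P: "P a c = c * (c + a)" if "a \<in> G" "c \<in> G" for a c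
    using series_weightD(1)[OF w that] \<open>\<alpha> = 0\<close> by simp
  have T: "T a b c = c * (c + a) * (c + a + b)" if "a \<in> G" "b \<in> G" "c \<in> G" for a b c
    using series_weightD(2)[OF w that(1,3,2)] \<open>\<alpha> = 0\<close> by (simp add: add.assoc)
  \<comment> \<open>\<open>S\<close> rescales the basis relative to \<open>e\<close>: the closed
    path from \<open>c\<close> via \<open>a + c\<close> and \<open>e\<close> gives
    \<open>f a c = c * S c / S (a + c)\<close>, as long as neither weight is 0.\<close>
  define S where "S c = f (e - c) c / c" for c
  have S: "S c \<noteq> 0 \<and> f (c - e) e = e / S c" if c: "c \<in> G" "c \<noteq> 0" for c
  proof -
    have "e - c \<in> G" using c e by (simp add: in_G)
    then have "f (e - c) c * f (c - e) e = c * e" using P[of "e - c" c] c by (simp add: P_def)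
    moreover from this have "f (e - c) c \<noteq> 0" using c e by auto
    ultimately show ?thesis using c by (simp add: S_def field_simps)
  qed
  have fS: "f a c = c * S c / S (a + c)" if ac: "a \<in> G" "c \<in> G" "c \<noteq> 0" "a + c \<noteq> 0" for a c
  proof -
    have "e - a - c \<in> G" "a + c \<in> G" using ac e by (simp_all add: in_G)
    then have "f a c * f (e - a - c) (a + c) * f (c - e) e = c * (c + a) * e"
      using T[of a "e - a - c" c] ac by (simp add: T_def algebra_simps)
    moreover have "f (e - a - c) (a + c) = (a + c) * S (a + c)" using ac by (simp add: S_def diff_diff_eq)
    ultimately have "f a c * ((a + c) * S (a + c)) * (e / S c) = c * (c + a) * e"
      using S[OF ac(2,3)] by simp
    then have "(a + c) * e * (f a c * S (a + c)) = (a + c) * e * (c * S c)"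
      using S[OF ac(2,3)] by (simp add: field_simps)
    then have "f a c * S (a + c) = c * S c" using ac e by simp
    then show ?thesis using S[OF \<open>a + c \<in> G\<close> ac(4)] by (simp add: field_simps)
  qed
  obtain A B where AB: "\<And>x. x \<in> G \<Longrightarrow> x \<noteq> 0 \<Longrightarrow> S x = A + B * x"
  proof (rule affine_if_weighted_additive[OF e])
    fix a b assume ab: "a \<in> G" "b \<in> G" "a \<noteq> 0" "b \<noteq> 0" "a + b \<noteq> 0"
    have "b * S b / S (a + b) - a * S a / S (a + b) = b - a"
      using lie[OF ab(1,2)] fS[of a b] fS[of b a] ab by (simp add: add.commute)
    then show "(a - b) * S (a + b) = a * S a - b * S b"
      using S[OF add_in[OF ab(1,2)] ab(5)] by (simp add: field_simps)
  qed (rule that)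
  \<comment> \<open>Closed products through weight 0 vanish and say nothing about
    \<open>f x (- x)\<close>, so left symmetry is used directly.\<close>
  obtain p q where pq: "\<And>x. x \<in> G \<Longrightarrow> x \<noteq> 0 \<Longrightarrow> f x (- x) / (x * S (- x)) = p + q * x"
  proof (rule affine_if_weighted_additive[OF e])
    fix a b assume ab: "a \<in> G" "b \<in> G" "a \<noteq> 0" "b \<noteq> 0" "a + b \<noteq> 0"
    have mem: "- a \<in> G" "- b \<in> G" "- (a + b) \<in> G" using ab by (simp_all add: in_G)
    have n0: "- a \<noteq> 0" "- b \<noteq> 0" "- (a + b) \<noteq> 0" using ab(3-5) unfolding neg_equal_0_iff_equal .
    have nz: "S (- a) \<noteq> 0" "S (- b) \<noteq> 0" "S (- (a + b)) \<noteq> 0"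
      using S[OF mem(1) n0(1)] S[OF mem(2) n0(2)] S[OF mem(3) n0(3)] by blast+
    have "f b (- (a + b)) = - (a + b) * S (- (a + b)) / S (- a)"
      "f a (- (a + b)) = - (a + b) * S (- (a + b)) / S (- b)"
      using fS[OF ab(2) mem(3) n0(3)] fS[OF ab(1) mem(3) n0(3)] ab(3,4) by simp_all
    define u v where "u = f a (- a) / S (- a)" and "v = f b (- b) / S (- b)"
    have "(b - a) * f (a + b) (- (a + b)) = - (a + b) * S (- (a + b)) * u - (- (a + b) * S (- (a + b))) * v"
      using left_sym[OF ab(1,2) mem(3)] \<open>f b (- (a + b)) = _\<close> \<open>f a (- (a + b)) = _\<close> by (simp add: u_def v_def)
    then have "(a - b) * f (a + b) (- (a + b)) = (a + b) * S (- (a + b)) * (u - v)" by algebra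
    then have "(a - b) * f (a + b) (- (a + b)) = (a + b) * S (- (a + b)) * (f a (- a) / S (- a) - f b (- b) / S (- b))"
      by (simp add: u_def v_def)
    then have "(a - b) * f (a + b) (- (a + b)) / ((a + b) * S (- (a + b))) = f a (- a) / S (- a) - f b (- b) / S (- b)"
      using nz(3) ab(5) by simp
    then show "(a - b) * (f (a + b) (- (a + b)) / ((a + b) * S (- (a + b))))
        = a * (f a (- a) / (a * S (- a))) - b * (f b (- b) / (b * S (- b)))"
      using ab by simp
  qed (rule that)
  have U: "f x (- x) = x * (A - B * x) * (p + q * x)" if x: "x \<in> G" "x \<noteq> 0" for x
  proof -
    have "S (- x) = A - B * x" "x * S (- x) \<noteq> 0" using AB[of "- x"] S[of "- x"] x by (simp_all add: in_G)
    then show ?thesis using pq[OF x] by (simp add: nonzero_divide_eq_eq mult_ac)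
  qed
  have "A * p - B * q * x\<^sup>2 = - 1" if x: "x \<in> G" "x \<noteq> 0" for x
  proof -
    have "x * (A - B * x) * (p + q * x) - (- x) * (A + B * x) * (p - q * x) = - 2 * x"
      using lie[OF x(1) neg_in[OF x(1)]] U[OF x] U[of "- x"] x by (simp add: in_G)
    then have "2 * x * (A * p - B * q * x\<^sup>2 + 1) = 0" by algebra
    then show ?thesis using x by (simp add: add_eq_0_iff2)
  qed
  \<comment> \<open>Two points separate the terms: \<open>B * q = 0\<close> and
    \<open>A * p = - 1\<close>. If \<open>B = 0\<close>, then \<open>f\<close> is a translation off
    the level \<open>a + b = 0\<close>; otherwise \<open>q = 0\<close> and
    \<open>\<theta> = B / A\<close>.\<close>
  from this[OF e] this[of "2 * e"] e have pq': "A * p - B * q * e\<^sup>2 = - 1" "A * p - B * q * (2 * e)\<^sup>2 = - 1"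
    by (simp_all add: in_G)
  then have "3 * e\<^sup>2 * (B * q) = 0" by algebra
  then have Bq: "B * q = 0" using e by simp
  then have Ap: "A * p = - 1" using pq' by auto
  then have "A \<noteq> 0" by auto
  show ?thesis
  proof (cases "B = 0")
    case True
    have "f a b = b" if "a \<in> G" "b \<in> G" "a + b \<noteq> 0" for a b
    proof (cases "b = 0")
      case True then show ?thesis using f_zero_right that \<open>\<alpha> = 0\<close> by simp
    next
      case False
      then show ?thesis using fS[of a b] AB[of b] AB[of "a + b"] that \<open>B = 0\<close> \<open>A \<noteq> 0\<close> by (simp add: in_G)
    qed
    then show ?thesis by blast
  next
    case False
    then have q: "q = 0" using Bq by simp
    define \<theta> where "\<theta> = B / A"
    have SA: "S x = A * (1 + \<theta> * x)" if "x \<in> G" "x \<noteq> 0" for x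
      using AB[OF that] \<open>A \<noteq> 0\<close> by (simp add: \<theta>_def field_simps)
    have nz: "1 + \<theta> * x \<noteq> 0" if "x \<in> G" for x
      using SA[OF that] S[OF that] by (cases "x = 0") auto
    have "f a b = b * (1 + \<theta> * b) / (1 + \<theta> * (a + b))" if ab: "a \<in> G" "b \<in> G" for a b
    proof (cases "b = 0 \<or> a + b = 0")
      case True
      then show ?thesis
      proof
        assume "b = 0" then show ?thesis using f_zero_right ab \<open>\<alpha> = 0\<close> by simp
      next
        assume 0: "a + b = 0"
        then have b: "b = - a" by (simp add: add_eq_0_iff2)
        have "A * (1 - \<theta> * a) = A - B * a" using \<open>A \<noteq> 0\<close> by (simp add: \<theta>_def field_simps)
        then have "a * (A - B * a) * p = - a * (1 - \<theta> * a)" using Ap by algebra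
        then show ?thesis using U[of a] ab f_zero_right[OF zero_in] \<open>\<alpha> = 0\<close> unfolding b q by (cases "a = 0") auto
      qed
    next
      case False
      then show ?thesis using fS[OF ab] SA[OF ab(2)] SA[OF add_in[OF ab]] \<open>A \<noteq> 0\<close> by simp
    qed
    moreover have "\<theta> \<noteq> 0" using False \<open>A \<noteq> 0\<close> by (simp add: \<theta>_def)
    ultimately show ?thesis using nz by blast
  qed
qed

text \<open>In the generic formula \<open>\<alpha> * \<theta>\<close> is the weight \<beta>; at
  \<open>\<alpha> * \<theta> = 1\<close> it collapses to \<open>\<alpha> + b\<close>, which is the
  first case.\<close>

theorem graded_classification:
  assumes e: "e \<in> G" "e \<noteq> 0"
  obtains (translation) "\<And>a b. a \<in> G \<Longrightarrow> b \<in> G \<Longrightarrow> f a b = \<alpha> + b"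
  | (generic) \<theta> where "\<theta> \<noteq> 0" "\<alpha> * \<theta> \<noteq> 1" "\<And>x. x \<in> G \<Longrightarrow> 1 + \<theta> * x \<noteq> 0"
    "\<And>a b. a \<in> G \<Longrightarrow> b \<in> G \<Longrightarrow> f a b = (\<alpha> + b + \<alpha> * \<theta> * a) * (1 + \<theta> * b) / (1 + \<theta> * (a + b))"
  | (exceptional) \<eta> where "\<alpha> \<in> G" "\<eta> \<noteq> 0"
    "\<And>a b. a \<in> G \<Longrightarrow> b \<in> G \<Longrightarrow> f a b = \<alpha> + b + (if \<alpha> + a + b = 0 then \<eta> * a * b else 0)"
proof -
  obtain \<beta> where "\<beta> \<noteq> 1"
    and w: "series_weight \<beta>"
    using intermediate_series[OF e] by blast
  have flat: thesis if off: "\<And>a b. a \<in> G \<Longrightarrow> b \<in> G \<Longrightarrow> \<alpha> + a + b \<noteq> 0 \<Longrightarrow> f a b = \<alpha> + b"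
  proof (cases "\<alpha> \<in> G")
    case False
    have "\<alpha> + a + b \<noteq> 0" if "a \<in> G" "b \<in> G" for a b
    proof
      assume "\<alpha> + a + b = 0"
      then have "\<alpha> = - (a + b)" by algebra
      then show False using False that by (simp add: in_G)
    qed
    then show thesis using off translation by blast
  next
    case True
    obtain \<eta> where \<eta>: "\<And>a b. a \<in> G \<Longrightarrow> b \<in> G \<Longrightarrow> \<alpha> + a + b = 0 \<Longrightarrow> f a b = \<alpha> + b + \<eta> * a * b"
      using exceptional_level[OF e True off] by blast
    have f: "f a b = \<alpha> + b + (if \<alpha> + a + b = 0 then \<eta> * a * b else 0)" if "a \<in> G" "b \<in> G" for a b
      using off[OF that] \<eta>[OF that] by auto
    show thesis
    proof (cases "\<eta> = 0")
      case True then show thesis using translation f by simp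
    next
      case False then show thesis using exceptional[OF True False] f by blast
    qed
  qed
  show thesis
  proof (cases "\<alpha> = 0")
    case True
    have "\<beta> * (1 - \<beta>) * e\<^sup>2 = 0" using series_weightD(1)[OF w e(1) zero_in] P_zero[OF e(1)] True by simp
    then have "\<beta> = 0" using e \<open>\<beta> \<noteq> 1\<close> by simp
    from classification_alpha_zero[OF e True w[unfolded this]] show thesis
    proof (elim disjE exE conjE)
      assume "\<forall>a\<in>G. \<forall>b\<in>G. a + b \<noteq> 0 \<longrightarrow> f a b = b"
      then show thesis using True by (intro flat) auto
    next
      fix \<theta> assume "\<theta> \<noteq> 0" "\<forall>x\<in>G. 1 + \<theta> * x \<noteq> 0" "\<forall>a\<in>G. \<forall>b\<in>G. f a b = b * (1 + \<theta> * b) / (1 + \<theta> * (a + b))"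
      then show thesis using True by (intro generic[of \<theta>]) auto
    qed
  next
    case False
    show thesis
    proof (cases "\<beta> = 0")
      case True
      have "f a b = \<alpha> + b" if ab: "a \<in> G" "b \<in> G" "\<alpha> + a + b \<noteq> 0" for a b
        using f_off_exceptional_level[OF ab(2,1) w] ab(3) True False by (auto simp: add_ac)
      then show thesis by (rule flat)
    next
      case \<beta>: False
      note c = classification_alpha_nonzero[OF False \<beta> \<open>\<beta> \<noteq> 1\<close> w]
      define \<theta> where "\<theta> = \<beta> / \<alpha>"
      have \<theta>: "1 + \<theta> * x = (\<alpha> + \<beta> * x) / \<alpha>" "\<alpha> * \<theta> = \<beta>" for x using False by (simp_all add: \<theta>_def field_simps)
      show thesis
      proof (rule generic[of \<theta>])
        show "\<theta> \<noteq> 0" "\<alpha> * \<theta> \<noteq> 1" using \<beta> False \<open>\<beta> \<noteq> 1\<close> by (simp_all add: \<theta>_def)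
        show "1 + \<theta> * x \<noteq> 0" if "x \<in> G" for x using c(1)[OF that] False unfolding \<theta> by simp
        fix a b assume ab: "a \<in> G" "b \<in> G"
        have "f a b = (\<alpha> + b + \<beta> * a) * (\<alpha> + \<beta> * b) / (\<alpha> + \<beta> * (a + b))"
          using c(2)[OF ab(2,1)] c(1)[OF add_in[OF ab]]
          by (simp add: nonzero_eq_divide_eq add.commute[of b a] mult.commute[of "\<alpha> + \<beta> * b"])
        then show "f a b = (\<alpha> + b + \<alpha> * \<theta> * a) * (1 + \<theta> * b) / (1 + \<theta> * (a + b))"
          unfolding \<theta> using False by simp
      qed
    qed
  qed
qed

end

section \<open>Shifted structures\<close>

locale shifted_clsas = graded_clsas G f for G f +
  fixes g :: "complex \<Rightarrow> complex \<Rightarrow> complex" and \<zeta> :: complex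
  assumes \<zeta>_in: "\<zeta> \<in> G" and \<zeta>_nz: "\<zeta> \<noteq> 0"
    and g_sym: "\<And>a b. a \<in> G \<Longrightarrow> b \<in> G \<Longrightarrow> g a b = g b a"
    and g_cocycle: "\<And>a b c. a \<in> G \<Longrightarrow> b \<in> G \<Longrightarrow> c \<in> G \<Longrightarrow>
      (b - a) * g (a + b) c = f b c * g a (b + c) + g b c * f a (b + c + \<zeta>)
        - f a c * g b (a + c) - g a c * f b (a + c + \<zeta>)"
    and g_comm: "\<And>a b c. a \<in> G \<Longrightarrow> b \<in> G \<Longrightarrow> c \<in> G \<Longrightarrow>
      g b c * g a (b + c + \<zeta>) = g a c * g b (a + c + \<zeta>)"
begin

text \<open>The cocycle equation at \<open>a = 0\<close>: the shift by \<zeta> changes the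
  eigenvalue of \<open>L_0\<close> by \<zeta> \<noteq> 0, so the \<open>g\<close>-part of left
  multiplication by \<open>L_b\<close> is, up to \<zeta>, its commutator with
  \<open>L_c \<mapsto> g 0 c L_{c + \<zeta>}\<close>.\<close>

lemma g_from_g0:
  assumes "b \<in> G" "c \<in> G"
  shows "\<zeta> * g b c = f b (c + \<zeta>) * g 0 c - f b c * g 0 (b + c)"
proof -
  have "c + \<zeta> \<in> G" "b + c + \<zeta> \<in> G" using assms \<zeta>_in by (simp_all add: in_G)
  then show ?thesis
    using g_cocycle[OF zero_in assms] f_zero_left[OF assms(2)] f_zero_left[of "b + c + \<zeta>"]
    by (simp add: algebra_simps)
qed

lemma g0_cocycle:
  assumes "b \<in> G" "c \<in> G"
  shows "(c - b) * g 0 (b + c) = f b (c + \<zeta>) * g 0 c - f c (b + \<zeta>) * g 0 b"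
  unfolding lie[OF assms, symmetric]
  using g_from_g0[OF assms] g_from_g0[OF assms(2,1)] g_sym[OF assms]
  by (simp add: algebra_simps)

text \<open>This makes \<open>g 0\<close> a multiple of \<open>f c \<zeta>\<close> except when
  \<open>\<alpha> = - \<zeta>\<close>, hence the case split in each family below.\<close>

lemma g0_scaled: "c \<in> G \<Longrightarrow> (\<alpha> + \<zeta>) * g 0 c = f c \<zeta> * g 0 0"
  using g0_cocycle[OF zero_in, of c] f_zero_left[of "c + \<zeta>"] \<zeta>_in by (simp add: in_G algebra_simps)

lemma g0_comm: "a \<in> G \<Longrightarrow> g 0 0 * g a \<zeta> = g 0 a * g 0 (a + \<zeta>)"
  using g_comm[OF _ zero_in zero_in, of a] g_sym[OF _ zero_in, of a] by simp

lemma g_zero_if_g0_zero: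
  assumes "\<And>c. c \<in> G \<Longrightarrow> g 0 c = 0" "a \<in> G" "b \<in> G"
  shows "g a b = 0"
  using g_from_g0[OF assms(2,3)] assms(1)[OF assms(3)] assms(1)[OF add_in[OF assms(2,3)]] \<zeta>_nz by simp

lemma zeta_multiples_in: "numeral k * \<zeta> \<in> G" "- \<zeta> \<in> G"
  using \<zeta>_in by (simp_all add: in_G)

text \<open>Inserting \<open>g0_scaled\<close> and \<open>g_from_g0\<close> into the quadratic
  equation \<open>g0_comm\<close> eliminates \<open>g\<close>; what remains is a condition on
  \<open>f\<close> that obstructs \<open>g 0 0 \<noteq> 0\<close>.\<close>

lemma proportional:
  assumes "\<alpha> + \<zeta> \<noteq> 0" "g 0 0 \<noteq> 0" "a \<in> G"
  shows "(\<alpha> + \<zeta>) * f a (2 * \<zeta>) * f \<zeta> \<zeta> = (\<alpha> + 2 * \<zeta>) * f a \<zeta> * f (a + \<zeta>) \<zeta>"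
proof -
  define u v w x y where "u = f a (2 * \<zeta>)" and "v = f \<zeta> \<zeta>" and "w = f a \<zeta>" and "x = f (a + \<zeta>) \<zeta>"
    and "y = g 0 0"
  have mem: "a + \<zeta> \<in> G" using assms \<zeta>_in by (simp add: in_G)
  have 1: "\<zeta> * g a \<zeta> = u * g 0 \<zeta> - w * g 0 (a + \<zeta>)"
    using g_from_g0[OF assms(3) \<zeta>_in] by (simp add: u_def w_def)
  have 2: "y * g a \<zeta> = g 0 a * g 0 (a + \<zeta>)" using g0_comm[OF assms(3)] by (simp add: y_def)
  have 3: "(\<alpha> + \<zeta>) * g 0 \<zeta> = v * y" "(\<alpha> + \<zeta>) * g 0 a = w * y" "(\<alpha> + \<zeta>) * g 0 (a + \<zeta>) = x * y"
    using g0_scaled[OF \<zeta>_in] g0_scaled[OF assms(3)] g0_scaled[OF mem] by (simp_all add: v_def w_def x_def y_def)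
  have "(\<alpha> + \<zeta>)^2 * (y * (\<zeta> * g a \<zeta>)) = \<zeta> * ((\<alpha> + \<zeta>) * g 0 a) * ((\<alpha> + \<zeta>) * g 0 (a + \<zeta>))"
    using 2 by algebra
  moreover have "(\<alpha> + \<zeta>)^2 * (y * (\<zeta> * g a \<zeta>)) = (\<alpha> + \<zeta>) * y * (u * ((\<alpha> + \<zeta>) * g 0 \<zeta>) - w * ((\<alpha> + \<zeta>) * g 0 (a + \<zeta>)))"
    unfolding 1 by algebra
  ultimately have "\<zeta> * (w * y) * (x * y) = (\<alpha> + \<zeta>) * y * (u * (v * y) - w * (x * y))"
    unfolding 3 by (rule trans[OF sym])
  then have "y^2 * ((\<alpha> + \<zeta>) * u * v - (\<alpha> + 2 * \<zeta>) * w * x) = 0" by algebra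
  then have "(\<alpha> + \<zeta>) * u * v - (\<alpha> + 2 * \<zeta>) * w * x = 0" using assms(2) by (simp add: y_def)
  then show ?thesis by (simp add: u_def v_def w_def x_def)
qed

section \<open>The shift \<open>g\<close> for each family of \<open>f\<close>\<close>

lemma g_translation:
  assumes f: "\<And>a b. a \<in> G \<Longrightarrow> b \<in> G \<Longrightarrow> f a b = \<alpha> + b"
  obtains \<mu> where "\<And>a b. a \<in> G \<Longrightarrow> b \<in> G \<Longrightarrow> g a b = \<mu>"
proof -
  have "\<exists>\<mu>. \<forall>c\<in>G. g 0 c = \<mu>"
  proof (cases "\<alpha> + \<zeta> = 0")
    case False
    then have "g 0 c = g 0 0" if "c \<in> G" for c
      using g0_scaled[OF that] f[OF that \<zeta>_in] by simp
    then show ?thesis by blast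
  next
    case True
    then have al: "\<alpha> = - \<zeta>" by algebra
    have eq: "(c - b) * g 0 (b + c) = c * g 0 c - b * g 0 b" if "b \<in> G" "c \<in> G" for b c
      using g0_cocycle[OF that] f[of b "c + \<zeta>"] f[of c "b + \<zeta>"] that \<zeta>_in
      by (simp add: in_G al)
    obtain p q where pq: "\<And>x. x \<in> G \<Longrightarrow> x \<noteq> 0 \<Longrightarrow> g 0 x = p + q * x"
    proof (rule affine_if_weighted_additive[OF \<zeta>_in \<zeta>_nz])
      fix a b assume "a \<in> G" "b \<in> G"
      then show "(a - b) * g 0 (a + b) = a * g 0 a - b * g 0 b"
        using eq[of b a] by (simp add: add.commute)
    qed (rule that)
    have "2 * \<zeta> * g 0 0 = 2 * \<zeta> * p"
      using eq[OF zeta_multiples_in(2) \<zeta>_in] pq[OF \<zeta>_in \<zeta>_nz] pq[OF zeta_multiples_in(2)] \<zeta>_nz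
      by (simp add: algebra_simps)
    then have "g 0 0 = p" using \<zeta>_nz by simp
    then have g0: "g 0 x = p + q * x" if "x \<in> G" for x using pq[OF that] by (cases "x = 0") auto
    have gz: "g a \<zeta> = p + q * \<zeta>" if a: "a \<in> G" for a
    proof -
      have "\<zeta> * g a \<zeta> = \<zeta> * (p + q * \<zeta>)"
        using g_from_g0[OF a \<zeta>_in] f[OF a \<zeta>_in] f[OF a zeta_multiples_in(1)[of "num.Bit0 num.One"]] g0[OF \<zeta>_in] by (simp add: al)
      then show ?thesis using \<zeta>_nz by simp
    qed
    have "p * (p + q * \<zeta>) = (p + q * a) * (p + q * (a + \<zeta>))" if a: "a \<in> G" for a
      using g0_comm[OF a] gz[OF a] g0[OF zero_in] g0[OF a] g0[OF add_in[OF a \<zeta>_in]] by simp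
    from this[OF \<zeta>_in] this[OF zeta_multiples_in(1)[of "num.Bit0 num.One"]]
    have "p * (p + q * \<zeta>) = (p + q * \<zeta>) * (p + q * (\<zeta> + \<zeta>))"
      "p * (p + q * \<zeta>) = (p + q * (2 * \<zeta>)) * (p + q * (2 * \<zeta> + \<zeta>))" by simp_all
    then have "2 * (q * \<zeta>)^2 = 0" by algebra
    then have "q = 0" using \<zeta>_nz by simp
    then show ?thesis using g0 by auto
  qed
  then obtain \<mu> where \<mu>: "\<And>c. c \<in> G \<Longrightarrow> g 0 c = \<mu>" by blast
  show ?thesis
  proof (rule that)
    fix a b assume ab: "a \<in> G" "b \<in> G"
    have "\<zeta> * g a b = \<zeta> * \<mu>"
      using g_from_g0[OF ab] f[OF ab] f[OF ab(1) add_in[OF ab(2) \<zeta>_in]] \<mu>[OF ab(2)] \<mu>[OF add_in[OF ab]]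
      by (simp add: algebra_simps)
    then show "g a b = \<mu>" using \<zeta>_nz by simp
  qed
qed

lemma g_generic:
  assumes \<theta>: "\<theta> \<noteq> 0" "\<alpha> * \<theta> \<noteq> 1" "\<And>x. x \<in> G \<Longrightarrow> 1 + \<theta> * x \<noteq> 0"
    and f: "\<And>a b. a \<in> G \<Longrightarrow> b \<in> G \<Longrightarrow> f a b = (\<alpha> + b + \<alpha> * \<theta> * a) * (1 + \<theta> * b) / (1 + \<theta> * (a + b))"
    and ab: "a \<in> G" "b \<in> G"
  shows "g a b = 0"
proof (cases "\<alpha> + \<zeta> = 0")
  case False
  have "g 0 0 = 0"
  proof (rule ccontr)
    assume nz: "g 0 0 \<noteq> 0"
    have "(\<alpha> + \<zeta>) * (\<alpha> + 2 * \<zeta> + \<alpha> * \<theta> * a) * (\<alpha> + \<zeta> + \<alpha> * \<theta> * \<zeta>) * (1 + \<theta> * (a + \<zeta>))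
      = (\<alpha> + 2 * \<zeta>) * (\<alpha> + \<zeta> + \<alpha> * \<theta> * a) * (\<alpha> + \<zeta> + \<alpha> * \<theta> * (a + \<zeta>)) * (1 + \<theta> * \<zeta>)"
      if a: "a \<in> G" for a
    proof -
      define d1 d2 d3 d4 where "d1 = 1 + \<theta> * \<zeta>" and "d2 = 1 + \<theta> * (2 * \<zeta>)"
        and "d3 = 1 + \<theta> * (a + \<zeta>)" and "d4 = 1 + \<theta> * (a + 2 * \<zeta>)"
      have d: "d1 \<noteq> 0" "d2 \<noteq> 0" "d3 \<noteq> 0" "d4 \<noteq> 0"
        using \<theta>(3) a \<zeta>_in by (simp_all add: d1_def d2_def d3_def d4_def in_G)
      have "f a (2 * \<zeta>) = (\<alpha> + 2 * \<zeta> + \<alpha> * \<theta> * a) * d2 / d4"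
        "f \<zeta> \<zeta> = (\<alpha> + \<zeta> + \<alpha> * \<theta> * \<zeta>) * d1 / d2"
        "f a \<zeta> = (\<alpha> + \<zeta> + \<alpha> * \<theta> * a) * d1 / d3"
        "f (a + \<zeta>) \<zeta> = (\<alpha> + \<zeta> + \<alpha> * \<theta> * (a + \<zeta>)) * d1 / d4"
        using f[OF a zeta_multiples_in(1)[of "num.Bit0 num.One"]] f[OF \<zeta>_in \<zeta>_in] f[OF a \<zeta>_in] f[OF add_in[OF a \<zeta>_in] \<zeta>_in]
        by (simp_all add: d1_def d2_def d3_def d4_def add.assoc mult_2[symmetric])
      note * = proportional[OF False nz a, unfolded this]
      have "(\<alpha> + \<zeta>) * (\<alpha> + 2 * \<zeta> + \<alpha> * \<theta> * a) * (\<alpha> + \<zeta> + \<alpha> * \<theta> * \<zeta>) * d3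
        = (\<alpha> + \<zeta>) * ((\<alpha> + 2 * \<zeta> + \<alpha> * \<theta> * a) * d2 / d4) * ((\<alpha> + \<zeta> + \<alpha> * \<theta> * \<zeta>) * d1 / d2) * (d3 * d4 / d1)"
        using d by simp
      also have "\<dots> = (\<alpha> + 2 * \<zeta>) * (\<alpha> + \<zeta> + \<alpha> * \<theta> * a) * (\<alpha> + \<zeta> + \<alpha> * \<theta> * (a + \<zeta>)) * d1"
        unfolding * using d by simp
      finally show ?thesis unfolding d1_def d3_def .
    qed
    from this[OF \<zeta>_in] this[OF zeta_multiples_in(1)[of "num.Bit0 num.One"]]
    have "2 * \<zeta>^4 * (\<alpha> * \<theta>^2 * (1 - \<alpha> * \<theta>)) = 0" and c1: "\<alpha> = 0 \<Longrightarrow> \<zeta>^4 * \<theta> = 0" by algebra+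
    then have "\<alpha> = 0" using \<zeta>_nz \<theta> by simp
    then show False using c1 \<zeta>_nz \<theta> by simp
  qed
  then show ?thesis using g_zero_if_g0_zero[OF _ ab] g0_scaled False by auto
next
  case True
  then have al: "\<alpha> = - \<zeta>" by algebra
  define \<beta> where "\<beta> = \<alpha> * \<theta>"
  \<comment> \<open>Clears the denominators of \<open>f\<close> in
    \<open>g0_cocycle\<close>.\<close>
  define h where "h c = (1 + \<theta> * (c + \<zeta>)) * g 0 c" for c
  have S: "1 + \<theta> * (c + \<zeta>) \<noteq> 0" if "c \<in> G" for c using \<theta>(3) that \<zeta>_in by (simp add: in_G)
  have "\<beta> \<noteq> 0" "\<beta> \<noteq> 1" using \<theta> al \<zeta>_nz by (simp_all add: \<beta>_def)
  have "\<beta> \<noteq> - 1"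
    using \<theta>(3)[OF zeta_multiples_in(2)] al unfolding \<beta>_def by (auto simp: algebra_simps)
  have heq: "(c - b) * h (b + c) = (c + \<beta> * b) * h c - (b + \<beta> * c) * h b" if bc: "b \<in> G" "c \<in> G" for b c
  proof -
    have "f b (c + \<zeta>) = (c + \<beta> * b) * (1 + \<theta> * (c + \<zeta>)) / (1 + \<theta> * (b + c + \<zeta>))"
      "f c (b + \<zeta>) = (b + \<beta> * c) * (1 + \<theta> * (b + \<zeta>)) / (1 + \<theta> * (b + c + \<zeta>))"
      using f[of b "c + \<zeta>"] f[of c "b + \<zeta>"] bc \<zeta>_in al by (simp_all add: in_G \<beta>_def add_ac)
    note * = g0_cocycle[OF bc, unfolded this]
    have "(c - b) * h (b + c) = (1 + \<theta> * (b + c + \<zeta>)) * ((c - b) * g 0 (b + c))" by (simp add: h_def)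
    also have "\<dots> = (c + \<beta> * b) * h c - (b + \<beta> * c) * h b"
      unfolding * h_def using S[OF add_in[OF bc]] by (simp add: right_diff_distrib)
    finally show ?thesis .
  qed
  have "f \<zeta> \<zeta> * g 0 0 = 0" using g0_scaled[OF \<zeta>_in] True by simp
  moreover have "f \<zeta> \<zeta> \<noteq> 0"
    using f[OF \<zeta>_in \<zeta>_in] \<theta>(3)[OF \<zeta>_in] S[OF \<zeta>_in] al \<zeta>_nz \<theta>(1) by simp
  ultimately have g00: "g 0 0 = 0" by simp
  then have h0: "h 0 = 0" by (simp add: h_def)
  have hh: "h a * h (a + \<zeta>) = 0" if "a \<in> G" for a
    using g0_comm[OF that] g00 by (auto simp: h_def)
  have odd: "h (- x) = - h x" if "x \<in> G" for x
  proof (cases "x = 0")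
    case False
    have "x * (1 - \<beta>) * (h x + h (- x)) = 0"
      using heq[OF neg_in[OF that] that] h0 by (simp add: algebra_simps)
    then show ?thesis using False \<open>\<beta> \<noteq> 1\<close> by (simp add: add_eq_0_iff)
  qed (simp add: h0)
  have vanish: "(2 + \<beta> * (1 - \<beta>)) * e^2 * h c = 0" if e: "e \<in> G" "h e = 0" and c: "c \<in> G" for e c
  proof -
    have "(c - e) * h (c + e) = (c + \<beta> * e) * h c"
      using heq[OF e(1) c] e(2) by (simp add: add.commute)
    moreover have "(c + 2 * e) * h c = (c + e - \<beta> * e) * h (c + e)"
      using heq[OF neg_in[OF e(1)] add_in[OF c e(1)]] odd[OF e(1)] e(2) by (simp add: algebra_simps)
    ultimately show ?thesis by algebra
  qed
  note z2 = zeta_multiples_in(1)[of "num.Bit0 num.One"] and z3 = zeta_multiples_in(1)[of "num.Bit1 num.One"]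
  have h12: "h \<zeta> = 0 \<or> h (2 * \<zeta>) = 0" using hh[OF \<zeta>_in] by simp
  have "h c = 0" if c: "c \<in> G" for c
  \<comment> \<open>One zero of \<open>h\<close> suffices unless
    \<open>(2 - \<beta>) * (1 + \<beta>) = 0\<close>. For \<beta> = 2 both \<open>h c = c\<close>
    and \<open>h c = c^3\<close> solve \<open>heq\<close>, so two zeros are needed;
    \<open>hh\<close> at \<zeta>, \<open>2 * \<zeta>\<close> and \<open>3 * \<zeta>\<close> provides
    them.\<close>
  proof (cases "\<beta> = 2")
    case False
    have "(2 + \<beta> * (1 - \<beta>)) = (2 - \<beta>) * (1 + \<beta>)" by algebra
    then have nz: "2 + \<beta> * (1 - \<beta>) \<noteq> 0" using False \<open>\<beta> \<noteq> - 1\<close> by (auto simp: add_eq_0_iff)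
    show ?thesis using h12 vanish[OF \<zeta>_in _ c] vanish[OF z2 _ c] nz \<zeta>_nz by auto
  next
    case True
    have h23: "h (2 * \<zeta>) * h (3 * \<zeta>) = 0" using hh[OF z2] by (simp add: algebra_simps)
    have h34: "h (3 * \<zeta>) * h (4 * \<zeta>) = 0" using hh[OF z3] by (simp add: algebra_simps)
    have e12: "\<zeta> * h (3 * \<zeta>) = 4 * \<zeta> * h (2 * \<zeta>) - 5 * \<zeta> * h \<zeta>"
      using heq[OF \<zeta>_in z2] True by (simp add: algebra_simps)
    have e13: "2 * \<zeta> * h (4 * \<zeta>) = 5 * \<zeta> * h (3 * \<zeta>) - 7 * \<zeta> * h \<zeta>"
      using heq[OF \<zeta>_in z3] True by (simp add: algebra_simps)
    have hz: "h \<zeta> = 0 \<and> h (2 * \<zeta>) = 0"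
    proof (cases "h \<zeta> = 0")
      case True
      then show ?thesis using e12 h23 \<zeta>_nz by auto
    next
      case False
      then have "h (2 * \<zeta>) = 0" using h12 by simp
      then have "\<zeta> * h (3 * \<zeta>) = \<zeta> * (- 5 * h \<zeta>)" using e12 by simp
      then have "h (3 * \<zeta>) = - 5 * h \<zeta>" using \<zeta>_nz unfolding mult_cancel_left by simp
      moreover have "h (4 * \<zeta>) = - 16 * h \<zeta>"
      proof -
        have "2 * \<zeta> * h (4 * \<zeta>) = 2 * \<zeta> * (- 16 * h \<zeta>)" using e13 calculation by simp
        then show ?thesis using \<zeta>_nz unfolding mult_cancel_left by simp
      qed
      ultimately show ?thesis using h34 False by simp
    qed
    have "(c - \<zeta>) * h (c + \<zeta>) = (c + 2 * \<zeta>) * h c"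
      using heq[OF \<zeta>_in c] hz True by (simp add: add.commute)
    moreover have "c * h (c + 2 * \<zeta>) = (c + 3 * \<zeta>) * h (c + \<zeta>)"
      using heq[OF \<zeta>_in add_in[OF c \<zeta>_in]] hz True by (simp add: algebra_simps)
    moreover have "(c - 2 * \<zeta>) * h (c + 2 * \<zeta>) = (c + 4 * \<zeta>) * h c"
      using heq[OF z2 c] hz True by (simp add: algebra_simps)
    ultimately have "12 * \<zeta>^3 * h c = 0" by algebra
    then show ?thesis using \<zeta>_nz by simp
  qed
  then have "g 0 c = 0" if "c \<in> G" for c using S[OF that] that by (auto simp: h_def)
  then show ?thesis using g_zero_if_g0_zero ab by blast
qed

lemma g_exceptional:
  assumes "\<alpha> \<in> G" "\<eta> \<noteq> 0"
    and f: "\<And>a b. a \<in> G \<Longrightarrow> b \<in> G \<Longrightarrow> f a b = \<alpha> + b + (if \<alpha> + a + b = 0 then \<eta> * a * b else 0)"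
    and ab: "a \<in> G" "b \<in> G"
  shows "g a b = 0"
proof -
  note z2 = zeta_multiples_in(1)[of "num.Bit0 num.One"] and z3 = zeta_multiples_in(1)[of "num.Bit1 num.One"]
    and z4 = zeta_multiples_in(1)[of "num.Bit0 (num.Bit0 num.One)"]
  have "g 0 c = 0" if c: "c \<in> G" for c
  proof (cases "\<alpha> + \<zeta> = 0")
    case False
    have "g 0 0 = 0"
    proof (rule ccontr)
      assume nz: "g 0 0 \<noteq> 0"
      \<comment> \<open>Puts the pair \<open>a\<close>, \<zeta> on the exceptional level, so that
        \<eta> enters \<open>proportional\<close>.\<close>
      define a where "a = - \<alpha> - \<zeta>"
      have a: "a \<in> G" using \<open>\<alpha> \<in> G\<close> \<zeta>_in by (simp add: a_def in_G)
      show False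
      proof (cases "\<alpha> + 2 * \<zeta> = 0")
        \<comment> \<open>Both sides of \<open>proportional\<close> vanish if
          \<open>\<alpha> = - 2 * \<zeta>\<close>. Instead \<open>g_comm\<close> is used at
          \<open>- 2 * \<zeta>\<close>, 0, \<open>2 * \<zeta>\<close>; \<eta> enters through the
          pair \<open>- 2 * \<zeta>\<close>, \<open>4 * \<zeta>\<close>, which lies on the
          exceptional level.\<close>
        case True
        then have al: "\<alpha> = - 2 * \<zeta>" by algebra
        define y where "y = g 0 0"
        have g0': "g 0 x = y" if x: "x \<in> G" "x \<noteq> \<zeta>" for x
        proof -
          have "\<alpha> + x + \<zeta> \<noteq> 0" using x(2) unfolding al by simp
          then have "- \<zeta> * g 0 x = - \<zeta> * y"
            using g0_scaled[OF x(1)] f[OF x(1) \<zeta>_in] unfolding y_def al by simp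
          then show ?thesis using \<zeta>_nz by simp
        qed
        have "f \<zeta> \<zeta> = - \<zeta> + \<eta> * \<zeta> * \<zeta>" using f[OF \<zeta>_in \<zeta>_in] unfolding al by simp
        then have "\<zeta> * g 0 \<zeta> = \<zeta> * (y * (1 - \<eta> * \<zeta>))"
          using g0_scaled[OF \<zeta>_in] unfolding y_def al by algebra
        then have g01: "g 0 \<zeta> = y * (1 - \<eta> * \<zeta>)" using \<zeta>_nz unfolding mult_cancel_left by simp
        have m2: "- (2 * \<zeta>) \<in> G" using z2 by (rule neg_in)
        have fz: "f (- (2 * \<zeta>)) (3 * \<zeta>) = \<zeta>" "f (- (2 * \<zeta>)) (2 * \<zeta>) = 0"
          "f (- (2 * \<zeta>)) (4 * \<zeta>) = 2 * \<zeta> - 8 * \<eta> * \<zeta>\<^sup>2"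
          using f[OF m2 z3] f[OF m2 z2] f[OF m2 z4] \<zeta>_nz by (simp_all add: al power2_eq_square)
        have gz: "g 0 \<zeta> = y * (1 - \<eta> * \<zeta>)" "g 0 (2 * \<zeta>) = y" "g 0 (3 * \<zeta>) = y" "g 0 0 = y"
          using g01 g0'[OF z2] g0'[OF z3] \<zeta>_nz by (simp_all add: y_def)
        have "\<zeta> * g (- (2 * \<zeta>)) (2 * \<zeta>) = \<zeta> * y"
          using g_from_g0[OF m2 z2] by (simp add: fz gz)
        then have 1: "g (- (2 * \<zeta>)) (2 * \<zeta>) = y" using \<zeta>_nz by simp
        have 2: "\<zeta> * g (- (2 * \<zeta>)) (3 * \<zeta>) = (2 * \<zeta> - 8 * \<eta> * \<zeta>\<^sup>2) * y - \<zeta> * (y * (1 - \<eta> * \<zeta>))"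
          using g_from_g0[OF m2 z3] by (simp add: fz gz)
        have 3: "y * g (- (2 * \<zeta>)) (3 * \<zeta>) = y * (y * (1 - \<eta> * \<zeta>))"
          using g_comm[OF m2 zero_in z2] by (simp add: gz 1)
        have "6 * \<eta> * \<zeta>\<^sup>2 * y\<^sup>2 = 0" using 2 3 by algebra
        then show False using \<open>\<eta> \<noteq> 0\<close> \<zeta>_nz nz by (simp add: y_def)
      next
        case 2: False
        have "f a \<zeta> = (\<alpha> + \<zeta>) * (1 - \<eta> * \<zeta>)" "f (a + \<zeta>) \<zeta> = \<alpha> + \<zeta>" "f a (2 * \<zeta>) = \<alpha> + 2 * \<zeta>" "f \<zeta> \<zeta> = \<alpha> + \<zeta>"
          using f[OF a \<zeta>_in] f[OF add_in[OF a \<zeta>_in] \<zeta>_in] f[OF a z2] f[OF \<zeta>_in \<zeta>_in] \<zeta>_nz 2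
          by (simp_all add: a_def algebra_simps)
        then have "(\<alpha> + \<zeta>)^2 * ((\<alpha> + 2 * \<zeta>) * (\<eta> * \<zeta>)) = 0"
          using proportional[OF False nz a] by algebra
        then show False using False 2 \<zeta>_nz \<open>\<eta> \<noteq> 0\<close> by simp
      qed
    qed
    then show ?thesis using g0_scaled[OF c] False by simp
  next
    case True
    then have al: "\<alpha> = - \<zeta>" by algebra
    obtain p q where pq: "\<And>x. x \<in> G \<Longrightarrow> x \<noteq> 0 \<Longrightarrow> g 0 x = p + q * x"
    proof (rule affine_if_weighted_additive[OF \<zeta>_in \<zeta>_nz])
      fix a b assume ab: "a \<in> G" "b \<in> G" "a + b \<noteq> 0"
      then have "f b (a + \<zeta>) = a" "f a (b + \<zeta>) = b"
        using f[OF ab(2) add_in[OF ab(1) \<zeta>_in]] f[OF ab(1) add_in[OF ab(2) \<zeta>_in]] by (simp_all add: al add.commute)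
      then show "(a - b) * g 0 (a + b) = a * g 0 a - b * g 0 b"
        using g0_cocycle[OF ab(2,1)] by (simp add: add.commute)
    qed (rule that)
    have g00: "g 0 0 = p * (1 - \<eta> * \<zeta>) - \<eta> * q * x\<^sup>2" if x: "x \<in> G" "x \<noteq> 0" for x
    proof -
      have mx: "- x \<in> G" using x by (simp add: in_G)
      have "f (- x) (x + \<zeta>) = x - \<eta> * x * (x + \<zeta>)" "f x (- x + \<zeta>) = - x + \<eta> * x * (- x + \<zeta>)"
        using f[OF mx add_in[OF x(1) \<zeta>_in]] f[OF x(1) add_in[OF mx \<zeta>_in]] by (simp_all add: al)
      then have "2 * x * g 0 0 = (x - \<eta> * x * (x + \<zeta>)) * (p + q * x) - (- x + \<eta> * x * (- x + \<zeta>)) * (p - q * x)"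
        using g0_cocycle[OF mx x(1)] pq[OF x] pq[OF mx] x by simp
      then have "2 * x * (g 0 0 - (p * (1 - \<eta> * \<zeta>) - \<eta> * q * x\<^sup>2)) = 0" by algebra
      then show ?thesis using x by simp
    qed
    have "3 * \<zeta>\<^sup>2 * (\<eta> * q) = 0" using g00[OF \<zeta>_in \<zeta>_nz] g00[OF z2] \<zeta>_nz by (simp add: algebra_simps)
    then have q: "q = 0" using \<zeta>_nz \<open>\<eta> \<noteq> 0\<close> by simp
    have "\<zeta> * g (2 * \<zeta>) \<zeta> = \<zeta> * p"
      using g_from_g0[OF z2 \<zeta>_in] f[OF z2 z2] f[OF z2 \<zeta>_in] pq[OF \<zeta>_in \<zeta>_nz] \<zeta>_nz by (simp add: al q)
    then have "g (2 * \<zeta>) \<zeta> = p" using \<zeta>_nz by simp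
    then have "p * (1 - \<eta> * \<zeta>) * p = p * p"
      using g0_comm[OF z2] pq[OF z2] pq[OF z3] g00[OF \<zeta>_in \<zeta>_nz] \<zeta>_nz by (simp add: q)
    then have "p\<^sup>2 * (\<eta> * \<zeta>) = 0" by algebra
    then have "p = 0" using \<zeta>_nz \<open>\<eta> \<noteq> 0\<close> by simp
    then show ?thesis using pq[OF c] g00[OF \<zeta>_in \<zeta>_nz] q by (cases "c = 0") auto
  qed
  then show ?thesis using g_zero_if_g0_zero ab by blast
qed

end

section \<open>Structure constants\<close>

definition basis :: "complex \<Rightarrow> complex \<Rightarrow> complex" where
  "basis a = (\<lambda>d. if d = a then 1 else 0)"

lemma supp_basis [simp]: "supp (basis a) = {a}"
  by (auto simp: supp_def basis_def)

lemma basis_in_Wsp: "a \<in> G \<Longrightarrow> basis a \<in> Wsp G"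
  by (simp add: Wsp_def)

lemma mulsc_basis: "mulsc sc (basis a) (basis b) = sc a b"
  by (simp add: mulsc_def) (simp add: basis_def)

lemma mulsc_basis_right:
  assumes "finite S" "supp x \<subseteq> S"
  shows "mulsc sc x (basis c) d = (\<Sum>p\<in>S. x p * sc p c d)"
proof -
  have "mulsc sc x (basis c) d = (\<Sum>p\<in>supp x. x p * sc p c d)"
    by (simp add: mulsc_def) (simp add: basis_def)
  also have "\<dots> = (\<Sum>p\<in>S. x p * sc p c d)"
    by (rule sum.mono_neutral_left) (use assms in \<open>auto simp: supp_def\<close>)
  finally show ?thesis .
qed

lemma mulsc_basis_left:
  assumes "finite S" "supp x \<subseteq> S"
  shows "mulsc sc (basis c) x d = (\<Sum>p\<in>S. x p * sc c p d)"
proof -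
  have "mulsc sc (basis c) x d = (\<Sum>p\<in>supp x. x p * sc c p d)"
    by (simp add: mulsc_def) (simp add: basis_def)
  also have "\<dots> = (\<Sum>p\<in>S. x p * sc c p d)"
    by (rule sum.mono_neutral_left) (use assms in \<open>auto simp: supp_def\<close>)
  finally show ?thesis .
qed

lemma mulsc_fg_triple:
  fixes f g :: "complex \<Rightarrow> complex \<Rightarrow> complex"
  assumes "\<zeta> \<noteq> 0"
  defines "sc \<equiv> fg_sc \<zeta> f g"
  shows "mulsc sc (mulsc sc (basis a) (basis b)) (basis c) d
      = f a b * sc (a + b) c d + g a b * sc (a + b + \<zeta>) c d"
    and "mulsc sc (basis a) (mulsc sc (basis b) (basis c)) d
      = f b c * sc a (b + c) d + g b c * sc a (b + c + \<zeta>) d"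
proof -
  have supp: "supp (sc x y) \<subseteq> {x + y, x + y + \<zeta>}" for x y
    by (auto simp: supp_def sc_def fg_sc_def)
  have val: "sc x y (x + y) = f x y" "sc x y (x + y + \<zeta>) = g x y" for x y
    using assms(1) by (simp_all add: sc_def fg_sc_def)
  show "mulsc sc (mulsc sc (basis a) (basis b)) (basis c) d
      = f a b * sc (a + b) c d + g a b * sc (a + b + \<zeta>) c d"
    unfolding mulsc_basis using assms(1) by (simp add: mulsc_basis_right[OF _ supp] val)
  show "mulsc sc (basis a) (mulsc sc (basis b) (basis c)) d
      = f b c * sc a (b + c) d + g b c * sc a (b + c + \<zeta>) d"
    unfolding mulsc_basis using assms(1) by (simp add: mulsc_basis_left[OF _ supp] val)
qed

text \<open>Left symmetry on basis vectors has coefficients in degrees \<open>a + b + c\<close>,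
  \<open>a + b + c + \<zeta>\<close> and \<open>a + b + c + 2 * \<zeta>\<close>, distinct because
  \<zeta> \<noteq> 0. They give in turn the equation for \<open>f\<close>, the cocycle equation and
  the quadratic equation.\<close>

lemma shifted_clsas_if_CLSAS:
  assumes "add_subgroup G" "\<zeta> \<in> G" "\<zeta> \<noteq> 0" and C: "CLSAS G (fg_sc \<zeta> f g)"
  shows "shifted_clsas G f g \<zeta>"
proof -
  interpret add_subgroup G by fact
  let ?sc = "fg_sc \<zeta> f g"
  have comm: "?sc a b d - ?sc b a d = witt_sc a b d" if "a \<in> G" "b \<in> G" for a b d
    using C basis_in_Wsp[OF that(1)] basis_in_Wsp[OF that(2)] unfolding CLSAS_def by (metis mulsc_basis)
  have lie: "f a b - f b a = b - a" and sym: "g a b = g b a" if "a \<in> G" "b \<in> G" for a b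
    using comm[OF that, of "a + b"] comm[OF that, of "a + b + \<zeta>"] \<open>\<zeta> \<noteq> 0\<close>
    by (simp_all add: fg_sc_def witt_sc_def add.commute[of b a])
  have assoc: "f a b * ?sc (a + b) c d + g a b * ?sc (a + b + \<zeta>) c d
      - (f b c * ?sc a (b + c) d + g b c * ?sc a (b + c + \<zeta>) d)
    = f b a * ?sc (b + a) c d + g b a * ?sc (b + a + \<zeta>) c d
      - (f a c * ?sc b (a + c) d + g a c * ?sc b (a + c + \<zeta>) d)"
    if "a \<in> G" "b \<in> G" "c \<in> G" for a b c d
    using C basis_in_Wsp[OF that(1)] basis_in_Wsp[OF that(2)] basis_in_Wsp[OF that(3)]
    unfolding CLSAS_def mulsc_fg_triple[OF \<open>\<zeta> \<noteq> 0\<close>, symmetric] by blast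
  have left_sym: "(b - a) * f (a + b) c = f b c * f a (b + c) - f a c * f b (a + c)"
    if abc: "a \<in> G" "b \<in> G" "c \<in> G" for a b c
  proof -
    have "f a b * f (a + b) c - f b c * f a (b + c) = f b a * f (a + b) c - f a c * f b (a + c)"
      using assoc[OF abc, of "a + b + c"] \<open>\<zeta> \<noteq> 0\<close>
      by (simp add: fg_sc_def add.commute[of b a] add.assoc add.left_commute[of b a])
    then show ?thesis unfolding lie[OF abc(1,2), symmetric] by (simp add: algebra_simps)
  qed
  have cocycle: "(b - a) * g (a + b) c = f b c * g a (b + c) + g b c * f a (b + c + \<zeta>)
      - f a c * g b (a + c) - g a c * f b (a + c + \<zeta>)"
    if abc: "a \<in> G" "b \<in> G" "c \<in> G" for a b c
  proof -
    have eqs: "a + b + \<zeta> + c = a + b + c + \<zeta>" "a + (b + c + \<zeta>) = a + b + c + \<zeta>" "b + (a + c + \<zeta>) = a + b + c + \<zeta>"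
      "a + (b + c) = a + b + c" "b + (a + c) = a + b + c" "b + a = a + b" by simp_all
    have "f a b * g (a + b) c + g a b * f (a + b + \<zeta>) c - (f b c * g a (b + c) + g b c * f a (b + c + \<zeta>))
      = f b a * g (a + b) c + g b a * f (a + b + \<zeta>) c - (f a c * g b (a + c) + g a c * f b (a + c + \<zeta>))"
      using assoc[OF abc, of "a + b + c + \<zeta>"] \<open>\<zeta> \<noteq> 0\<close> unfolding fg_sc_def eqs by simp
    then show ?thesis unfolding lie[OF abc(1,2), symmetric] sym[OF abc(1,2)] by (simp add: algebra_simps)
  qed
  have g_comm: "g b c * g a (b + c + \<zeta>) = g a c * g b (a + c + \<zeta>)"
    if abc: "a \<in> G" "b \<in> G" "c \<in> G" for a b c
  proof -
    have eqs: "a + b + \<zeta> + c = a + b + c + \<zeta>" "a + (b + c + \<zeta>) = a + b + c + \<zeta>" "b + (a + c + \<zeta>) = a + b + c + \<zeta>"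
      "a + (b + c) = a + b + c" "b + (a + c) = a + b + c" "b + a = a + b" by simp_all
    have "a + b + c + \<zeta> + \<zeta> \<noteq> a + b + c" using \<open>\<zeta> \<noteq> 0\<close> by (simp add: add.assoc flip: mult_2)
    then have "g a b * g (a + b + \<zeta>) c - g b c * g a (b + c + \<zeta>) = g b a * g (a + b + \<zeta>) c - g a c * g b (a + c + \<zeta>)"
      using assoc[OF abc, of "a + b + c + \<zeta> + \<zeta>"] \<open>\<zeta> \<noteq> 0\<close> unfolding fg_sc_def eqs by simp
    then show ?thesis unfolding sym[OF abc(1,2)] by simp
  qed
  show ?thesis
    by unfold_locales (use assms lie left_sym sym cocycle g_comm in \<open>simp_all\<close>)
qed

lemma iso_alg_if_sc_eq:
  assumes "\<And>a b d. a \<in> G \<Longrightarrow> b \<in> G \<Longrightarrow> sc1 a b d = sc2 a b d"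
  shows "iso_alg G sc1 sc2"
proof -
  have "mulsc sc1 x y = mulsc sc2 x y" if "x \<in> Wsp G" "y \<in> Wsp G" for x y
  proof
    fix d
    show "mulsc sc1 x y d = mulsc sc2 x y d"
      unfolding mulsc_def using that
      by (intro sum.cong refl arg_cong2[where f = "(*)"] assms) (auto simp: Wsp_def)
  qed
  then show ?thesis unfolding iso_alg_def by (intro exI[of _ id]) auto
qed

theorem theorem4p7:
  fixes G :: "complex set" and \<zeta> :: complex and f g :: "complex \<Rightarrow> complex \<Rightarrow> complex"
  assumes "free_subgroup_rank_gt1 G"
    and "\<zeta> \<in> G" and "\<zeta> \<noteq> 0"
    and "CLSAS G (fg_sc \<zeta> f g)"
  shows "(\<exists>\<alpha> \<theta>. (\<theta> = 0 \<or> inverse \<theta> \<notin> G) \<and> iso_alg G (fg_sc \<zeta> f g) (V_sc \<alpha> \<theta>))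
       \<or> (\<exists>\<gamma> lam. lam \<in> G \<and> lam \<noteq> \<gamma> \<and> iso_alg G (fg_sc \<zeta> f g) (Vup_sc \<gamma> lam))
       \<or> (\<exists>\<alpha> \<mu>. iso_alg G (fg_sc \<zeta> f g) (Wamz_sc \<alpha> \<mu> \<zeta>))"
proof -
  have "add_subgroup G"
    using assms(1) unfolding free_subgroup_rank_gt1_def by unfold_locales blast+
  from shifted_clsas_if_CLSAS[OF this assms(2-4)] interpret shifted_clsas G f g \<zeta> .
  from assms(2,3) show ?thesis
  proof (cases rule: graded_classification)
    case translation
    then obtain \<mu> where "\<And>a b. a \<in> G \<Longrightarrow> b \<in> G \<Longrightarrow> g a b = \<mu>" using g_translation by blast
    then have "iso_alg G (fg_sc \<zeta> f g) (Wamz_sc \<alpha> \<mu> \<zeta>)"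
      using translation by (intro iso_alg_if_sc_eq) (simp add: fg_sc_def Wamz_sc_def)
    then show ?thesis by blast
  next
    case (generic \<theta>)
    have "inverse \<theta> \<notin> G"
    proof
      assume "inverse \<theta> \<in> G"
      then show False using generic(3)[of "- inverse \<theta>"] generic(1) by (simp add: in_G)
    qed
    moreover have "g a b = 0" if "a \<in> G" "b \<in> G" for a b
      by (rule g_generic[OF generic that])
    then have "iso_alg G (fg_sc \<zeta> f g) (V_sc \<alpha> \<theta>)"
      using generic(4) by (intro iso_alg_if_sc_eq) (simp add: fg_sc_def V_sc_def)
    ultimately show ?thesis by blast
  next
    case (exceptional \<eta>)
    have "g a b = 0" if "a \<in> G" "b \<in> G" for a b
      by (rule g_exceptional[OF exceptional that])
    \<comment> \<open>The parameters are \<open>lam = \<alpha>\<close> and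
      \<open>\<gamma> = \<alpha> + 1 / \<eta>\<close>: on the level
      \<open>a = - (\<alpha> + b)\<close>, the left side is
      \<open>(\<alpha> + b) * (1 - \<eta> * b)\<close>.\<close>
    moreover have "\<alpha> + b + \<eta> * a * b = (\<alpha> + b) * (\<alpha> + 1 / \<eta> - \<alpha> - b) / (\<alpha> + 1 / \<eta> - \<alpha>)"
      if "\<alpha> + a + b = 0" for a b
    proof -
      have a: "a = - (\<alpha> + b)" using that by algebra
      show ?thesis unfolding a using exceptional(2) by (simp add: field_simps)
    qed
    ultimately have "iso_alg G (fg_sc \<zeta> f g) (Vup_sc (\<alpha> + 1 / \<eta>) \<alpha>)"
      using exceptional(3) by (intro iso_alg_if_sc_eq) (auto simp: fg_sc_def Vup_sc_def)
    moreover have "\<alpha> \<noteq> \<alpha> + 1 / \<eta>" using exceptional(2) by simp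
    ultimately show ?thesis using exceptional(1) by blast
  qed
qed

end
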